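(* Let $(Q,I)$ be a locally gentle quiver, with corresponding algebra $A=KQ/I$, considered with the natural grading given by path lengths. For any vertex $i$ in $Q$, consider the (at most) two paths in $Q$ with full relations starting in $i$; denote the vertices on these paths by $i,i_1,i_2,\ldots$ and by $i,j_1,j_2,\ldots$, respectively. Then the corresponding simple module $E_i$ has a graded projective resolution of the form $$\ldots\to (P^{i_2}\oplus P^{j_2})\langle 2\rangle \to (P^{i_1}\oplus P^{j_1})\langle 1\rangle \to P^i \to E_i\to 0.$$ In particular, with the grading by path lengths, any locally gentle algebra $A$ is Koszul.
   Context: A quiver $Q$ is a directed graph with finitely many vertices (set $Q_0$) and finitely many arrows (set $Q_1$); loops and multiple arrows are allowed. For a path $p$, $s(p)$ and $t(p)$ are its start and end vertices; paths are written from left to right, so in the path algebra $KQ$ over a field $K$ the product $pq$ is the concatenation if $t(p)=s(q)$ and $0$ otherwise. For each vertex $i$ there is a trivial path $e_i$ of length $0$. An ideal $I\subseteq KQ$ is admissible if it is contained in the square of the ideal generated by the arrows. Locally gentle quiver: a pair $(Q,I)$ with $I$ an admissible ideal of $KQ$ such that: (G2) each vertex of $Q$ is the starting point of at most two arrows and the end point of at most two arrows; (G3) for each arrow $\alpha$ there is at most one arrow $\beta$ such that $\alpha\beta\notin I$, and at most one arrow $\gamma$ such that $\gamma\alpha\notin I$; (G4) $I$ is generated by paths of length $2$; (G5) for each arrow $\alpha$ there is at most one arrow $\beta'$ with $t(\alpha)=s(\beta')$ and $\alpha\beta'\in I$, and at most one arrow $\gamma'$ with $t(\gamma')=s(\alpha)$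 and $\gamma'\alpha\in I$. The algebra $A=KQ/I$ is then called a locally gentle algebra. Paths with full relations starting in $i$: for each arrow $\alpha_1$ with $s(\alpha_1)=i$ (there are at most two), the maximal, possibly infinite, path $\alpha_1\alpha_2\alpha_3\cdots$ with $\alpha_k\alpha_{k+1}\in I$ for all $k$ (unique by (G5)); its vertices are $i,t(\alpha_1),t(\alpha_2),\ldots$. If a path is finite or absent, the corresponding missing summands in the resolution are $0$. Modules: $P^i=e_iA$ is the indecomposable projective right $A$-module attached to $i$, graded by path length, and $E_i$ is the one-dimensional simple right module at $i$, placed in degree $0$. For a graded module $M=\bigoplus_i M_i$, the shift is $(M\langle n\rangle)_i=M_{i-n}$. Koszul: a positively graded algebra $A=\bigoplus_{i\ge0}A_i$ is Koszul if $A_0$ is semisimple and the graded left $A$-module $A_0$ admits a graded projective resolution $\ldots\to P^2\to P^1\to P^0\to A_0\to0$ such that each $P^i$ is generated by its component in degree $i$, i.e. $P^i=AP^i_i$ (in this definition $P^i$ denotes the $i$-th term of the resolution). *)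

theory Defs
  imports "HOL-Algebra.Module" "HOL-Algebra.QuotRing" "HOL-Algebra.Ideal_Product" "Graph_Theory.Arc_Walk"
begin

section \<open>Modules over a noncommutative ring\<close>

text \<open>
  The locale \<^locale>\<open>module\<close> is restricted to commutative rings, so left modules over an arbitrary
  ring are introduced here, on the same record type.  As there, the fields \<^const>\<open>mult\<close> and
  \<^const>\<open>one\<close> of a module record carry no information.  Right modules over \<open>R\<close> are left modules
  over \<open>opp_ring R\<close>.
\<close>

definition opp_ring :: "('a, 'm) ring_scheme \<Rightarrow> ('a, 'm) ring_scheme" where
  "opp_ring R = R\<lparr>mult := \<lambda>x y. y \<otimes>\<^bsub>R\<^esub> x\<rparr>"

locale left_module = R?: ring R + M?: abelian_group M
  for R :: "('a, 'r) ring_scheme" (structure) and M :: "('a, 'b, 'm) module_scheme" (structure) +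
  assumes smult_closed:
      "\<lbrakk>a \<in> carrier R; x \<in> carrier M\<rbrakk> \<Longrightarrow> a \<odot>\<^bsub>M\<^esub> x \<in> carrier M"
    and smult_l_distr:
      "\<lbrakk>a \<in> carrier R; b \<in> carrier R; x \<in> carrier M\<rbrakk> \<Longrightarrow>
        (a \<oplus> b) \<odot>\<^bsub>M\<^esub> x = a \<odot>\<^bsub>M\<^esub> x \<oplus>\<^bsub>M\<^esub> b \<odot>\<^bsub>M\<^esub> x"
    and smult_r_distr:
      "\<lbrakk>a \<in> carrier R; x \<in> carrier M; y \<in> carrier M\<rbrakk> \<Longrightarrow>
        a \<odot>\<^bsub>M\<^esub> (x \<oplus>\<^bsub>M\<^esub> y) = a \<odot>\<^bsub>M\<^esub> x \<oplus>\<^bsub>M\<^esub> a \<odot>\<^bsub>M\<^esub> y"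
    and smult_assoc1:
      "\<lbrakk>a \<in> carrier R; b \<in> carrier R; x \<in> carrier M\<rbrakk> \<Longrightarrow>
        (a \<otimes> b) \<odot>\<^bsub>M\<^esub> x = a \<odot>\<^bsub>M\<^esub> (b \<odot>\<^bsub>M\<^esub> x)"
    and smult_one:
      "x \<in> carrier M \<Longrightarrow> \<one> \<odot>\<^bsub>M\<^esub> x = x"

definition module_hom ::
  "('a, 'r) ring_scheme \<Rightarrow> ('a, 'b, 'm) module_scheme \<Rightarrow> ('a, 'c, 'n) module_scheme \<Rightarrow> ('b \<Rightarrow> 'c) set"
where
  "module_hom R M N =
    {f \<in> hom (add_monoid M) (add_monoid N).
      \<forall>a\<in>carrier R. \<forall>x\<in>carrier M. f (a \<odot>\<^bsub>M\<^esub> x) = a \<odot>\<^bsub>N\<^esub> f x}"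

definition regular_module :: "('a, 'm) ring_scheme \<Rightarrow> ('a, 'a) module" where
  "regular_module R =
    \<lparr>carrier = carrier R, mult = mult R, one = one R, zero = zero R, add = add R, smult = mult R\<rparr>"

text \<open>External direct sum: families of finite support.\<close>

definition direct_sum :: "'j set \<Rightarrow> ('j \<Rightarrow> ('a, 'b, 'm) module_scheme) \<Rightarrow> ('a, 'j \<Rightarrow> 'b) module" where
  "direct_sum J M =
    \<lparr>carrier = {f \<in> (\<Pi>\<^sub>E j\<in>J. carrier (M j)). finite {j \<in> J. f j \<noteq> \<zero>\<^bsub>M j\<^esub>}},
     mult = undefined, one = undefined,
     zero = (\<lambda>j\<in>J. \<zero>\<^bsub>M j\<^esub>),
     add = (\<lambda>f g. \<lambda>j\<in>J. f j \<oplus>\<^bsub>M j\<^esub> g j),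
     smult = (\<lambda>a f. \<lambda>j\<in>J. a \<odot>\<^bsub>M j\<^esub> f j)\<rparr>"

text \<open>
  Projective means: direct summand of a free module.  Taking the basis of the free module in the
  type of \<open>P\<close> is no restriction, as the elements of \<open>P\<close> generate \<open>P\<close>.
\<close>

definition projective_module :: "('a, 'r) ring_scheme \<Rightarrow> ('a, 'b, 'm) module_scheme \<Rightarrow> bool" where
  "projective_module R P \<longleftrightarrow> left_module R P \<and>
    (\<exists>(X :: 'b set) s r.
      s \<in> module_hom R P (direct_sum X (\<lambda>_. regular_module R)) \<and>
      r \<in> module_hom R (direct_sum X (\<lambda>_. regular_module R)) P \<and>
      (\<forall>x\<in>carrier P. r (s x) = x))"

text \<open>Internal direct sums; \<open>J\<close> and \<open>G\<close> are the index set and the family of summands.\<close>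

definition is_decomposition ::
  "('b, 'm) ring_scheme \<Rightarrow> 'j set \<Rightarrow> ('j \<Rightarrow> 'b set) \<Rightarrow> 'b \<Rightarrow> ('j \<Rightarrow> 'b) \<Rightarrow> bool"
where
  "is_decomposition M J G x f \<longleftrightarrow>
    f \<in> (\<Pi>\<^sub>E j\<in>J. G j) \<and> finite {j \<in> J. f j \<noteq> \<zero>\<^bsub>M\<^esub>} \<and>
    x = (\<Oplus>\<^bsub>M\<^esub>j\<in>{j \<in> J. f j \<noteq> \<zero>\<^bsub>M\<^esub>}. f j)"

definition is_direct_sum :: "('b, 'm) ring_scheme \<Rightarrow> 'j set \<Rightarrow> ('j \<Rightarrow> 'b set) \<Rightarrow> bool" where
  "is_direct_sum M J G \<longleftrightarrow>
    (\<forall>j\<in>J. additive_subgroup (G j) M) \<and>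
    (\<forall>x\<in>carrier M. \<exists>!f. is_decomposition M J G x f)"

definition simple_submodule :: "'b set \<Rightarrow> ('a, 'r) ring_scheme \<Rightarrow> ('a, 'b, 'm) module_scheme \<Rightarrow> bool"
where
  "simple_submodule N R M \<longleftrightarrow> submodule N R M \<and> N \<noteq> {\<zero>\<^bsub>M\<^esub>} \<and>
    (\<forall>L. submodule L R M \<and> L \<subseteq> N \<longrightarrow> L = {\<zero>\<^bsub>M\<^esub>} \<or> L = N)"

definition semisimple_module :: "('a, 'r) ring_scheme \<Rightarrow> ('a, 'b, 'm) module_scheme \<Rightarrow> bool" where
  "semisimple_module R M \<longleftrightarrow> left_module R M \<and>
    (\<exists>S. (\<forall>N\<in>S. simple_submodule N R M) \<and> is_direct_sum M S (\<lambda>N. N))"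

definition semisimple_ring :: "('a, 'r) ring_scheme \<Rightarrow> bool" where
  "semisimple_ring R \<longleftrightarrow> ring R \<and> semisimple_module R (regular_module R)"


section \<open>Graded rings and graded modules\<close>

text \<open>
  The grading of a positively graded ring is given separately from the ring, as the family
  \<open>G\<close> of its homogeneous components.  Modules are graded by the integers.
\<close>

definition graded_ring :: "('a, 'r) ring_scheme \<Rightarrow> (nat \<Rightarrow> 'a set) \<Rightarrow> bool" where
  "graded_ring R G \<longleftrightarrow> ring R \<and> is_direct_sum R UNIV G \<and>
    (\<forall>m n. \<forall>a\<in>G m. \<forall>b\<in>G n. a \<otimes>\<^bsub>R\<^esub> b \<in> G (m + n))"

definition homogeneous_part ::
  "('a, 'r) ring_scheme \<Rightarrow> (nat \<Rightarrow> 'a set) \<Rightarrow> nat \<Rightarrow> 'a \<Rightarrow> 'a"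
where
  "homogeneous_part R G n a = (THE f. is_decomposition R UNIV G a f) n"

record ('a, 'b) graded_module = "('a, 'b) module" +
  grade :: "int \<Rightarrow> 'b set"

definition graded_by :: "('a, 'b, 'm) module_scheme \<Rightarrow> (int \<Rightarrow> 'b set) \<Rightarrow> ('a, 'b) graded_module" where
  "graded_by M H =
    \<lparr>carrier = carrier M, mult = mult M, one = one M, zero = zero M, add = add M,
     smult = smult M, grade = H\<rparr>"

definition is_graded_module ::
  "('a, 'r) ring_scheme \<Rightarrow> (nat \<Rightarrow> 'a set) \<Rightarrow> ('a, 'b) graded_module \<Rightarrow> bool"
where
  "is_graded_module R G M \<longleftrightarrow> graded_ring R G \<and> left_module R M \<and> is_direct_sum M UNIV (grade M) \<and>
    (\<forall>m n. \<forall>a\<in>G m. \<forall>x\<in>grade M n. a \<odot>\<^bsub>M\<^esub> x \<in> grade M (int m + n))"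

definition shift :: "int \<Rightarrow> ('a, 'b) graded_module \<Rightarrow> ('a, 'b) graded_module" where
  "shift n M = M\<lparr>grade := \<lambda>k. grade M (k - n)\<rparr>"

definition graded_direct_sum ::
  "'j set \<Rightarrow> ('j \<Rightarrow> ('a, 'b) graded_module) \<Rightarrow> ('a, 'j \<Rightarrow> 'b) graded_module"
where
  "graded_direct_sum J M = graded_by (direct_sum J M)
    (\<lambda>k. {f \<in> carrier (direct_sum J M). \<forall>j\<in>J. f j \<in> grade (M j) k})"

definition graded_hom ::
  "('a, 'r) ring_scheme \<Rightarrow> ('a, 'b) graded_module \<Rightarrow> ('a, 'c) graded_module \<Rightarrow> ('b \<Rightarrow> 'c) set"
where
  "graded_hom R M N = {f \<in> module_hom R M N. \<forall>k. f ` grade M k \<subseteq> grade N k}"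

definition graded_iso ::
  "('a, 'r) ring_scheme \<Rightarrow> ('a, 'b) graded_module \<Rightarrow> ('a, 'c) graded_module \<Rightarrow> bool"
where
  "graded_iso R M N \<longleftrightarrow>
    (\<exists>f\<in>graded_hom R M N. bij_betw f (carrier M) (carrier N) \<and> (\<forall>k. f ` grade M k = grade N k))"

text \<open>The complex \<open>\<dots> \<rightarrow> P 2 \<rightarrow> P 1 \<rightarrow> P 0 \<rightarrow> M \<rightarrow> 0\<close> with maps \<open>d n : P (n + 1) \<rightarrow> P n\<close> and \<open>\<epsilon> : P 0 \<rightarrow> M\<close>.\<close>

definition graded_projective_resolution ::
  "('a, 'r) ring_scheme \<Rightarrow> (nat \<Rightarrow> 'a set) \<Rightarrow> (nat \<Rightarrow> ('a, 'b) graded_module) \<Rightarrow>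
    (nat \<Rightarrow> 'b \<Rightarrow> 'b) \<Rightarrow> ('b \<Rightarrow> 'c) \<Rightarrow> ('a, 'c) graded_module \<Rightarrow> bool"
where
  "graded_projective_resolution R G P d \<epsilon> M \<longleftrightarrow>
    is_graded_module R G M \<and>
    (\<forall>n. is_graded_module R G (P n) \<and> projective_module R (P n)) \<and>
    (\<forall>n. d n \<in> graded_hom R (P (Suc n)) (P n)) \<and>
    \<epsilon> \<in> graded_hom R (P 0) M \<and>
    (\<forall>n. d (Suc n) ` carrier (P (Suc (Suc n))) = {x \<in> carrier (P (Suc n)). d n x = \<zero>\<^bsub>P n\<^esub>}) \<and>
    d 0 ` carrier (P 1) = {x \<in> carrier (P 0). \<epsilon> x = \<zero>\<^bsub>M\<^esub>} \<and>
    \<epsilon> ` carrier (P 0) = carrier M"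

text \<open>\<open>R\<^sub>0 = R / R\<^sub>>\<^sub>0\<close> as a left module over \<open>R\<close>: the action of a ring element is that of its degree 0 part.\<close>

definition degree_zero_module ::
  "('a, 'r) ring_scheme \<Rightarrow> (nat \<Rightarrow> 'a set) \<Rightarrow> ('a, 'a) graded_module"
where
  "degree_zero_module R G =
    \<lparr>carrier = G 0, mult = mult R, one = one R, zero = zero R, add = add R,
     smult = (\<lambda>a x. homogeneous_part R G 0 a \<otimes>\<^bsub>R\<^esub> x),
     grade = (\<lambda>k. if k = 0 then G 0 else {\<zero>\<^bsub>R\<^esub>})\<rparr>"

text \<open>
  The terms of the resolution are sought on the type \<open>nat \<Rightarrow> 'a\<close>.  This loses nothing: if \<open>R\<close> is
  Koszul, the terms \<open>R \<otimes> V\<close> (tensor product over \<open>R\<^sub>0\<close>) of the minimal resolution, where \<open>V\<close> lies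
  in the preceding term, have at most as many elements as \<open>R \<times> nat\<close>, so that they can be
  realised on this type.
\<close>

definition koszul :: "('a, 'r) ring_scheme \<Rightarrow> (nat \<Rightarrow> 'a set) \<Rightarrow> bool" where
  "koszul R G \<longleftrightarrow> graded_ring R G \<and> semisimple_ring (R\<lparr>carrier := G 0\<rparr>) \<and>
    (\<exists>(P :: nat \<Rightarrow> ('a, nat \<Rightarrow> 'a) graded_module) d \<epsilon>.
      graded_projective_resolution R G P d \<epsilon> (degree_zero_module R G) \<and>
      (\<forall>n. carrier (P n) = (\<lambda>N. submodule N R (P n)) hull grade (P n) (int n)))"


section \<open>Path algebras\<close>

text \<open>
  A quiver is a \<^locale>\<open>fin_digraph\<close>.  A path is the pair of its start vertex and its list of
  arrows; the vertex distinguishes the trivial paths.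
\<close>

type_synonym ('v, 'e) path = "'v \<times> 'e list"

definition paths :: "('v, 'e) pre_digraph \<Rightarrow> ('v, 'e) path set" where
  "paths Q = {(u, w). \<exists>v. pre_digraph.awalk Q u w v}"

definition path_end :: "('v, 'e) pre_digraph \<Rightarrow> ('v, 'e) path \<Rightarrow> 'v" where
  "path_end Q p = pre_digraph.awlast Q (fst p) (snd p)"

definition path_length :: "('v, 'e) path \<Rightarrow> nat" where
  "path_length p = length (snd p)"

text \<open>
  The algebra \<open>KQ\<close>: finitely supported functions on the set of paths, where the coefficient of a
  product at \<open>r\<close> is the sum over all factorisations of \<open>r\<close> as a concatenation \<open>p q\<close>.
\<close>

definition path_algebra :: "('v, 'e) pre_digraph \<Rightarrow> (('v, 'e) path \<Rightarrow> 'k::field) ring" where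
  "path_algebra Q =
    \<lparr>carrier = {f. finite {p. f p \<noteq> 0} \<and> {p. f p \<noteq> 0} \<subseteq> paths Q},
     mult = (\<lambda>f g r. \<Sum>(p, q)\<in>{(p, q) \<in> paths Q \<times> paths Q.
               path_end Q p = fst q \<and> r = (fst p, snd p @ snd q)}. f p * g q),
     one = (\<lambda>r. if \<exists>v\<in>verts Q. r = (v, []) then 1 else 0),
     zero = (\<lambda>r. 0),
     add = (\<lambda>f g r. f r + g r)\<rparr>"

definition path_elt :: "('v, 'e) path \<Rightarrow> ('v, 'e) path \<Rightarrow> 'k::field" where
  "path_elt p = (\<lambda>r. if r = p then 1 else 0)"

definition arrow_elt :: "('v, 'e) pre_digraph \<Rightarrow> 'e \<Rightarrow> ('v, 'e) path \<Rightarrow> 'k::field" where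
  "arrow_elt Q \<alpha> = path_elt (tail Q \<alpha>, [\<alpha>])"

definition arrow_ideal :: "('v, 'e) pre_digraph \<Rightarrow> (('v, 'e) path \<Rightarrow> 'k::field) set" where
  "arrow_ideal Q = Idl\<^bsub>path_algebra Q\<^esub> (arrow_elt Q ` arcs Q)"

definition admissible :: "('v, 'e) pre_digraph \<Rightarrow> (('v, 'e) path \<Rightarrow> 'k::field) set \<Rightarrow> bool" where
  "admissible Q I \<longleftrightarrow> ideal I (path_algebra Q) \<and>
    I \<subseteq> ideal_prod (path_algebra Q) (arrow_ideal Q) (arrow_ideal Q)"

definition path_quotient ::
  "('v, 'e) pre_digraph \<Rightarrow> (('v, 'e) path \<Rightarrow> 'k::field) set \<Rightarrow> (('v, 'e) path \<Rightarrow> 'k) set ring"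
where
  "path_quotient Q I = path_algebra Q Quot I"

definition length_grading ::
  "('v, 'e) pre_digraph \<Rightarrow> (('v, 'e) path \<Rightarrow> 'k::field) set \<Rightarrow> nat \<Rightarrow> (('v, 'e) path \<Rightarrow> 'k) set set"
where
  "length_grading Q I n =
    {I +>\<^bsub>path_algebra Q\<^esub> f | f.
      f \<in> carrier (path_algebra Q) \<and> (\<forall>p. f p \<noteq> 0 \<longrightarrow> path_length p = n)}"

text \<open>The right modules \<open>P\<^sup>i = e\<^sub>i A\<close> and \<open>E\<^sub>i\<close>, as left modules over the opposite of \<open>A = KQ / I\<close>.\<close>

definition vertex_projective ::
  "('v, 'e) pre_digraph \<Rightarrow> (('v, 'e) path \<Rightarrow> 'k::field) set \<Rightarrow> 'v \<Rightarrow>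
    ((('v, 'e) path \<Rightarrow> 'k) set, (('v, 'e) path \<Rightarrow> 'k) set) graded_module"
where
  "vertex_projective Q I i =
    (let A = path_quotient Q I;
         eA = {(I +>\<^bsub>path_algebra Q\<^esub> path_elt (i, [])) \<otimes>\<^bsub>A\<^esub> a | a. a \<in> carrier A}
     in \<lparr>carrier = eA, mult = mult A, one = one A, zero = zero A, add = add A,
         smult = (\<lambda>a x. x \<otimes>\<^bsub>A\<^esub> a),
         grade = (\<lambda>k. if k < 0 then {\<zero>\<^bsub>A\<^esub>} else eA \<inter> length_grading Q I (nat k))\<rparr>)"

text \<open>
  \<open>E\<^sub>i\<close> is the field itself, on which \<open>e\<^sub>i\<close> acts as the identity and every other path as zero.  So the
  class \<open>a\<close> of \<open>f\<close> acts by the coefficient of \<open>f\<close> at \<open>e\<^sub>i\<close>, which for admissible \<open>I\<close> does not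
  depend on the representative \<open>f \<in> a\<close>.
\<close>

definition vertex_simple ::
  "('v, 'e) pre_digraph \<Rightarrow> (('v, 'e) path \<Rightarrow> 'k::field) set \<Rightarrow> 'v \<Rightarrow>
    ((('v, 'e) path \<Rightarrow> 'k) set, 'k) graded_module"
where
  "vertex_simple Q I i =
    \<lparr>carrier = UNIV, mult = (*), one = 1, zero = 0, add = (+),
     smult = (\<lambda>a x. x * (SOME f. f \<in> a) (i, [])),
     grade = (\<lambda>k. if k = 0 then UNIV else {0})\<rparr>"


section \<open>Locally gentle quivers\<close>

definition locally_gentle ::
  "('v, 'e) pre_digraph \<Rightarrow> (('v, 'e) path \<Rightarrow> 'k::field) set \<Rightarrow> bool"
where
  "locally_gentle Q I \<longleftrightarrow> fin_digraph Q \<and> admissible Q I \<and>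
    (\<forall>v\<in>verts Q. out_degree Q v \<le> 2 \<and> in_degree Q v \<le> 2) \<and>
    (\<forall>\<alpha>\<in>arcs Q.
      (\<exists>\<^sub>\<le>\<^sub>1\<beta>. \<beta> \<in> arcs Q \<and> arrow_elt Q \<alpha> \<otimes>\<^bsub>path_algebra Q\<^esub> arrow_elt Q \<beta> \<notin> I) \<and>
      (\<exists>\<^sub>\<le>\<^sub>1\<gamma>. \<gamma> \<in> arcs Q \<and> arrow_elt Q \<gamma> \<otimes>\<^bsub>path_algebra Q\<^esub> arrow_elt Q \<alpha> \<notin> I)) \<and>
    (\<exists>S \<subseteq> {p \<in> paths Q. path_length p = 2}. I = Idl\<^bsub>path_algebra Q\<^esub> (path_elt ` S)) \<and>
    (\<forall>\<alpha>\<in>arcs Q.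
      (\<exists>\<^sub>\<le>\<^sub>1\<beta>. \<beta> \<in> arcs Q \<and> head Q \<alpha> = tail Q \<beta> \<and>
        arrow_elt Q \<alpha> \<otimes>\<^bsub>path_algebra Q\<^esub> arrow_elt Q \<beta> \<in> I) \<and>
      (\<exists>\<^sub>\<le>\<^sub>1\<gamma>. \<gamma> \<in> arcs Q \<and> head Q \<gamma> = tail Q \<alpha> \<and>
        arrow_elt Q \<gamma> \<otimes>\<^bsub>path_algebra Q\<^esub> arrow_elt Q \<alpha> \<in> I))"

definition next_relation_arrow ::
  "('v, 'e) pre_digraph \<Rightarrow> (('v, 'e) path \<Rightarrow> 'k::field) set \<Rightarrow> 'e \<Rightarrow> 'e option"
where
  "next_relation_arrow Q I \<alpha> =
    (let B = {\<beta> \<in> arcs Q. head Q \<alpha> = tail Q \<beta> \<and>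
                arrow_elt Q \<alpha> \<otimes>\<^bsub>path_algebra Q\<^esub> arrow_elt Q \<beta> \<in> I}
     in if B = {} then None else Some (THE \<beta>. \<beta> \<in> B))"

text \<open>
  The maximal path \<open>\<alpha>\<^sub>1 \<alpha>\<^sub>2 \<alpha>\<^sub>3 \<dots>\<close> with full relations and first arrow \<open>\<alpha>\<^sub>1 = \<alpha>\<close>: the value at \<open>n\<close>
  is \<open>Some \<alpha>\<^sub>n\<^sub>+\<^sub>1\<close>, or \<open>None\<close> if the path has at most \<open>n\<close> arrows.
\<close>

primrec full_relation_path ::
  "('v, 'e) pre_digraph \<Rightarrow> (('v, 'e) path \<Rightarrow> 'k::field) set \<Rightarrow> 'e \<Rightarrow> nat \<Rightarrow> 'e option"
where
  "full_relation_path Q I \<alpha> 0 = Some \<alpha>"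
| "full_relation_path Q I \<alpha> (Suc n) =
    Option.bind (full_relation_path Q I \<alpha> n) (next_relation_arrow Q I)"

text \<open>
  The direct sum of the modules \<open>P\<^sup>v\<close>, where \<open>v\<close> is the vertex reached after \<open>n + 1\<close> arrows on one
  of the paths with full relations starting in \<open>i\<close>.  These paths are indexed by their first
  arrow; those with fewer than \<open>n + 1\<close> arrows do not contribute.
\<close>

definition full_relation_term ::
  "('v, 'e) pre_digraph \<Rightarrow> (('v, 'e) path \<Rightarrow> 'k::field) set \<Rightarrow> 'v \<Rightarrow> nat \<Rightarrow>
    ((('v, 'e) path \<Rightarrow> 'k) set, 'e \<Rightarrow> (('v, 'e) path \<Rightarrow> 'k) set) graded_module"
where
  "full_relation_term Q I i n =
    graded_direct_sum {\<alpha> \<in> out_arcs Q i. full_relation_path Q I \<alpha> n \<noteq> None}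
      (\<lambda>\<alpha>. vertex_projective Q I (head Q (the (full_relation_path Q I \<alpha> n))))"

end

theory Submission
  imports Defs
begin

text \<open>
  The ideal \<open>I\<close> is generated by paths of length \<open>2\<close>, so it is spanned by the paths that contain
  one of these relations, and the remaining paths form a basis of \<open>A = KQ / I\<close>
  (\<open>mem_ideal_iff\<close>).  The product of an arrow with such a basis path is again a basis path or zero, and
  this makes kernels visible.  Left multiplication with an arrow \<open>\<alpha>\<close> is a map of right modules
  from \<open>e\<^sub>v A\<close>, where \<open>v\<close> is the end of \<open>\<alpha>\<close>, to \<open>A\<close>.  It sends distinct basis paths \<open>w\<close> to distinct
  basis paths \<open>\<alpha> w\<close>, apart from those \<open>w\<close> whose first arrow \<open>\<beta>\<close> forms a relation \<open>\<alpha> \<beta>\<close>, which it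
  kills.  In a locally gentle quiver there is at most one such \<open>\<beta>\<close>, so the kernel is either zero or \<open>\<beta> A\<close>: the
  image of the same kind of map for the next arrow \<open>\<beta>\<close> of the path with full relations
  (\<open>mult_arr_eq_zeroE\<close>).  Hence the multiplications with the successive arrows of such a path form an
  exact sequence.

  The sequence begins at \<open>E\<^sub>i\<close> as follows.  The kernel of \<open>P\<^sup>i \<rightarrow> E\<^sub>i\<close> is spanned by the nontrivial paths
  starting in \<open>i\<close>.  As a path determines its first arrow, it is the direct sum of the \<open>\<alpha> A\<close> over the
  arrows \<open>\<alpha>\<close> starting in \<open>i\<close> (\<open>radical_expansion\<close>, \<open>finsum_mult_arr_eq_zeroD\<close>).  So the
  sequences belonging to these arrows add up to a resolution of \<open>E\<^sub>i\<close> (\<open>diff_0_image\<close>, \<open>diff_exact\<close>).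
  Each map is the multiplication with arrows, of degree \<open>1\<close>, which accounts for the shifts: the
  \<open>n\<close>-th term is generated by trivial paths placed in degree \<open>n\<close>.

  Left modules are treated in the same way, with last arrows in place of first arrows: for each arrow
  there is also at most one arrow that forms a relation with it from the left.
  The left module \<open>A\<^sub>0\<close> is the sum of all simple modules belonging to the vertices, so taking all
  vertices at once gives a resolution of \<open>A\<^sub>0\<close> whose \<open>n\<close>-th term is generated in degree \<open>n\<close>: \<open>A\<close> is
  Koszul.

  To carry out the argument only once, it is formulated for left modules over a ring \<open>R\<close> with a basis
  of paths that are prolonged at one end by arrows, the locale \<open>quadratic_monomial_ring\<close>.  This applies
  to \<open>A\<close>, where arrows are appended, and to the opposite ring of \<open>A\<close>, where they are prepended
  (\<open>left_quadratic_monomial_ring\<close>, \<open>right_quadratic_monomial_ring\<close>).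
\<close>

section \<open>Direct sums and graded modules\<close>

text \<open>
  A family of additive projections onto the summands, each vanishing on all other summands, forces the
  components of every decomposition, since it can be applied to the sum term by term.  All direct sum
  decompositions below are obtained in this way.
\<close>

lemma is_direct_sum_by_projections:
  fixes M (structure)
  assumes M: "abelian_group M"
    and sub: "\<And>j. j \<in> J \<Longrightarrow> additive_subgroup (G j) M"
    and proj_in: "\<And>j x. \<lbrakk>j \<in> J; x \<in> carrier M\<rbrakk> \<Longrightarrow> \<pi> j x \<in> G j"
    and proj_add: "\<And>j x y. \<lbrakk>j \<in> J; x \<in> carrier M; y \<in> carrier M\<rbrakk> \<Longrightarrow> \<pi> j (x \<oplus> y) = \<pi> j x \<oplus> \<pi> j y"
    and proj_same: "\<And>j x. \<lbrakk>j \<in> J; x \<in> G j\<rbrakk> \<Longrightarrow> \<pi> j x = x"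
    and proj_other: "\<And>j k x. \<lbrakk>j \<in> J; k \<in> J; j \<noteq> k; x \<in> G k\<rbrakk> \<Longrightarrow> \<pi> j x = \<zero>"
    and fin: "\<And>x. x \<in> carrier M \<Longrightarrow> finite {j \<in> J. \<pi> j x \<noteq> \<zero>}"
    and sum: "\<And>x. x \<in> carrier M \<Longrightarrow> x = (\<Oplus>j\<in>{j \<in> J. \<pi> j x \<noteq> \<zero>}. \<pi> j x)"
  shows is_decomposition_iff_projections:
      "x \<in> carrier M \<Longrightarrow> is_decomposition M J G x f \<longleftrightarrow> f = (\<lambda>j\<in>J. \<pi> j x)"
    and "is_direct_sum M J G"
proof -
  interpret abelian_group M by fact
  have G_carrier: "y \<in> carrier M" if "j \<in> J" "y \<in> G j" for j y
    using additive_subgroup.a_subset[OF sub[OF that(1)]] that(2) by blast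
  have proj_zero: "\<pi> j \<zero> = \<zero>" if "j \<in> J" for j
    using proj_same[OF that] additive_subgroup.zero_closed[OF sub[OF that]] by blast
  have proj_carrier: "\<pi> j y \<in> carrier M" if "j \<in> J" "y \<in> carrier M" for j y
    using that proj_in G_carrier by blast
  have proj_finsum: "\<pi> j (\<Oplus>k\<in>F. f k) = (\<Oplus>k\<in>F. \<pi> j (f k))"
    if "finite F" "f \<in> F \<rightarrow> carrier M" "j \<in> J" for F f j
    using that
  proof (induction F)
    case empty
    then show ?case by (simp add: proj_zero)
  next
    case (insert k F)
    then show ?case
      by (simp add: proj_add proj_carrier Pi_iff)
  qed
  show decomp: "is_decomposition M J G x f \<longleftrightarrow> f = (\<lambda>j\<in>J. \<pi> j x)" if x: "x \<in> carrier M" for x f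
  proof
    assume "is_decomposition M J G x f"
    then have fG: "f \<in> (\<Pi>\<^sub>E j\<in>J. G j)" and finf: "finite {j \<in> J. f j \<noteq> \<zero>}"
      and xf: "x = (\<Oplus>j\<in>{j \<in> J. f j \<noteq> \<zero>}. f j)"
      by (auto simp: is_decomposition_def)
    let ?F = "{j \<in> J. f j \<noteq> \<zero>}"
    have "\<pi> j x = f j" if j: "j \<in> J" for j
    proof -
      have fc: "f \<in> ?F \<rightarrow> carrier M"
        using fG G_carrier by (auto simp: PiE_iff)
      have "\<pi> j x = (\<Oplus>k\<in>?F. \<pi> j (f k))"
        by (subst xf) (rule proj_finsum[OF finf fc j])
      also have "\<dots> = (\<Oplus>k\<in>?F. if j = k then f k else \<zero>)"
      proof (rule finsum_cong')
        show "\<pi> j (f k) = (if j = k then f k else \<zero>)" if "k \<in> ?F" for k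
          using fG j that by (auto simp: PiE_iff proj_same intro: proj_other)
      qed (use fc in auto)
      also have "\<dots> = f j"
      proof (cases "j \<in> ?F")
        case True
        then show ?thesis
          using finsum_singleton[OF True finf fc] by simp
      next
        case False
        then have "(\<Oplus>k\<in>?F. if j = k then f k else \<zero>) = (\<Oplus>k\<in>?F. \<zero>)"
          by (intro finsum_cong') auto
        then show ?thesis
          using False j by (simp add: finsum_zero)
      qed
      finally show ?thesis .
    qed
    then show "f = (\<lambda>j\<in>J. \<pi> j x)"
      using fG by (auto simp: PiE_iff extensional_def fun_eq_iff)
  next
    assume f: "f = (\<lambda>j\<in>J. \<pi> j x)"
    have "{j \<in> J. f j \<noteq> \<zero>} = {j \<in> J. \<pi> j x \<noteq> \<zero>}"
      using f by auto
    moreover have "(\<Oplus>j\<in>{j \<in> J. \<pi> j x \<noteq> \<zero>}. f j) = x"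
      by (subst (2) sum[OF x], rule finsum_cong') (use f x proj_carrier in auto)
    moreover have "f \<in> (\<Pi>\<^sub>E j\<in>J. G j)"
      using f x proj_in by auto
    ultimately show "is_decomposition M J G x f"
      unfolding is_decomposition_def
      using x fin by simp
  qed
  show "is_direct_sum M J G"
    unfolding is_direct_sum_def using sub by (auto simp: decomp)
qed

lemma is_direct_sum_concentrated:
  fixes M :: "('b, 'm) ring_scheme"
  assumes M: "abelian_group M"
  shows "is_direct_sum M UNIV (\<lambda>k :: int. if k = 0 then carrier M else {\<zero>\<^bsub>M\<^esub>})"
proof -
  interpret abelian_group M by fact
  let ?\<pi> = "\<lambda>k x. if k = (0::int) then x else \<zero>\<^bsub>M\<^esub>"
  have supp: "{k \<in> UNIV. ?\<pi> k x \<noteq> \<zero>\<^bsub>M\<^esub>} = (if x = \<zero>\<^bsub>M\<^esub> then {} else {0})" for x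
    by auto
  have sub: "additive_subgroup (if k = 0 then carrier M else {\<zero>\<^bsub>M\<^esub>}) M" for k :: int
    by (rule additive_subgroup.intro, rule add.subgroupI) auto
  have sum: "x = (\<Oplus>\<^bsub>M\<^esub>k\<in>{k \<in> UNIV. ?\<pi> k x \<noteq> \<zero>\<^bsub>M\<^esub>}. ?\<pi> k x)" if "x \<in> carrier M" for x
    unfolding supp using that by simp
  show ?thesis
    by (rule is_direct_sum_by_projections[where \<pi> = ?\<pi>, OF M sub _ _ _ _ _ sum])
      (auto simp: supp split: if_splits)
qed

lemma (in abelian_group) finsum_in_additive_subgroup:
  assumes "additive_subgroup H G" "f \<in> F \<rightarrow> H"
  shows "(\<Oplus>k\<in>F. f k) \<in> H"
proof (cases "finite F")
  case True
  interpret H: additive_subgroup H G by fact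
  show ?thesis
    using True assms(2) H.a_subset by (induction F) (auto simp: Pi_iff subset_iff)
next
  case False
  then show ?thesis
    using additive_subgroup.zero_closed[OF assms(1)] by (simp add: finsum_infinite)
qed

lemma ring_opp_ring: "ring R \<Longrightarrow> ring (opp_ring R)"
proof -
  assume "ring R"
  then interpret ring R .
  show ?thesis
  proof (rule ringI)
    show "abelian_group (opp_ring R)"
      by (rule abelian_groupI) (auto simp: opp_ring_def a_ac intro: l_neg)
    show "Group.monoid (opp_ring R)"
      by (rule monoidI) (auto simp: opp_ring_def m_assoc)
  qed (auto simp: opp_ring_def l_distr r_distr)
qed

lemma mult_opp_ring: "X \<otimes>\<^bsub>opp_ring R\<^esub> Y = Y \<otimes>\<^bsub>R\<^esub> X"
  by (simp add: opp_ring_def)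

lemma left_moduleI:
  assumes "ring R" "abelian_group M"
    and "\<And>a x. \<lbrakk>a \<in> carrier R; x \<in> carrier M\<rbrakk> \<Longrightarrow> a \<odot>\<^bsub>M\<^esub> x \<in> carrier M"
    and "\<And>a b x. \<lbrakk>a \<in> carrier R; b \<in> carrier R; x \<in> carrier M\<rbrakk> \<Longrightarrow>
        (a \<oplus>\<^bsub>R\<^esub> b) \<odot>\<^bsub>M\<^esub> x = a \<odot>\<^bsub>M\<^esub> x \<oplus>\<^bsub>M\<^esub> b \<odot>\<^bsub>M\<^esub> x"
    and "\<And>a x y. \<lbrakk>a \<in> carrier R; x \<in> carrier M; y \<in> carrier M\<rbrakk> \<Longrightarrow>
        a \<odot>\<^bsub>M\<^esub> (x \<oplus>\<^bsub>M\<^esub> y) = a \<odot>\<^bsub>M\<^esub> x \<oplus>\<^bsub>M\<^esub> a \<odot>\<^bsub>M\<^esub> y"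
    and "\<And>a b x. \<lbrakk>a \<in> carrier R; b \<in> carrier R; x \<in> carrier M\<rbrakk> \<Longrightarrow>
        (a \<otimes>\<^bsub>R\<^esub> b) \<odot>\<^bsub>M\<^esub> x = a \<odot>\<^bsub>M\<^esub> (b \<odot>\<^bsub>M\<^esub> x)"
    and "\<And>x. x \<in> carrier M \<Longrightarrow> \<one>\<^bsub>R\<^esub> \<odot>\<^bsub>M\<^esub> x = x"
  shows "left_module R M"
  using assms by (intro left_module.intro left_module_axioms.intro)

lemma graded_homI:
  assumes "\<And>x. x \<in> carrier M \<Longrightarrow> f x \<in> carrier N"
    and "\<And>x y. \<lbrakk>x \<in> carrier M; y \<in> carrier M\<rbrakk> \<Longrightarrow> f (x \<oplus>\<^bsub>M\<^esub> y) = f x \<oplus>\<^bsub>N\<^esub> f y"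
    and "\<And>a x. \<lbrakk>a \<in> carrier R; x \<in> carrier M\<rbrakk> \<Longrightarrow> f (a \<odot>\<^bsub>M\<^esub> x) = a \<odot>\<^bsub>N\<^esub> f x"
    and "\<And>k x. x \<in> grade M k \<Longrightarrow> f x \<in> grade N k"
  shows "f \<in> graded_hom R M N"
  using assms by (auto simp: graded_hom_def module_hom_def hom_def)

lemma carrier_direct_sum_finite:
  "finite J \<Longrightarrow> carrier (direct_sum J M) = (\<Pi>\<^sub>E j\<in>J. carrier (M j))"
  by (auto simp: direct_sum_def)

lemma direct_sum_simps:
  "zero (direct_sum J M) = (\<lambda>j\<in>J. \<zero>\<^bsub>M j\<^esub>)"
  "add (direct_sum J M) f g = (\<lambda>j\<in>J. f j \<oplus>\<^bsub>M j\<^esub> g j)"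
  "smult (direct_sum J M) a f = (\<lambda>j\<in>J. a \<odot>\<^bsub>M j\<^esub> f j)"
  by (auto simp: direct_sum_def)

lemma left_module_direct_sum:
  assumes J: "finite J" and R: "ring R" and M: "\<And>j. j \<in> J \<Longrightarrow> left_module R (M j)"
  shows "left_module R (direct_sum J M)"
proof -
  have ag: "abelian_group (M j)" if "j \<in> J" for j
    using M[OF that] by (simp add: left_module_def)
  note ag_simps = abelian_groupE[OF ag]
  show ?thesis
  proof (rule left_moduleI[OF R])
    show "abelian_group (direct_sum J M)"
    proof (rule abelian_groupI)
      fix f assume f: "f \<in> carrier (direct_sum J M)"
      have "\<exists>y\<in>carrier (M j). y \<oplus>\<^bsub>M j\<^esub> f j = \<zero>\<^bsub>M j\<^esub>" if "j \<in> J" for j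
        using f that ag_simps(6)[OF that] by (auto simp: carrier_direct_sum_finite[OF J] PiE_iff)
      then obtain g where "\<And>j. j \<in> J \<Longrightarrow> g j \<in> carrier (M j) \<and> g j \<oplus>\<^bsub>M j\<^esub> f j = \<zero>\<^bsub>M j\<^esub>"
        by metis
      then show "\<exists>y\<in>carrier (direct_sum J M). y \<oplus>\<^bsub>direct_sum J M\<^esub> f = \<zero>\<^bsub>direct_sum J M\<^esub>"
        by (intro bexI[of _ "restrict g J"])
          (auto simp: carrier_direct_sum_finite[OF J] direct_sum_simps fun_eq_iff)
    next
      fix f g assume "f \<in> carrier (direct_sum J M)" "g \<in> carrier (direct_sum J M)"
      then show "f \<oplus>\<^bsub>direct_sum J M\<^esub> g = g \<oplus>\<^bsub>direct_sum J M\<^esub> f"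
        by (auto simp: carrier_direct_sum_finite[OF J] direct_sum_simps fun_eq_iff PiE_iff
            intro: ag_simps(4))
    qed (auto simp: carrier_direct_sum_finite[OF J] direct_sum_simps PiE_iff extensional_def
        fun_eq_iff ag_simps(1,2,3,5))
  qed (auto simp: carrier_direct_sum_finite[OF J] direct_sum_simps PiE_iff extensional_def
        fun_eq_iff left_module.smult_closed[OF M] left_module.smult_l_distr[OF M]
        left_module.smult_r_distr[OF M] left_module.smult_assoc1[OF M] left_module.smult_one[OF M])
qed

lemma left_module_cong:
  assumes M: "left_module R M"
    and eq: "carrier N = carrier M" "add N = add M" "zero N = zero M" "smult N = smult M"
  shows "left_module R N"
proof -
  interpret left_module R M by fact
  note ag = abelian_groupE[OF M.abelian_group_axioms]
  show ?thesis
    by (intro left_moduleI abelian_groupI)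
      (use ag in \<open>simp_all add: eq R.ring_axioms smult_closed smult_l_distr smult_r_distr
          smult_assoc1 smult_one\<close>)
qed

lemma graded_iso_refl: "graded_iso R M M"
  unfolding graded_iso_def
  by (rule bexI[of _ "\<lambda>x. x"]) (auto intro: graded_homI simp: bij_betw_def)

lemma shift_0: "shift 0 M = M"
  by (simp add: shift_def)

lemma graded_iso_singleton_sum:
  fixes M :: "('a, 'b) graded_module"
  assumes M: "\<And>n. grade M n \<subseteq> carrier M"
  shows "graded_iso R (graded_direct_sum {k} (\<lambda>_. M)) M"
proof -
  let ?D = "graded_direct_sum {k} (\<lambda>_. M)"
  have car: "carrier ?D = (\<Pi>\<^sub>E j\<in>{k}. carrier M)"
    "grade ?D n = {f \<in> \<Pi>\<^sub>E j\<in>{k}. carrier M. f k \<in> grade M n}" for n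
    by (simp_all add: graded_direct_sum_def graded_by_def carrier_direct_sum_finite)
  have ops: "(f \<oplus>\<^bsub>?D\<^esub> g) k = f k \<oplus>\<^bsub>M\<^esub> g k" "(a \<odot>\<^bsub>?D\<^esub> f) k = a \<odot>\<^bsub>M\<^esub> f k" for f g a
    by (simp_all add: graded_direct_sum_def graded_by_def direct_sum_simps)
  have const: "(\<lambda>j\<in>{k}. y) \<in> carrier ?D" if "y \<in> carrier M" for y
    unfolding car using that by (rule restrict_PiE_iff[THEN iffD2, rule_format])
  have const_eq: "y = (\<lambda>j\<in>{k}. y) k" for y :: 'b
    by simp
  have eta: "f = (\<lambda>j\<in>{k}. f k)" if "f \<in> carrier ?D" for f
  proof
    fix j
    show "f j = (\<lambda>j\<in>{k}. f k) j"
      using PiE_arb[OF that[unfolded car], of j] by (cases "j = k") simp_all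
  qed
  have hom: "(\<lambda>f. f k) \<in> graded_hom R ?D M"
  proof (rule graded_homI)
    show "f k \<in> carrier M" if "f \<in> carrier ?D" for f
      using PiE_mem[OF that[unfolded car], of k] by simp
    show "f k \<in> grade M n" if "f \<in> grade ?D n" for n f
      using that unfolding car by blast
  qed (rule ops)+
  have "inj_on (\<lambda>f. f k) (carrier ?D)"
  proof (rule inj_onI)
    fix f g assume fg: "f \<in> carrier ?D" "g \<in> carrier ?D" "f k = g k"
    show "f = g" by (subst eta[OF fg(1)], subst eta[OF fg(2)]) (simp only: fg(3))
  qed
  moreover have "(\<lambda>f. f k) ` carrier ?D = carrier M"
  proof (intro equalityI subsetI)
    fix y assume "y \<in> (\<lambda>f. f k) ` carrier ?D"
    then show "y \<in> carrier M" using hom unfolding graded_hom_def module_hom_def hom_def by auto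
  next
    fix y assume "y \<in> carrier M"
    then show "y \<in> (\<lambda>f. f k) ` carrier ?D" using const_eq const by (metis image_eqI)
  qed
  moreover have "(\<lambda>f. f k) ` grade ?D n = grade M n" for n
  proof (intro equalityI subsetI)
    fix y assume "y \<in> (\<lambda>f. f k) ` grade ?D n"
    then show "y \<in> grade M n" unfolding car by blast
  next
    fix y assume y: "y \<in> grade M n"
    have "(\<lambda>j\<in>{k}. y) \<in> grade ?D n"
      using const[of y] y M[of n] unfolding car by auto
    then show "y \<in> (\<lambda>f. f k) ` grade ?D n" using const_eq by (metis image_eqI)
  qed
  ultimately show ?thesis
    unfolding graded_iso_def bij_betw_def using hom by blast
qed

text \<open>
  A direct sum does not see the fields \<open>mult\<close> and \<open>one\<close> of its summands, which are meaningless for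
  modules; equality of the summands as records would be too strong a premise.
\<close>

lemma graded_direct_sum_cong:
  assumes "\<And>j. j \<in> J \<Longrightarrow> carrier (M j) = carrier (N j)" "\<And>j. j \<in> J \<Longrightarrow> zero (M j) = zero (N j)"
    "\<And>j. j \<in> J \<Longrightarrow> add (M j) = add (N j)" "\<And>j. j \<in> J \<Longrightarrow> smult (M j) = smult (N j)"
    "\<And>j. j \<in> J \<Longrightarrow> grade (M j) = grade (N j)"
  shows "graded_direct_sum J M = graded_direct_sum J N"
proof -
  have "(\<Pi>\<^sub>E j\<in>J. carrier (M j)) = (\<Pi>\<^sub>E j\<in>J. carrier (N j))"
    by (rule PiE_cong) (rule assms(1))
  moreover have "{j \<in> J. f j \<noteq> zero (M j)} = {j \<in> J. f j \<noteq> zero (N j)}" for f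
    using assms(2) by auto
  moreover have "(\<lambda>j\<in>J. zero (M j)) = (\<lambda>j\<in>J. zero (N j))"
    using assms(2) by (rule restrict_ext)
  moreover have "(\<lambda>j\<in>J. add (M j) (f j) (g j)) = (\<lambda>j\<in>J. add (N j) (f j) (g j))" for f g
    using assms(3) by (intro restrict_ext) simp
  moreover have "(\<lambda>j\<in>J. smult (M j) a (f j)) = (\<lambda>j\<in>J. smult (N j) a (f j))" for a f
    using assms(4) by (intro restrict_ext) simp
  ultimately have "direct_sum J M = direct_sum J N"
    by (simp add: direct_sum_def)
  then show ?thesis
    using assms(5) by (simp add: graded_direct_sum_def)
qed

lemma left_module_regular_module: "ring R \<Longrightarrow> left_module R (regular_module R)"
proof -
  assume "ring R"
  then interpret ring R .
  have "abelian_group (regular_module R)"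
    by (rule abelian_groupI) (auto simp: regular_module_def a_ac intro: l_neg)
  then show ?thesis
    by (intro left_moduleI) (auto simp: regular_module_def \<open>ring R\<close> l_distr r_distr m_assoc)
qed

lemma (in left_module) smult_zero:
  "a \<in> carrier R \<Longrightarrow> a \<odot>\<^bsub>M\<^esub> \<zero>\<^bsub>M\<^esub> = \<zero>\<^bsub>M\<^esub>"
proof -
  assume a: "a \<in> carrier R"
  then have "a \<odot>\<^bsub>M\<^esub> \<zero>\<^bsub>M\<^esub> \<oplus>\<^bsub>M\<^esub> a \<odot>\<^bsub>M\<^esub> \<zero>\<^bsub>M\<^esub> = a \<odot>\<^bsub>M\<^esub> \<zero>\<^bsub>M\<^esub>"
    using smult_r_distr[of a "\<zero>\<^bsub>M\<^esub>" "\<zero>\<^bsub>M\<^esub>"] by simp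
  then show ?thesis
    using a smult_closed[of a "\<zero>\<^bsub>M\<^esub>"] by simp
qed

lemma (in left_module) smult_finsum:
  assumes "finite F" "f \<in> F \<rightarrow> carrier M" "a \<in> carrier R"
  shows "a \<odot>\<^bsub>M\<^esub> (\<Oplus>\<^bsub>M\<^esub>k\<in>F. f k) = (\<Oplus>\<^bsub>M\<^esub>k\<in>F. a \<odot>\<^bsub>M\<^esub> f k)"
  using assms
proof (induction F)
  case empty
  then show ?case by (simp add: smult_zero)
next
  case (insert k F)
  then show ?case by (simp add: smult_r_distr smult_closed Pi_iff)
qed

text \<open>
  The dual basis criterion: coordinate functions \<open>\<phi> b\<close> with respect to generators \<open>b\<close> split the
  projection from the free module on these generators.
\<close>

lemma projective_module_dual_basis:
  fixes R :: "('a, 'r) ring_scheme" and P :: "('a, 'b, 'm) module_scheme"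
  assumes P: "left_module R P" and X: "finite X" "X \<subseteq> carrier P"
    and dual: "\<And>b. b \<in> X \<Longrightarrow> \<phi> b \<in> module_hom R P (regular_module R)"
    and gen: "\<And>x. x \<in> carrier P \<Longrightarrow> (\<Oplus>\<^bsub>P\<^esub>b\<in>X. \<phi> b x \<odot>\<^bsub>P\<^esub> b) = x"
  shows "projective_module R P"
proof -
  interpret left_module R P by fact
  let ?F = "direct_sum X (\<lambda>_. regular_module R)"
  define s where "s = (\<lambda>x. \<lambda>b\<in>X. \<phi> b x)"
  define r where "r = (\<lambda>f. \<Oplus>\<^bsub>P\<^esub>b\<in>X. f b \<odot>\<^bsub>P\<^esub> b)"
  have dual_closed: "\<phi> b x \<in> carrier R" if "b \<in> X" "x \<in> carrier P" for b x
    using dual[OF that(1)] that by (auto simp: module_hom_def hom_def regular_module_def)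
  have dual_add: "\<phi> b (x \<oplus>\<^bsub>P\<^esub> y) = \<phi> b x \<oplus>\<^bsub>R\<^esub> \<phi> b y"
    if "b \<in> X" "x \<in> carrier P" "y \<in> carrier P" for b x y
    using dual[OF that(1)] that by (auto simp: module_hom_def hom_def regular_module_def)
  have dual_smult: "\<phi> b (a \<odot>\<^bsub>P\<^esub> x) = a \<otimes>\<^bsub>R\<^esub> \<phi> b x"
    if "b \<in> X" "x \<in> carrier P" "a \<in> carrier R" for b a x
    using dual[OF that(1)] that by (auto simp: module_hom_def hom_def regular_module_def)
  have Xc: "b \<in> carrier P" if "b \<in> X" for b using X that by blast
  have "s \<in> module_hom R P ?F"
    by (auto simp: module_hom_def hom_def s_def carrier_direct_sum_finite[OF X(1)] direct_sum_simps
        regular_module_def fun_eq_iff dual_closed dual_add dual_smult)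
  moreover have "r \<in> module_hom R ?F P"
  proof -
    have c: "f b \<odot>\<^bsub>P\<^esub> b \<in> carrier P" if "f \<in> carrier ?F" "b \<in> X" for f b
      using that Xc by (auto simp: carrier_direct_sum_finite[OF X(1)] regular_module_def PiE_iff
          intro: smult_closed)
    have add: "r (f \<oplus>\<^bsub>?F\<^esub> g) = r f \<oplus>\<^bsub>P\<^esub> r g" if fg: "f \<in> carrier ?F" "g \<in> carrier ?F" for f g
    proof -
      have "r (f \<oplus>\<^bsub>?F\<^esub> g) = (\<Oplus>\<^bsub>P\<^esub>b\<in>X. f b \<odot>\<^bsub>P\<^esub> b \<oplus>\<^bsub>P\<^esub> g b \<odot>\<^bsub>P\<^esub> b)"
        unfolding r_def
      proof (rule M.finsum_cong')
        show "(f \<oplus>\<^bsub>?F\<^esub> g) b \<odot>\<^bsub>P\<^esub> b = f b \<odot>\<^bsub>P\<^esub> b \<oplus>\<^bsub>P\<^esub> g b \<odot>\<^bsub>P\<^esub> b" if "b \<in> X" for b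
          using fg that Xc[OF that]
          by (auto simp: carrier_direct_sum_finite[OF X(1)] regular_module_def PiE_iff
              direct_sum_simps smult_l_distr)
      qed (use c fg in auto)
      also have "\<dots> = r f \<oplus>\<^bsub>P\<^esub> r g"
        unfolding r_def by (rule M.finsum_addf) (use c fg in auto)
      finally show ?thesis .
    qed
    have smult: "r (a \<odot>\<^bsub>?F\<^esub> f) = a \<odot>\<^bsub>P\<^esub> r f" if f: "f \<in> carrier ?F" and a: "a \<in> carrier R" for a f
    proof -
      have "r (a \<odot>\<^bsub>?F\<^esub> f) = (\<Oplus>\<^bsub>P\<^esub>b\<in>X. a \<odot>\<^bsub>P\<^esub> (f b \<odot>\<^bsub>P\<^esub> b))"
        unfolding r_def
      proof (rule M.finsum_cong')
        show "(a \<odot>\<^bsub>?F\<^esub> f) b \<odot>\<^bsub>P\<^esub> b = a \<odot>\<^bsub>P\<^esub> (f b \<odot>\<^bsub>P\<^esub> b)" if "b \<in> X" for b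
          using f a that Xc[OF that]
          by (auto simp: carrier_direct_sum_finite[OF X(1)] regular_module_def PiE_iff
              direct_sum_simps smult_assoc1)
      qed (use c f a smult_closed in auto)
      also have "\<dots> = a \<odot>\<^bsub>P\<^esub> r f"
        unfolding r_def by (rule smult_finsum[symmetric]) (use c f a X in auto)
      finally show ?thesis .
    qed
    have "r f \<in> carrier P" if "f \<in> carrier ?F" for f
      unfolding r_def by (rule M.finsum_closed) (use c that in auto)
    with add smult show ?thesis
      by (auto simp: module_hom_def hom_def)
  qed
  moreover have "r (s x) = x" if "x \<in> carrier P" for x
  proof -
    have "r (s x) = (\<Oplus>\<^bsub>P\<^esub>b\<in>X. \<phi> b x \<odot>\<^bsub>P\<^esub> b)"
      unfolding r_def
    proof (rule M.finsum_cong')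
      show "(\<lambda>b. \<phi> b x \<odot>\<^bsub>P\<^esub> b) \<in> X \<rightarrow> carrier P"
        using that Xc by (auto intro!: smult_closed dual_closed)
    qed (auto simp: s_def)
    then show ?thesis using gen that by simp
  qed
  ultimately show ?thesis
    unfolding projective_module_def using P by blast
qed

section \<open>Quadratic monomial rings\<close>

text \<open>
  The path with full relations, for an arbitrary rule giving the next arrow: such paths are followed
  forwards for right modules and backwards for left modules.
\<close>

primrec relation_chain :: "('e \<Rightarrow> 'e option) \<Rightarrow> 'e \<Rightarrow> nat \<Rightarrow> 'e option" where
  "relation_chain prv \<alpha> 0 = Some \<alpha>"
| "relation_chain prv \<alpha> (Suc n) = Option.bind (relation_chain prv \<alpha> n) prv"

text \<open>
  A ring with a \<open>K\<close>-basis \<open>B\<close> that behaves like the set of paths containing no relation, seen from the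
  side of left modules.  The function \<open>coef\<close> gives the coordinates, \<open>len\<close> is the length of a path, and
  \<open>triv v\<close> is the trivial path at the vertex \<open>v\<close>, which represents the idempotent \<open>idem v\<close>.

  Right multiplication is modelled by prolonging paths: \<open>stop p\<close> is the vertex of \<open>p\<close> at the end where
  arrows are attached, and \<open>ext p \<alpha>\<close> is \<open>p\<close> prolonged by the arrow \<open>\<alpha>\<close>.  The element \<open>arr \<alpha>\<close> of the ring
  satisfies \<open>p \<cdot> arr \<alpha> = ext p \<alpha>\<close> if \<open>ext p \<alpha>\<close> belongs to \<open>B\<close>, and \<open>p \<cdot> arr \<alpha> = 0\<close> otherwise
  (\<open>coef_mult_arr_ext\<close>, \<open>coef_mult_arr_zero\<close>).  So \<open>src \<alpha>\<close> is the vertex where \<open>\<alpha>\<close> is attached and \<open>tgt \<alpha>\<close>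
  the new end.

  The partial function \<open>prv\<close> encodes the relations: \<open>prv \<alpha> = Some \<gamma>\<close> says that \<open>\<gamma>\<close> followed by \<open>\<alpha>\<close> is a
  relation, so there is at most one relation with a given last arrow.  By \<open>ext_blocked\<close> and
  \<open>prv_blocks\<close>, a path that stops at \<open>src \<alpha>\<close> cannot be prolonged by \<open>\<alpha>\<close> exactly if \<open>prv \<alpha>\<close> is its last
  arrow.
\<close>

locale quadratic_monomial_ring = ring R
  for R :: "('a, 'r) ring_scheme" (structure) +
  fixes B :: "'b set" and coef :: "'a \<Rightarrow> 'b \<Rightarrow> 'k::field" and len :: "'b \<Rightarrow> nat" and stop :: "'b \<Rightarrow> 'v"
    and V :: "'v set" and triv :: "'v \<Rightarrow> 'b" and idem :: "'v \<Rightarrow> 'a"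
    and E :: "'e set" and src :: "'e \<Rightarrow> 'v" and tgt :: "'e \<Rightarrow> 'v" and arr :: "'e \<Rightarrow> 'a"
    and ext :: "'b \<Rightarrow> 'e \<Rightarrow> 'b" and prv :: "'e \<Rightarrow> 'e option"
  assumes finite_V: "finite V" and finite_E: "finite E"
    and coef_finite: "y \<in> carrier R \<Longrightarrow> finite {p \<in> B. coef y p \<noteq> 0}"
    and coef_eqI: "\<lbrakk>y \<in> carrier R; z \<in> carrier R; \<And>p. p \<in> B \<Longrightarrow> coef y p = coef z p\<rbrakk> \<Longrightarrow> y = z"
    and coef_surj: "finite {p \<in> B. f p \<noteq> 0} \<Longrightarrow> \<exists>y\<in>carrier R. \<forall>p\<in>B. coef y p = f p"
    and coef_add: "\<lbrakk>y \<in> carrier R; z \<in> carrier R; p \<in> B\<rbrakk> \<Longrightarrow> coef (y \<oplus> z) p = coef y p + coef z p"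
    and coef_mult_nonzero: "\<lbrakk>y \<in> carrier R; z \<in> carrier R; r \<in> B; coef (y \<otimes> z) r \<noteq> 0\<rbrakk> \<Longrightarrow>
      \<exists>p\<in>B. \<exists>q\<in>B. coef y p \<noteq> 0 \<and> coef z q \<noteq> 0 \<and> len r = len p + len q"
    and stop_in: "p \<in> B \<Longrightarrow> stop p \<in> V"
    and triv_in: "v \<in> V \<Longrightarrow> triv v \<in> B" and len_triv: "v \<in> V \<Longrightarrow> len (triv v) = 0"
    and stop_triv: "v \<in> V \<Longrightarrow> stop (triv v) = v"
    and len_zero: "\<lbrakk>p \<in> B; len p = 0\<rbrakk> \<Longrightarrow> p = triv (stop p)"
    and coef_mult_triv: "\<lbrakk>y \<in> carrier R; z \<in> carrier R; v \<in> V\<rbrakk> \<Longrightarrow>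
      coef (y \<otimes> z) (triv v) = coef y (triv v) * coef z (triv v)"
    and idem_in: "v \<in> V \<Longrightarrow> idem v \<in> carrier R"
    and coef_idem: "\<lbrakk>v \<in> V; p \<in> B\<rbrakk> \<Longrightarrow> coef (idem v) p = (if p = triv v then 1 else 0)"
    and coef_mult_idem: "\<lbrakk>y \<in> carrier R; v \<in> V; p \<in> B\<rbrakk> \<Longrightarrow>
      coef (y \<otimes> idem v) p = (if stop p = v then coef y p else 0)"
    and src_in: "\<alpha> \<in> E \<Longrightarrow> src \<alpha> \<in> V" and tgt_in: "\<alpha> \<in> E \<Longrightarrow> tgt \<alpha> \<in> V"
    and arr_in: "\<alpha> \<in> E \<Longrightarrow> arr \<alpha> \<in> carrier R"
    and idem_mult_arr: "\<alpha> \<in> E \<Longrightarrow> idem (src \<alpha>) \<otimes> arr \<alpha> = arr \<alpha>"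
    and ext_cases: "\<lbrakk>q \<in> B; len q \<noteq> 0\<rbrakk> \<Longrightarrow> \<exists>p\<in>B. \<exists>\<alpha>\<in>E. q = ext p \<alpha>"
    and ext_inj: "\<lbrakk>p \<in> B; p' \<in> B; \<alpha> \<in> E; \<alpha>' \<in> E; ext p \<alpha> \<in> B; ext p \<alpha> = ext p' \<alpha>'\<rbrakk> \<Longrightarrow> p = p' \<and> \<alpha> = \<alpha>'"
    and ext_props: "\<lbrakk>p \<in> B; \<alpha> \<in> E; ext p \<alpha> \<in> B\<rbrakk> \<Longrightarrow>
      stop p = src \<alpha> \<and> stop (ext p \<alpha>) = tgt \<alpha> \<and> len (ext p \<alpha>) = Suc (len p)"
    and ext_blocked: "\<lbrakk>p \<in> B; \<alpha> \<in> E; stop p = src \<alpha>; ext p \<alpha> \<notin> B\<rbrakk> \<Longrightarrow>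
      \<exists>\<gamma>. prv \<alpha> = Some \<gamma> \<and> (\<exists>p'\<in>B. p = ext p' \<gamma>)"
    and prv_blocks: "\<lbrakk>p \<in> B; \<alpha> \<in> E; prv \<alpha> = Some \<gamma>; ext p \<gamma> \<in> B\<rbrakk> \<Longrightarrow> ext (ext p \<gamma>) \<alpha> \<notin> B"
    and prv_in: "\<lbrakk>\<alpha> \<in> E; prv \<alpha> = Some \<gamma>\<rbrakk> \<Longrightarrow> \<gamma> \<in> E \<and> tgt \<gamma> = src \<alpha>"
    and coef_mult_arr_ext: "\<lbrakk>y \<in> carrier R; p \<in> B; \<alpha> \<in> E; \<beta> \<in> E; ext p \<alpha> \<in> B\<rbrakk> \<Longrightarrow>
      coef (y \<otimes> arr \<beta>) (ext p \<alpha>) = (if \<alpha> = \<beta> then coef y p else 0)"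
    and coef_mult_arr_zero: "\<lbrakk>y \<in> carrier R; q \<in> B; \<beta> \<in> E; len q = 0\<rbrakk> \<Longrightarrow> coef (y \<otimes> arr \<beta>) q = 0"
begin

subsection \<open>Coefficients\<close>

lemma coef_zero: "p \<in> B \<Longrightarrow> coef \<zero> p = 0"
  using coef_add[of \<zero> \<zero> p] by (metis add_cancel_left_left l_zero zero_closed)

lemma coef_finsum:
  assumes "finite F" "f \<in> F \<rightarrow> carrier R" "p \<in> B"
  shows "coef (\<Oplus>k\<in>F. f k) p = (\<Sum>k\<in>F. coef (f k) p)"
  using assms
  by (induction F) (auto simp: coef_zero coef_add Pi_iff)

definition of_coef :: "('b \<Rightarrow> 'k) \<Rightarrow> 'a" where
  "of_coef f = (SOME y. y \<in> carrier R \<and> (\<forall>p\<in>B. coef y p = f p))"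

lemma of_coef:
  assumes "finite {p \<in> B. f p \<noteq> 0}"
  shows "of_coef f \<in> carrier R" "p \<in> B \<Longrightarrow> coef (of_coef f) p = f p"
  using someI_ex[of "\<lambda>y. y \<in> carrier R \<and> (\<forall>p\<in>B. coef y p = f p)"] coef_surj[OF assms]
  unfolding of_coef_def by auto

definition ideal_at :: "'v \<Rightarrow> 'a set" where
  "ideal_at v = {y \<in> carrier R. y \<otimes> idem v = y}"

lemma ideal_at_iff:
  assumes "v \<in> V"
  shows "y \<in> ideal_at v \<longleftrightarrow> y \<in> carrier R \<and> (\<forall>p\<in>B. coef y p \<noteq> 0 \<longrightarrow> stop p = v)"
proof -
  have "y \<otimes> idem v = y \<longleftrightarrow> (\<forall>p\<in>B. coef y p \<noteq> 0 \<longrightarrow> stop p = v)" if y: "y \<in> carrier R"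
  proof
    assume "y \<otimes> idem v = y"
    then show "\<forall>p\<in>B. coef y p \<noteq> 0 \<longrightarrow> stop p = v"
      using coef_mult_idem[OF y assms] by metis
  next
    assume "\<forall>p\<in>B. coef y p \<noteq> 0 \<longrightarrow> stop p = v"
    then show "y \<otimes> idem v = y"
      by (intro coef_eqI) (auto simp: y idem_in assms coef_mult_idem)
  qed
  then show ?thesis by (auto simp: ideal_at_def)
qed

lemma ideal_at_carrier: "y \<in> ideal_at v \<Longrightarrow> y \<in> carrier R"
  by (simp add: ideal_at_def)

lemma idem_ideal_at: "v \<in> V \<Longrightarrow> idem v \<in> ideal_at v"
  by (auto simp: ideal_at_iff idem_in coef_idem stop_triv)

lemma idem_nonzero: "v \<in> V \<Longrightarrow> idem v \<noteq> \<zero>"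
  using coef_idem[of v "triv v"] coef_zero[of "triv v"] by (auto simp: triv_in)

lemma mult_ideal_at: "\<lbrakk>a \<in> carrier R; y \<in> ideal_at v; v \<in> V\<rbrakk> \<Longrightarrow> a \<otimes> y \<in> ideal_at v"
  by (auto simp: ideal_at_def m_assoc idem_in)

lemma mult_arr_ideal_at: "\<lbrakk>y \<in> carrier R; \<alpha> \<in> E\<rbrakk> \<Longrightarrow> y \<otimes> arr \<alpha> \<in> ideal_at (tgt \<alpha>)"
proof -
  assume y: "y \<in> carrier R" and \<alpha>: "\<alpha> \<in> E"
  have "stop q = tgt \<alpha>" if q: "q \<in> B" "coef (y \<otimes> arr \<alpha>) q \<noteq> 0" for q
  proof -
    obtain p \<beta> where p: "p \<in> B" "\<beta> \<in> E" "q = ext p \<beta>"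
      using coef_mult_arr_zero[OF y q(1) \<alpha>] q ext_cases[OF q(1)] by blast
    then have "\<beta> = \<alpha>"
      using q coef_mult_arr_ext[OF y p(1,2) \<alpha>] by (auto split: if_splits)
    then show ?thesis using ext_props p q(1) by blast
  qed
  then show ?thesis
    by (simp add: ideal_at_iff[OF tgt_in[OF \<alpha>]] y \<alpha> arr_in)
qed

lemma additive_subgroup_ideal_at: "v \<in> V \<Longrightarrow> additive_subgroup (ideal_at v) R"
  by (rule additive_subgroup.intro, rule add.subgroupI)
    (auto simp: ideal_at_def idem_in l_distr l_minus)

subsection \<open>The grading\<close>

text \<open>
  Degrees are integers, so that the shifted gradings below need no case distinction; the components of
  negative degree vanish.
\<close>

definition homog :: "int \<Rightarrow> 'a set" where
  "homog k = {y \<in> carrier R. \<forall>p\<in>B. coef y p \<noteq> 0 \<longrightarrow> int (len p) = k}"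

definition deg_part :: "int \<Rightarrow> 'a \<Rightarrow> 'a" where
  "deg_part k y = of_coef (\<lambda>p. if int (len p) = k then coef y p else 0)"

lemma deg_part:
  assumes "y \<in> carrier R"
  shows "deg_part k y \<in> carrier R"
    and "p \<in> B \<Longrightarrow> coef (deg_part k y) p = (if int (len p) = k then coef y p else 0)"
proof -
  have fin: "finite {p \<in> B. (if int (len p) = k then coef y p else 0) \<noteq> 0}"
    by (rule finite_subset[OF _ coef_finite[OF assms]]) auto
  show "deg_part k y \<in> carrier R"
    unfolding deg_part_def by (rule of_coef(1)[OF fin])
  show "coef (deg_part k y) p = (if int (len p) = k then coef y p else 0)" if "p \<in> B"
    unfolding deg_part_def by (rule of_coef(2)[OF fin that])
qed

lemma homog_carrier: "y \<in> homog k \<Longrightarrow> y \<in> carrier R"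
  by (simp add: homog_def)

lemma homog_negative: "k < 0 \<Longrightarrow> homog k = {\<zero>}"
  by (auto simp: homog_def coef_zero intro!: coef_eqI)

lemma coef_minus: "\<lbrakk>y \<in> carrier R; p \<in> B\<rbrakk> \<Longrightarrow> coef (\<ominus> y) p = - coef y p"
  using coef_add[of y "\<ominus> y" p] by (simp add: r_neg coef_zero add_eq_0_iff)

lemma additive_subgroup_homog: "additive_subgroup (homog k) R"
  by (rule additive_subgroup.intro, rule add.subgroupI)
    (auto simp: homog_def coef_minus coef_add coef_zero intro!: exI[of _ \<zero>])

lemma homog_mult: "\<lbrakk>y \<in> homog k; z \<in> homog l\<rbrakk> \<Longrightarrow> y \<otimes> z \<in> homog (k + l)"
proof -
  assume yz: "y \<in> homog k" "z \<in> homog l"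
  then have c: "y \<in> carrier R" "z \<in> carrier R" by (auto simp: homog_carrier)
  have "int (len r) = k + l" if r: "r \<in> B" "coef (y \<otimes> z) r \<noteq> 0" for r
  proof -
    obtain p q where "p \<in> B" "q \<in> B" "coef y p \<noteq> 0" "coef z q \<noteq> 0" "len r = len p + len q"
      using coef_mult_nonzero[OF c r] by blast
    then show ?thesis using yz by (auto simp: homog_def)
  qed
  then show ?thesis using c by (simp add: homog_def)
qed

lemma idem_homog: "v \<in> V \<Longrightarrow> idem v \<in> homog 0"
  by (auto simp: homog_def idem_in coef_idem len_triv)

lemma arr_homog: "\<alpha> \<in> E \<Longrightarrow> arr \<alpha> \<in> homog 1"
proof -
  assume \<alpha>: "\<alpha> \<in> E"
  have "int (len q) = 1" if q: "q \<in> B" "coef (arr \<alpha>) q \<noteq> 0" for q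
  proof -
    have nz: "coef (idem (src \<alpha>) \<otimes> arr \<alpha>) q \<noteq> 0"
      using q by (simp add: idem_mult_arr \<alpha>)
    then obtain p \<beta> where p: "p \<in> B" "\<beta> \<in> E" "q = ext p \<beta>"
      using coef_mult_arr_zero[OF idem_in[OF src_in[OF \<alpha>]] q(1) \<alpha>] ext_cases[OF q(1)] by blast
    then have "coef (idem (src \<alpha>)) p \<noteq> 0"
      using nz q coef_mult_arr_ext[OF idem_in[OF src_in[OF \<alpha>]] p(1,2) \<alpha>] by (auto split: if_splits)
    then have "len p = 0"
      using p by (auto simp: coef_idem src_in \<alpha> len_triv split: if_splits)
    then show ?thesis using ext_props p q by auto
  qed
  then show ?thesis by (auto simp: homog_def arr_in \<alpha>)
qed

lemma deg_part_homog: "y \<in> carrier R \<Longrightarrow> deg_part k y \<in> homog k"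
  by (auto simp: homog_def deg_part)

lemma deg_part_add: "\<lbrakk>y \<in> carrier R; z \<in> carrier R\<rbrakk> \<Longrightarrow> deg_part k (y \<oplus> z) = deg_part k y \<oplus> deg_part k z"
  by (rule coef_eqI) (auto simp: deg_part coef_add)

lemma deg_part_same: "y \<in> homog k \<Longrightarrow> deg_part k y = y"
  by (rule coef_eqI) (auto simp: homog_def deg_part)

lemma deg_part_other: "\<lbrakk>y \<in> homog l; k \<noteq> l\<rbrakk> \<Longrightarrow> deg_part k y = \<zero>"
  by (rule coef_eqI) (auto simp: homog_def deg_part coef_zero)

lemma finite_deg_part: "y \<in> carrier R \<Longrightarrow> finite {k. deg_part k y \<noteq> \<zero>}"
proof (rule finite_subset)
  assume y: "y \<in> carrier R"
  show "{k. deg_part k y \<noteq> \<zero>} \<subseteq> (int \<circ> len) ` {p \<in> B. coef y p \<noteq> 0}"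
  proof
    fix k assume k: "k \<in> {k. deg_part k y \<noteq> \<zero>}"
    then obtain p where "p \<in> B" "coef (deg_part k y) p \<noteq> coef \<zero> p"
      using coef_eqI[of "deg_part k y" \<zero>] deg_part[OF y] by auto
    then show "k \<in> (int \<circ> len) ` {p \<in> B. coef y p \<noteq> 0}"
      by (auto simp: deg_part[OF y] coef_zero split: if_splits)
  qed
  show "finite ((int \<circ> len) ` {p \<in> B. coef y p \<noteq> 0})"
    using coef_finite[OF y] by simp
qed

text \<open>
  The reindexing \<open>g\<close> serves both the grading of the ring, where \<open>g\<close> embeds the natural numbers, and
  shifted gradings of modules.
\<close>

lemma sum_deg_part:
  assumes y: "y \<in> carrier R" and S: "finite S" "\<And>k. deg_part k y \<noteq> \<zero> \<Longrightarrow> k \<in> g ` S" "inj_on g S"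
  shows "(\<Oplus>k\<in>S. deg_part (g k) y) = y"
proof (rule coef_eqI)
  fix p assume p: "p \<in> B"
  have "coef (\<Oplus>k\<in>S. deg_part (g k) y) p = (\<Sum>k\<in>S. if int (len p) = g k then coef y p else 0)"
    by (subst coef_finsum) (use S p y in \<open>auto simp: deg_part\<close>)
  also have "\<dots> = (\<Sum>l\<in>g ` S. if int (len p) = l then coef y p else 0)"
    by (subst sum.reindex[OF S(3)]) simp
  also have "\<dots> = (if int (len p) \<in> g ` S then coef y p else 0)"
    using S by (simp add: sum.delta')
  also have "\<dots> = coef y p"
  proof (cases "int (len p) \<in> g ` S")
    case False
    then have "deg_part (int (len p)) y = \<zero>" using S(2) by blast
    then show ?thesis using deg_part(2)[OF y p, of "int (len p)"] p False by (simp add: coef_zero)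
  qed simp
  finally show "coef (\<Oplus>k\<in>S. deg_part (g k) y) p = coef y p" .
qed (use y deg_part in \<open>auto intro: finsum_closed\<close>)

abbreviation grading :: "nat \<Rightarrow> 'a set" where
  "grading n \<equiv> homog (int n)"

lemma one_homog: "\<one> \<in> homog 0"
proof -
  have "len p = 0" if p: "p \<in> B" "coef \<one> p \<noteq> 0" for p
  proof -
    have "coef (idem (stop p)) p \<noteq> 0"
      using coef_mult_idem[OF one_closed stop_in[OF p(1)] p(1)] p idem_in[OF stop_in[OF p(1)]]
      by simp
    then show ?thesis
      using p by (metis coef_idem len_triv stop_in)
  qed
  then show ?thesis by (simp add: homog_def)
qed

lemma
  shows graded_ring: "graded_ring R grading"
    and homogeneous_part_eq: "y \<in> carrier R \<Longrightarrow> homogeneous_part R grading n y = deg_part (int n) y"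
proof -
  let ?\<pi> = "\<lambda>n. deg_part (int n)"
  have nonneg: "k \<in> range int" if "deg_part k y \<noteq> \<zero>" "y \<in> carrier R" for k y
  proof -
    have "k \<ge> 0"
      using deg_part_homog[OF that(2), of k] homog_negative[of k] that(1) by (cases "k < 0") auto
    then show ?thesis by (metis nonneg_int_cases rangeI)
  qed
  have fin: "finite {n \<in> UNIV. ?\<pi> n y \<noteq> \<zero>}" if "y \<in> carrier R" for y
    using finite_vimageI[OF finite_deg_part[OF that], of int] by (simp add: vimage_def)
  have sum: "y = (\<Oplus>n\<in>{n \<in> UNIV. ?\<pi> n y \<noteq> \<zero>}. ?\<pi> n y)" if "y \<in> carrier R" for y
    by (rule sum_deg_part[symmetric]) (use that fin nonneg in \<open>fastforce simp: inj_on_def\<close>)+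
  note decomp = is_decomposition_iff_projections[where J = UNIV and G = grading and \<pi> = ?\<pi>,
      OF is_abelian_group additive_subgroup_homog deg_part_homog deg_part_add deg_part_same _ fin sum]
  have "is_direct_sum R UNIV grading"
    by (rule is_direct_sum_by_projections[where \<pi> = ?\<pi>,
      OF is_abelian_group additive_subgroup_homog deg_part_homog deg_part_add deg_part_same _ fin sum])
      (auto intro: deg_part_other)
  then show "graded_ring R grading"
    unfolding graded_ring_def of_nat_add using homog_mult ring_axioms by blast
  show "homogeneous_part R grading n y = ?\<pi> n y" if "y \<in> carrier R"
  proof -
    have "is_decomposition R UNIV grading y f \<longleftrightarrow> f = (\<lambda>j\<in>UNIV. ?\<pi> j y)" for f
      by (rule decomp) (use that in \<open>auto intro: deg_part_other\<close>)
    then show ?thesis by (simp add: homogeneous_part_def)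
  qed
qed


subsection \<open>Sums of principal left ideals\<close>

text \<open>
  The projective left module at \<open>v\<close>.  For the opposite of \<open>KQ / I\<close> it agrees with
  \<open>vertex_projective\<close>, up to the meaningless fields \<open>mult\<close> and \<open>one\<close>.
\<close>

definition principal :: "'v \<Rightarrow> ('a, 'a) graded_module" where
  "principal v =
    \<lparr>carrier = ideal_at v, mult = undefined, one = undefined, zero = \<zero>, add = add R,
     smult = mult R, grade = (\<lambda>k. ideal_at v \<inter> homog k)\<rparr>"

definition principal_sum :: "'j set \<Rightarrow> ('j \<Rightarrow> 'v) \<Rightarrow> nat \<Rightarrow> ('a, 'j \<Rightarrow> 'a) graded_module" where
  "principal_sum J w n = shift (int n) (graded_direct_sum J (\<lambda>j. principal (w j)))"

lemma left_module_principal: "v \<in> V \<Longrightarrow> left_module R (principal v)"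
proof -
  assume v: "v \<in> V"
  interpret S: additive_subgroup "ideal_at v" R
    by (rule additive_subgroup_ideal_at[OF v])
  have "abelian_group (principal v)"
  proof (rule abelian_groupI)
    fix y assume "y \<in> carrier (principal v)"
    then show "\<exists>z\<in>carrier (principal v). z \<oplus>\<^bsub>principal v\<^esub> y = \<zero>\<^bsub>principal v\<^esub>"
      by (intro bexI[of _ "\<ominus> y"]) (auto simp: principal_def l_neg S.a_Hcarr)
  qed (auto simp: principal_def a_ac S.a_Hcarr)
  then show ?thesis
    by (intro left_moduleI[OF ring_axioms])
      (auto simp: principal_def mult_ideal_at v S.a_Hcarr l_distr r_distr m_assoc)
qed

lemma principal_sum_simps:
  "zero (principal_sum J w n) = (\<lambda>j\<in>J. \<zero>)"
  "add (principal_sum J w n) = (\<lambda>f g. \<lambda>j\<in>J. f j \<oplus> g j)"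
  "smult (principal_sum J w n) = (\<lambda>a f. \<lambda>j\<in>J. a \<otimes> f j)"
  by (simp_all add: principal_sum_def shift_def graded_direct_sum_def graded_by_def direct_sum_def
      principal_def)

lemma principal_sum_carrier:
  assumes "finite J"
  shows "carrier (principal_sum J w n) = (\<Pi>\<^sub>E j\<in>J. ideal_at (w j))"
    and "grade (principal_sum J w n) k = {f \<in> \<Pi>\<^sub>E j\<in>J. ideal_at (w j). \<forall>j\<in>J. f j \<in> homog (k - int n)}"
  using assms by (auto simp: principal_sum_def shift_def graded_direct_sum_def graded_by_def
      carrier_direct_sum_finite principal_def)

lemma left_module_principal_sum:
  assumes "finite J" "w \<in> J \<rightarrow> V"
  shows "left_module R (principal_sum J w n)"
  by (rule left_module_cong[OF left_module_direct_sum[of J R "\<lambda>j. principal (w j)"]])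
    (use assms left_module_principal ring_axioms in
      \<open>auto simp: principal_sum_def shift_def graded_direct_sum_def graded_by_def\<close>)

lemma finsum_principal_sum:
  assumes J: "finite J" "w \<in> J \<rightarrow> V" and j: "j \<in> J"
    and F: "finite F" "f \<in> F \<rightarrow> carrier (principal_sum J w n)"
  shows "(\<Oplus>\<^bsub>principal_sum J w n\<^esub>k\<in>F. f k) j = (\<Oplus>k\<in>F. f k j)"
proof -
  interpret T: left_module R "principal_sum J w n" by (rule left_module_principal_sum[OF J])
  show ?thesis
    using F
  proof (induction F)
    case empty
    then show ?case using j by (simp add: principal_sum_simps)
  next
    case (insert k F)
    have "f i j \<in> carrier R" if "i \<in> insert k F" for i
      using insert.prems that j
      by (auto simp: principal_sum_carrier[OF J(1)] PiE_iff Pi_iff intro: ideal_at_carrier)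
    with insert show ?case
      using j by (simp add: principal_sum_simps(2) Pi_iff)
  qed
qed

lemma graded_module_principal_sum:
  assumes J: "finite J" "w \<in> J \<rightarrow> V"
  shows "is_graded_module R grading (principal_sum J w n)"
proof -
  interpret T: left_module R "principal_sum J w n" by (rule left_module_principal_sum[OF J])
  let ?T = "principal_sum J w n"
  let ?\<pi> = "\<lambda>k f. \<lambda>j\<in>J. deg_part (k - int n) (f j)"
  have wV: "w j \<in> V" if "j \<in> J" for j using that J by blast
  note car = principal_sum_carrier[OF J(1)]
  have c: "f j \<in> carrier R" if "f \<in> carrier ?T" "j \<in> J" for f j
    using that by (auto simp: car PiE_iff intro: ideal_at_carrier)
  have deg_ideal: "deg_part k y \<in> ideal_at v" if "y \<in> ideal_at v" "v \<in> V" for k y v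
    using that by (auto simp: ideal_at_iff deg_part split: if_splits)
  have sub: "additive_subgroup (grade ?T k) ?T" for k
  proof (rule additive_subgroup.intro, rule T.M.add.subgroupI)
    interpret H: additive_subgroup "homog l" R for l by (rule additive_subgroup_homog)
    show "grade ?T k \<noteq> {}"
      using T.M.zero_closed by (auto simp: car principal_sum_simps intro!: exI[of _ "\<lambda>j\<in>J. \<zero>"])
    fix f assume f: "f \<in> grade ?T k"
    show "\<ominus>\<^bsub>?T\<^esub> f \<in> grade ?T k"
    proof -
      have fc: "f \<in> carrier ?T" using f by (simp add: car)
      have "(\<ominus>\<^bsub>?T\<^esub> f) j = \<ominus> f j" if j: "j \<in> J" for j
      proof (rule minus_equality[symmetric])
        show "(\<ominus>\<^bsub>?T\<^esub> f) j \<oplus> f j = \<zero>"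
          using fun_cong[OF T.M.l_neg[OF fc], of j] j by (simp add: principal_sum_simps)
      qed (use c j fc in auto)
      then show ?thesis
        using T.M.a_inv_closed[OF fc] f by (auto simp: car)
    qed
    fix g assume g: "g \<in> grade ?T k"
    show "f \<oplus>\<^bsub>?T\<^esub> g \<in> grade ?T k"
      using f g T.M.a_closed[of f g] by (auto simp: car principal_sum_simps)
  qed (auto simp: car)
  have fin: "finite {k \<in> UNIV. ?\<pi> k f \<noteq> \<zero>\<^bsub>?T\<^esub>}" if f: "f \<in> carrier ?T" for f
  proof (rule finite_subset)
    show "{k \<in> UNIV. ?\<pi> k f \<noteq> \<zero>\<^bsub>?T\<^esub>} \<subseteq> (\<Union>j\<in>J. (\<lambda>k. k + int n) ` {k. deg_part k (f j) \<noteq> \<zero>})"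
      by (auto simp: principal_sum_simps fun_eq_iff image_iff) (metis diff_add_cancel)
    show "finite (\<Union>j\<in>J. (\<lambda>k. k + int n) ` {k. deg_part k (f j) \<noteq> \<zero>})"
      using J finite_deg_part c f by auto
  qed
  have \<pi>_in: "?\<pi> k f \<in> grade ?T k" if "f \<in> carrier ?T" for k f
    using that c[OF that] by (auto simp: car PiE_iff wV intro: deg_part_homog deg_ideal)
  have sum: "f = (\<Oplus>\<^bsub>?T\<^esub>k\<in>{k \<in> UNIV. ?\<pi> k f \<noteq> \<zero>\<^bsub>?T\<^esub>}. ?\<pi> k f)" (is "f = finsum _ _ ?S")
    if f: "f \<in> carrier ?T" for f
  proof
    fix j
    have Pi: "(\<lambda>k. ?\<pi> k f) \<in> ?S \<rightarrow> carrier ?T"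
      using \<pi>_in[OF f] by (auto simp: car)
    then have sum_c: "(\<Oplus>\<^bsub>?T\<^esub>k\<in>?S. ?\<pi> k f) \<in> carrier ?T"
      by (rule T.M.finsum_closed)
    show "f j = (\<Oplus>\<^bsub>?T\<^esub>k\<in>?S. ?\<pi> k f) j"
    proof (cases "j \<in> J")
      case True
      have "(\<Oplus>\<^bsub>?T\<^esub>k\<in>?S. ?\<pi> k f) j = (\<Oplus>k\<in>?S. ?\<pi> k f j)"
        by (rule finsum_principal_sum[OF J True fin[OF f] Pi])
      also have "\<dots> = (\<Oplus>k\<in>?S. deg_part (k - int n) (f j))"
        by (rule finsum_cong') (use True c f deg_part in auto)
      also have "\<dots> = f j"
      proof (rule sum_deg_part[OF c[OF f True] fin[OF f]])
        show "k \<in> (\<lambda>k. k - int n) ` ?S" if "deg_part k (f j) \<noteq> \<zero>" for k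
          by (rule image_eqI[of _ _ "k + int n"])
            (use that True in \<open>auto simp: principal_sum_simps fun_eq_iff\<close>)
      qed (auto simp: inj_on_def)
      finally show ?thesis by simp
    next
      case False
      then show ?thesis using f sum_c by (auto simp: car PiE_iff extensional_def)
    qed
  qed
  have "is_direct_sum ?T UNIV (grade ?T)"
  proof (rule is_direct_sum_by_projections[where \<pi> = ?\<pi>, OF T.M.abelian_group_axioms sub \<pi>_in _ _ _ fin sum])
    fix k f g assume "f \<in> carrier ?T" "g \<in> carrier ?T"
    then show "?\<pi> k (f \<oplus>\<^bsub>?T\<^esub> g) = ?\<pi> k f \<oplus>\<^bsub>?T\<^esub> ?\<pi> k g"
      by (auto simp: principal_sum_simps fun_eq_iff c deg_part_add)
  next
    fix k f assume f: "f \<in> grade ?T k"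
    then show "?\<pi> k f = f"
      by (auto simp: car fun_eq_iff deg_part_same PiE_iff extensional_def)
    fix l assume "l \<noteq> k"
    with f show "?\<pi> l f = \<zero>\<^bsub>?T\<^esub>"
      by (auto simp: car fun_eq_iff principal_sum_simps intro!: deg_part_other)
  qed
  moreover have "a \<odot>\<^bsub>?T\<^esub> f \<in> grade ?T (int m + k)" if "a \<in> grading m" "f \<in> grade ?T k" for a f m k
  proof -
    have "a \<otimes> f j \<in> homog (int m + k - int n)" if "j \<in> J" for j
      using homog_mult[OF \<open>a \<in> grading m\<close>, of "f j" "k - int n"] \<open>f \<in> grade ?T k\<close> that
      by (simp add: car add_diff_eq)
    with that show ?thesis
      by (auto simp: car principal_sum_simps PiE_iff wV mult_ideal_at homog_carrier)
  qed
  ultimately show ?thesis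
    unfolding is_graded_module_def using graded_ring T.left_module_axioms by blast
qed

definition basis_vector :: "'j set \<Rightarrow> ('j \<Rightarrow> 'v) \<Rightarrow> 'j \<Rightarrow> 'j \<Rightarrow> 'a" where
  "basis_vector J w j = (\<lambda>k\<in>J. if k = j then idem (w j) else \<zero>)"

lemma basis_vector_in:
  assumes J: "finite J" "w \<in> J \<rightarrow> V" and j: "j \<in> J"
  shows "basis_vector J w j \<in> grade (principal_sum J w n) (int n)"
proof -
  have "\<zero> \<in> ideal_at (w k)" "\<zero> \<in> homog 0" if "k \<in> J" for k
    using additive_subgroup.zero_closed[OF additive_subgroup_ideal_at[of "w k"]]
      additive_subgroup.zero_closed[OF additive_subgroup_homog] that J by auto
  then show ?thesis
    using J j idem_homog[of "w j"] idem_ideal_at[of "w j"]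
    by (auto simp: principal_sum_carrier basis_vector_def Pi_iff)
qed

lemma principal_sum_expansion:
  assumes J: "finite J" "w \<in> J \<rightarrow> V" and f: "f \<in> carrier (principal_sum J w n)"
  shows "(\<Oplus>\<^bsub>principal_sum J w n\<^esub>j\<in>J. f j \<odot>\<^bsub>principal_sum J w n\<^esub> basis_vector J w j) = f" (is "?s = f")
proof
  interpret T: left_module R "principal_sum J w n" by (rule left_module_principal_sum[OF J])
  let ?T = "principal_sum J w n"
  note car = principal_sum_carrier[OF J(1)]
  have fc: "f j \<in> ideal_at (w j)" "f j \<in> carrier R" if "j \<in> J" for j
    using f that by (auto simp: car PiE_iff intro: ideal_at_carrier)
  have bc: "basis_vector J w j \<in> carrier ?T" if "j \<in> J" for j
    using basis_vector_in[OF J that, of n] by (auto simp: car)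
  have Pi: "(\<lambda>j. f j \<odot>\<^bsub>?T\<^esub> basis_vector J w j) \<in> J \<rightarrow> carrier ?T"
    using T.smult_closed fc bc by auto
  fix k
  show "?s k = f k"
  proof (cases "k \<in> J")
    case True
    have "?s k = (\<Oplus>j\<in>J. (f j \<odot>\<^bsub>?T\<^esub> basis_vector J w j) k)"
      by (rule finsum_principal_sum[OF J True J(1) Pi])
    also have "\<dots> = (\<Oplus>j\<in>J. if k = j then f j else \<zero>)"
      by (rule finsum_cong')
        (use True fc in \<open>auto simp: principal_sum_simps basis_vector_def ideal_at_def\<close>)
    also have "\<dots> = f k"
      by (rule finsum_singleton[OF True J(1)]) (use fc in auto)
    finally show ?thesis .
  next
    case False
    then show ?thesis
      using f T.M.finsum_closed[OF Pi] by (auto simp: car PiE_iff extensional_def)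
  qed
qed

lemma projective_principal_sum:
  assumes J: "finite J" "w \<in> J \<rightarrow> V"
  shows "projective_module R (principal_sum J w n)"
proof -
  interpret T: left_module R "principal_sum J w n" by (rule left_module_principal_sum[OF J])
  let ?T = "principal_sum J w n" and ?b = "basis_vector J w"
  note car = principal_sum_carrier[OF J(1)]
  have inj: "inj_on ?b J"
  proof (rule inj_onI, rule ccontr)
    fix i j assume ij: "i \<in> J" "j \<in> J" "?b i = ?b j" "i \<noteq> j"
    have "?b i i = idem (w i)" "?b j i = \<zero>" using ij(1,2,4) by (auto simp: basis_vector_def)
    then show False using ij(1,3) idem_nonzero[of "w i"] J by (auto simp: Pi_iff)
  qed
  have inv: "the_inv_into J ?b (?b j) = j" if "j \<in> J" for j
    by (rule the_inv_into_f_f[OF inj that])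
  have bc: "?b j \<in> carrier ?T" if "j \<in> J" for j
    using basis_vector_in[OF J that, of n] by (auto simp: car)
  have fc: "f j \<in> carrier R" if "j \<in> J" "f \<in> carrier ?T" for f j
    using that by (auto simp: car PiE_iff intro: ideal_at_carrier)
  show ?thesis
  proof (rule projective_module_dual_basis[where X = "?b ` J" and \<phi> = "\<lambda>b f. f (the_inv_into J ?b b)"])
    show "(\<lambda>f. f (the_inv_into J ?b b)) \<in> module_hom R ?T (regular_module R)" if "b \<in> ?b ` J" for b
      using that by (auto simp: inv module_hom_def hom_def regular_module_def fc principal_sum_simps)
    fix f assume f: "f \<in> carrier ?T"
    have "(\<Oplus>\<^bsub>?T\<^esub>b\<in>?b ` J. f (the_inv_into J ?b b) \<odot>\<^bsub>?T\<^esub> b)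
        = (\<Oplus>\<^bsub>?T\<^esub>j\<in>J. f (the_inv_into J ?b (?b j)) \<odot>\<^bsub>?T\<^esub> ?b j)"
      by (rule T.M.finsum_reindex[OF _ inj]) (use f in \<open>auto simp: inv bc fc intro: T.smult_closed\<close>)
    also have "\<dots> = (\<Oplus>\<^bsub>?T\<^esub>j\<in>J. f j \<odot>\<^bsub>?T\<^esub> ?b j)"
      by (rule T.M.finsum_cong') (use f in \<open>auto simp: inv bc fc intro: T.smult_closed\<close>)
    also have "\<dots> = f"
      by (rule principal_sum_expansion[OF J f])
    finally show "(\<Oplus>\<^bsub>?T\<^esub>b\<in>?b ` J. f (the_inv_into J ?b b) \<odot>\<^bsub>?T\<^esub> b) = f" .
  qed (use J bc T.left_module_axioms in auto)
qed

text \<open>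
  Every element is a combination of the basis vectors, and these lie in degree \<open>n\<close>.
\<close>

lemma principal_sum_generated:
  assumes J: "finite J" "w \<in> J \<rightarrow> V"
  shows "carrier (principal_sum J w n) =
    (\<lambda>N. submodule N R (principal_sum J w n)) hull grade (principal_sum J w n) (int n)"
    (is "carrier ?T = ?S hull ?G")
proof
  interpret T: left_module R "principal_sum J w n" by (rule left_module_principal_sum[OF J])
  note car = principal_sum_carrier[OF J(1)]
  have sub: "subgroup (carrier ?T) (add_monoid ?T)"
    using group.subgroup_self[OF T.M.a_group] by simp
  then have "submodule (carrier ?T) R ?T"
    by (auto simp: submodule_def submodule_axioms_def T.smult_closed)
  then show "?S hull ?G \<subseteq> carrier ?T"
    by (intro hull_minimal) (auto simp: car)
  show "carrier ?T \<subseteq> ?S hull ?G"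
    unfolding hull_def
  proof (intro subsetI InterI, clarify)
    fix f N assume f: "f \<in> carrier ?T" and N: "submodule N R ?T" "?G \<subseteq> N"
    interpret N: submodule N R ?T by fact
    have fc: "f j \<in> carrier R" if "j \<in> J" for j
      using that f by (auto simp: car PiE_iff intro: ideal_at_carrier)
    have "(\<Oplus>\<^bsub>?T\<^esub>j\<in>F. f j \<odot>\<^bsub>?T\<^esub> basis_vector J w j) \<in> N" if "F \<subseteq> J" for F
      using finite_subset[OF that J(1)] that
    proof (induction F)
      case empty
      then show ?case using N.one_closed by simp
    next
      case (insert j F)
      have "basis_vector J w i \<in> N" if "i \<in> J" for i
        using basis_vector_in[OF J that] N(2) by blast
      then have sm: "f i \<odot>\<^bsub>?T\<^esub> basis_vector J w i \<in> N" if "i \<in> insert j F" for i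
        using that insert.prems fc by auto
      moreover have "N \<subseteq> carrier ?T" using N.subset by simp
      ultimately have "(\<lambda>i. f i \<odot>\<^bsub>?T\<^esub> basis_vector J w i) \<in> insert j F \<rightarrow> carrier ?T"
        by blast
      with insert sm show ?case
        using N.m_closed[of "f j \<odot>\<^bsub>?T\<^esub> basis_vector J w j"] by (auto simp: Pi_iff)
    qed
    from this[OF order_refl] show "f \<in> N"
      using principal_sum_expansion[OF J f] by simp
  qed
qed

subsection \<open>Right multiplication by arrows\<close>

text \<open>
  The cofactor of \<open>arr \<alpha>\<close> in \<open>y\<close>: drop the last arrow \<open>\<alpha>\<close> from all paths that end with
  it and delete the other paths.
\<close>

definition strip :: "'e \<Rightarrow> 'a \<Rightarrow> 'a" where
  "strip \<alpha> y = of_coef (\<lambda>p. if ext p \<alpha> \<in> B then coef y (ext p \<alpha>) else 0)"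

lemma strip:
  assumes y: "y \<in> carrier R" and \<alpha>: "\<alpha> \<in> E"
  shows "strip \<alpha> y \<in> carrier R"
    and "p \<in> B \<Longrightarrow> coef (strip \<alpha> y) p = (if ext p \<alpha> \<in> B then coef y (ext p \<alpha>) else 0)"
    and "strip \<alpha> y \<in> ideal_at (src \<alpha>)"
proof -
  let ?f = "\<lambda>p. if ext p \<alpha> \<in> B then coef y (ext p \<alpha>) else 0"
  have "inj_on (\<lambda>p. ext p \<alpha>) {p \<in> B. ?f p \<noteq> 0}"
    by (rule inj_onI) (use \<alpha> ext_inj in \<open>auto split: if_splits\<close>)
  moreover have "finite ((\<lambda>p. ext p \<alpha>) ` {p \<in> B. ?f p \<noteq> 0})"
    by (rule finite_subset[OF _ coef_finite[OF y]]) (auto split: if_splits)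
  ultimately have fin: "finite {p \<in> B. ?f p \<noteq> 0}"
    using finite_imageD by blast
  show 1: "strip \<alpha> y \<in> carrier R"
    unfolding strip_def by (rule of_coef(1)[OF fin])
  show 2: "coef (strip \<alpha> y) p = ?f p" if "p \<in> B" for p
    unfolding strip_def by (rule of_coef(2)[OF fin that])
  show "strip \<alpha> y \<in> ideal_at (src \<alpha>)"
    unfolding ideal_at_iff[OF src_in[OF \<alpha>]] using 1 2 \<alpha> ext_props by auto
qed

text \<open>
  As every nontrivial path is the prolongation of a shorter one, elements are compared separately on
  trivial paths and on prolonged paths, which is where products with arrows are known.
\<close>

lemma coef_ext_eqI:
  assumes "y \<in> carrier R" "z \<in> carrier R"
    and "\<And>p. \<lbrakk>p \<in> B; len p = 0\<rbrakk> \<Longrightarrow> coef y p = coef z p"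
    and "\<And>p \<alpha>. \<lbrakk>p \<in> B; \<alpha> \<in> E; ext p \<alpha> \<in> B\<rbrakk> \<Longrightarrow> coef y (ext p \<alpha>) = coef z (ext p \<alpha>)"
  shows "y = z"
  using assms ext_cases by (intro coef_eqI) blast+

lemma mult_prv_arr:
  assumes y: "y \<in> carrier R" and \<alpha>: "\<alpha> \<in> E" "prv \<alpha> = Some \<gamma>"
  shows "y \<otimes> arr \<gamma> \<otimes> arr \<alpha> = \<zero>"
proof -
  have \<gamma>: "\<gamma> \<in> E" using prv_in[OF \<alpha>] by simp
  have c: "y \<otimes> arr \<gamma> \<in> carrier R" using y \<gamma> arr_in by simp
  have zero: "coef (y \<otimes> arr \<gamma>) p = 0" if p: "p \<in> B" "ext p \<alpha> \<in> B" for p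
  proof (cases "len p = 0")
    case False
    then obtain p' \<beta> where "p' \<in> B" "\<beta> \<in> E" "p = ext p' \<beta>" using ext_cases p by blast
    then show ?thesis
      using coef_mult_arr_ext[OF y _ _ \<gamma>, of p' \<beta>] prv_blocks[OF _ \<alpha>, of p'] p by auto
  qed (use coef_mult_arr_zero y p \<gamma> in auto)
  show ?thesis
    by (rule coef_ext_eqI)
      (use c \<alpha> arr_in zero in \<open>auto simp: coef_mult_arr_ext coef_mult_arr_zero coef_zero\<close>)
qed

text \<open>
  The heart of the proof.  Right multiplication with \<open>arr \<alpha>\<close> maps the paths that can be prolonged by
  \<open>\<alpha>\<close> to distinct paths, so it is injective on their span.  An element of its kernel therefore
  involves only paths whose prolongation is blocked, and these all end with the one arrow \<open>prv \<alpha>\<close>.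
\<close>

lemma mult_arr_eq_zeroE:
  assumes y: "y \<in> ideal_at (src \<alpha>)" and \<alpha>: "\<alpha> \<in> E" and zero: "y \<otimes> arr \<alpha> = \<zero>"
  shows "prv \<alpha> = None \<Longrightarrow> y = \<zero>"
    and "prv \<alpha> = Some \<gamma> \<Longrightarrow> y = strip \<gamma> y \<otimes> arr \<gamma>"
proof -
  have yc: "y \<in> carrier R" using y by (rule ideal_at_carrier)
  \<comment> \<open>Every path in the support of \<open>y\<close> ends with the arrow \<open>prv \<alpha>\<close>.\<close>
  have supp: "\<exists>\<gamma> p'. prv \<alpha> = Some \<gamma> \<and> p' \<in> B \<and> p = ext p' \<gamma>" if p: "p \<in> B" "coef y p \<noteq> 0" for p
  proof -
    have "stop p = src \<alpha>"
      using y p by (simp add: ideal_at_iff src_in \<alpha>)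
    moreover have "ext p \<alpha> \<notin> B"
      using coef_mult_arr_ext[OF yc p(1) \<alpha> \<alpha>] p(2) by (auto simp: zero coef_zero)
    ultimately show ?thesis using ext_blocked[OF p(1) \<alpha>] by blast
  qed
  show "y = \<zero>" if "prv \<alpha> = None"
    by (rule coef_eqI) (use yc supp that in \<open>auto simp: coef_zero\<close>)
  show "y = strip \<gamma> y \<otimes> arr \<gamma>" if \<gamma>': "prv \<alpha> = Some \<gamma>"
  proof (rule coef_ext_eqI)
    have \<gamma>: "\<gamma> \<in> E" using prv_in[OF \<alpha> \<gamma>'] by simp
    note s = strip[OF yc \<gamma>]
    show "strip \<gamma> y \<otimes> arr \<gamma> \<in> carrier R" using s \<gamma> arr_in by simp
    show "coef y p = coef (strip \<gamma> y \<otimes> arr \<gamma>) p" if "p \<in> B" "len p = 0" for p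
      using supp[OF that(1)] that \<gamma> \<gamma>' ext_props s(1) by (fastforce simp: coef_mult_arr_zero)
    show "coef y (ext p \<beta>) = coef (strip \<gamma> y \<otimes> arr \<gamma>) (ext p \<beta>)"
      if p: "p \<in> B" "\<beta> \<in> E" "ext p \<beta> \<in> B" for p \<beta>
    proof (cases "\<beta> = \<gamma>")
      case False
      then have "coef y (ext p \<beta>) = 0"
        using supp[OF p(3)] \<gamma> \<gamma>' ext_inj[of p _ \<beta> \<gamma>] p by (metis option.inject)
      then show ?thesis using False p \<gamma> s by (simp add: coef_mult_arr_ext)
    qed (use p \<gamma> s in \<open>simp add: coef_mult_arr_ext\<close>)
  qed (rule yc)
qed

lemma finsum_mult_arr_ext:
  assumes A: "A \<subseteq> E" "r \<in> A \<rightarrow> carrier R" and p: "p \<in> B" "\<alpha> \<in> E" "ext p \<alpha> \<in> B"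
  shows "coef (\<Oplus>\<beta>\<in>A. r \<beta> \<otimes> arr \<beta>) (ext p \<alpha>) = (if \<alpha> \<in> A then coef (r \<alpha>) p else 0)"
proof -
  have finA: "finite A" using A finite_E finite_subset by blast
  have "coef (\<Oplus>\<beta>\<in>A. r \<beta> \<otimes> arr \<beta>) (ext p \<alpha>) = (\<Sum>\<beta>\<in>A. coef (r \<beta> \<otimes> arr \<beta>) (ext p \<alpha>))"
    using A arr_in by (intro coef_finsum) (auto simp: finA p Pi_iff)
  also have "\<dots> = (\<Sum>\<beta>\<in>A. if \<alpha> = \<beta> then coef (r \<beta>) p else 0)"
    using A p by (intro sum.cong) (auto simp: coef_mult_arr_ext Pi_iff subset_iff)
  finally show ?thesis using finA by (simp add: sum.delta')
qed

lemma finsum_mult_arr_zero_len: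
  assumes A: "A \<subseteq> E" "r \<in> A \<rightarrow> carrier R" and p: "p \<in> B" "len p = 0"
  shows "coef (\<Oplus>\<beta>\<in>A. r \<beta> \<otimes> arr \<beta>) p = 0"
proof -
  have finA: "finite A" using A finite_E finite_subset by blast
  have "coef (\<Oplus>\<beta>\<in>A. r \<beta> \<otimes> arr \<beta>) p = (\<Sum>\<beta>\<in>A. coef (r \<beta> \<otimes> arr \<beta>) p)"
    using A arr_in by (intro coef_finsum) (auto simp: finA p Pi_iff)
  also have "\<dots> = 0"
    using A p by (intro sum.neutral) (auto simp: coef_mult_arr_zero Pi_iff subset_iff)
  finally show ?thesis .
qed

lemma finsum_mult_arr_closed:
  "\<lbrakk>A \<subseteq> E; r \<in> A \<rightarrow> carrier R\<rbrakk> \<Longrightarrow> (\<Oplus>\<beta>\<in>A. r \<beta> \<otimes> arr \<beta>) \<in> carrier R"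
  by (rule finsum_closed) (auto simp: Pi_iff arr_in subset_iff)

text \<open>
  Products with different arrows are linearly independent, because a path determines its last arrow.
\<close>

lemma finsum_mult_arr_eq_zeroD:
  assumes A: "A \<subseteq> E" "r \<in> A \<rightarrow> carrier R" and zero: "(\<Oplus>\<beta>\<in>A. r \<beta> \<otimes> arr \<beta>) = \<zero>" and \<alpha>: "\<alpha> \<in> A"
  shows "r \<alpha> \<otimes> arr \<alpha> = \<zero>"
proof -
  have \<alpha>E: "\<alpha> \<in> E" and r: "r \<alpha> \<in> carrier R" using A \<alpha> by auto
  show ?thesis
  proof (rule coef_ext_eqI)
    show "coef (r \<alpha> \<otimes> arr \<alpha>) (ext p \<beta>) = coef \<zero> (ext p \<beta>)"
      if "p \<in> B" "\<beta> \<in> E" "ext p \<beta> \<in> B" for p \<beta>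
      using finsum_mult_arr_ext[OF A that] that \<alpha> \<alpha>E r by (auto simp: zero coef_zero coef_mult_arr_ext)
  qed (use \<alpha>E r arr_in in \<open>auto simp: coef_mult_arr_zero coef_zero\<close>)
qed

text \<open>
  Sorting the paths of positive length by their last arrow.
\<close>

lemma radical_expansion:
  assumes y: "y \<in> ideal_at v" and v: "v \<in> V" and zero: "deg_part 0 y = \<zero>"
  shows "(\<Oplus>\<alpha>\<in>{\<alpha> \<in> E. tgt \<alpha> = v}. strip \<alpha> y \<otimes> arr \<alpha>) = y"
proof -
  have yc: "y \<in> carrier R" using y by (rule ideal_at_carrier)
  have A: "{\<alpha> \<in> E. tgt \<alpha> = v} \<subseteq> E" "(\<lambda>\<alpha>. strip \<alpha> y) \<in> {\<alpha> \<in> E. tgt \<alpha> = v} \<rightarrow> carrier R"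
    using strip yc by auto
  show ?thesis
  proof (rule coef_ext_eqI)
    show "coef (\<Oplus>\<alpha>\<in>{\<alpha> \<in> E. tgt \<alpha> = v}. strip \<alpha> y \<otimes> arr \<alpha>) p = coef y p"
      if "p \<in> B" "len p = 0" for p
      using finsum_mult_arr_zero_len[OF A that] deg_part(2)[OF yc that(1), of 0] that
      by (simp add: zero coef_zero)
    show "coef (\<Oplus>\<alpha>\<in>{\<alpha> \<in> E. tgt \<alpha> = v}. strip \<alpha> y \<otimes> arr \<alpha>) (ext p \<beta>) = coef y (ext p \<beta>)"
      if p: "p \<in> B" "\<beta> \<in> E" "ext p \<beta> \<in> B" for p \<beta>
      using finsum_mult_arr_ext[OF A p] strip(2)[OF yc p(2,1)] y p ext_props[OF p]
      by (auto simp: ideal_at_iff v)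
  qed (use finsum_mult_arr_closed[OF A] yc in auto)
qed

subsection \<open>The simple modules\<close>

definition simple_at :: "'v \<Rightarrow> ('a, 'k) graded_module" where
  "simple_at v =
    \<lparr>carrier = UNIV, mult = (*), one = 1, zero = 0, add = (+), smult = (\<lambda>a x. x * coef a (triv v)),
     grade = (\<lambda>k. if k = 0 then UNIV else {0})\<rparr>"

lemma coef_one_triv: "v \<in> V \<Longrightarrow> coef \<one> (triv v) = 1"
  using coef_mult_idem[of \<one> v "triv v"] coef_idem[of v "triv v"]
  by (simp add: triv_in stop_triv idem_in)

lemma deg_part_zero_iff:
  assumes y: "y \<in> ideal_at v" and v: "v \<in> V"
  shows "deg_part 0 y = \<zero> \<longleftrightarrow> coef y (triv v) = 0"
proof
  have yc: "y \<in> carrier R" using y by (rule ideal_at_carrier)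
  show "coef y (triv v) = 0" if "deg_part 0 y = \<zero>"
    using deg_part(2)[OF yc triv_in[OF v], of 0] v by (simp add: that coef_zero triv_in len_triv)
  show "deg_part 0 y = \<zero>" if zero: "coef y (triv v) = 0"
  proof (rule coef_eqI)
    fix p assume p: "p \<in> B"
    show "coef (deg_part 0 y) p = coef \<zero> p"
      using p y len_zero[OF p] zero
      by (auto simp: deg_part(2)[OF yc p] coef_zero ideal_at_iff v)
  qed (use yc deg_part in auto)
qed

lemma graded_module_simple_at:
  assumes v: "v \<in> V"
  shows "is_graded_module R grading (simple_at v)"
proof -
  have ag: "abelian_group (simple_at v)"
    by (rule abelian_groupI) (auto simp: simple_at_def intro: exI[of _ "- x" for x])
  have lm: "left_module R (simple_at v)"
    by (rule left_moduleI[OF ring_axioms ag])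
      (auto simp: simple_at_def algebra_simps coef_add coef_mult_triv coef_one_triv triv_in v)
  have "is_direct_sum (simple_at v) UNIV (grade (simple_at v))"
  proof -
    have "grade (simple_at v) = (\<lambda>k. if k = 0 then carrier (simple_at v) else {\<zero>\<^bsub>simple_at v\<^esub>})"
      by (simp add: simple_at_def fun_eq_iff)
    then show ?thesis using is_direct_sum_concentrated[OF ag] by simp
  qed
  moreover have "a \<odot>\<^bsub>simple_at v\<^esub> x \<in> grade (simple_at v) (int m + n)"
    if "a \<in> grading m" "x \<in> grade (simple_at v) n" for a x m n
  proof (cases "m = 0")
    case False
    then have "coef a (triv v) = 0"
      using that(1) v by (force simp: homog_def triv_in len_triv)
    then show ?thesis by (simp add: simple_at_def)
  qed (use that in \<open>auto simp: simple_at_def\<close>)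
  ultimately show ?thesis
    unfolding is_graded_module_def using graded_ring lm by blast
qed

subsection \<open>The degree zero part\<close>

lemma homog_0_eqI:
  assumes "y \<in> homog 0" "z \<in> homog 0" "\<And>v. v \<in> V \<Longrightarrow> coef y (triv v) = coef z (triv v)"
  shows "y = z"
proof (rule coef_eqI)
  fix p assume p: "p \<in> B"
  show "coef y p = coef z p"
  proof (cases "len p = 0")
    case True
    then show ?thesis using len_zero[OF p True] assms(3)[OF stop_in[OF p]] by metis
  next
    case False
    then have "coef y p = 0" "coef z p = 0" using assms(1,2) p by (auto simp: homog_def)
    then show ?thesis by simp
  qed
qed (use assms homog_carrier in auto)

lemma coef_deg_part_triv: "\<lbrakk>y \<in> carrier R; v \<in> V\<rbrakk> \<Longrightarrow> coef (deg_part 0 y) (triv v) = coef y (triv v)"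
  by (simp add: deg_part triv_in len_triv)

lemma deg_part_0_mult:
  assumes "y \<in> carrier R" "z \<in> carrier R"
  shows "deg_part 0 (y \<otimes> z) = deg_part 0 y \<otimes> deg_part 0 z"
proof (rule homog_0_eqI)
  show "deg_part 0 y \<otimes> deg_part 0 z \<in> homog 0"
    using homog_mult[OF deg_part_homog deg_part_homog, of y z 0 0] assms by simp
qed (use assms in \<open>auto simp: deg_part_homog coef_deg_part_triv coef_mult_triv deg_part(1)\<close>)

lemma ring_degree_zero: "ring (R\<lparr>carrier := homog 0\<rparr>)"
proof -
  interpret H: additive_subgroup "homog 0" R by (rule additive_subgroup_homog)
  have mult: "y \<otimes> z \<in> homog 0" if "y \<in> homog 0" "z \<in> homog 0" for y z
    using homog_mult[OF that] by simp
  show ?thesis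
  proof (rule ringI)
    show "abelian_group (R\<lparr>carrier := homog 0\<rparr>)"
    proof (rule abelian_groupI)
      fix y assume "y \<in> carrier (R\<lparr>carrier := homog 0\<rparr>)"
      then show "\<exists>z\<in>carrier (R\<lparr>carrier := homog 0\<rparr>). z \<oplus>\<^bsub>R\<lparr>carrier := homog 0\<rparr>\<^esub> y = \<zero>\<^bsub>R\<lparr>carrier := homog 0\<rparr>\<^esub>"
        by (intro bexI[of _ "\<ominus> y"]) (auto simp: l_neg homog_carrier)
    qed (auto simp: a_ac homog_carrier)
    show "Group.monoid (R\<lparr>carrier := homog 0\<rparr>)"
      by (rule monoidI) (auto simp: mult one_homog homog_carrier m_assoc)
  qed (auto simp: homog_carrier l_distr r_distr)
qed

lemma finsum_in_subring_record:
  assumes "finite F" "f \<in> F \<rightarrow> homog 0"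
  shows "(\<Oplus>\<^bsub>regular_module (R\<lparr>carrier := homog 0\<rparr>)\<^esub>k\<in>F. f k) = (\<Oplus>k\<in>F. f k)"
proof -
  interpret M: left_module "R\<lparr>carrier := homog 0\<rparr>" "regular_module (R\<lparr>carrier := homog 0\<rparr>)"
    by (rule left_module_regular_module[OF ring_degree_zero])
  have [simp]: "carrier (regular_module (R\<lparr>carrier := homog 0\<rparr>)) = homog 0"
    "\<zero>\<^bsub>regular_module (R\<lparr>carrier := homog 0\<rparr>)\<^esub> = \<zero>"
    "y \<oplus>\<^bsub>regular_module (R\<lparr>carrier := homog 0\<rparr>)\<^esub> z = y \<oplus> z" for y z
    by (auto simp: regular_module_def)
  show ?thesis
    using assms
  proof (induction F)
    case (insert k F)
    then have "f \<in> F \<rightarrow> carrier R" "f k \<in> carrier R" using homog_carrier by auto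
    with insert show ?case by (simp add: Pi_iff)
  qed simp
qed

definition line_at :: "'v \<Rightarrow> 'a set" where
  "line_at v = homog 0 \<inter> ideal_at v"

lemma line_at_iff:
  assumes v: "v \<in> V"
  shows "y \<in> line_at v \<longleftrightarrow> y \<in> homog 0 \<and> (\<forall>u\<in>V. u \<noteq> v \<longrightarrow> coef y (triv u) = 0)"
proof -
  have "y \<in> ideal_at v" if y: "y \<in> homog 0" "\<forall>u\<in>V. u \<noteq> v \<longrightarrow> coef y (triv u) = 0"
  proof -
    have "stop p = v" if p: "p \<in> B" "coef y p \<noteq> 0" for p
      using y p len_zero[OF p(1)] stop_in[OF p(1)] by (auto simp: homog_def)
    then show ?thesis using y by (auto simp: ideal_at_iff v homog_carrier)
  qed
  moreover have "coef y (triv u) = 0" if "y \<in> ideal_at v" "u \<in> V" "u \<noteq> v" for u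
    using that by (auto simp: ideal_at_iff v triv_in stop_triv)
  ultimately show ?thesis by (auto simp: line_at_def)
qed

lemma idem_line_at: "v \<in> V \<Longrightarrow> idem v \<in> line_at v"
  by (simp add: line_at_def idem_homog idem_ideal_at)

lemma line_at_inj: "inj_on line_at V"
proof (rule inj_onI, rule ccontr)
  fix u v assume uv: "u \<in> V" "v \<in> V" "line_at u = line_at v" "u \<noteq> v"
  then have "idem u \<in> line_at v" using idem_line_at by blast
  then show False using uv by (auto simp: line_at_iff coef_idem triv_in)
qed

text \<open>
  The degree zero part of \<open>ideal_at v\<close> is a line over the field, so that any two of its elements are
  proportional.
\<close>

lemma line_at_generated:
  assumes v: "v \<in> V" and y: "y \<in> line_at v" "y \<noteq> \<zero>" and z: "z \<in> line_at v"
  shows "\<exists>a\<in>homog 0. a \<otimes> y = z"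
proof -
  have yz: "y \<in> homog 0" "y \<in> carrier R" "z \<in> homog 0"
    using y z by (auto simp: line_at_def homog_carrier)
  have zero: "coef y (triv u) = 0" "coef z (triv u) = 0" if "u \<in> V" "u \<noteq> v" for u
    using y z that by (auto simp: line_at_iff v)
  have c: "coef y (triv v) \<noteq> 0"
  proof
    assume *: "coef y (triv v) = 0"
    have "y = \<zero>"
    proof (rule homog_0_eqI)
      show "coef y (triv u) = coef \<zero> (triv u)" if "u \<in> V" for u
        using that * zero by (cases "u = v") (auto simp: coef_zero triv_in)
      show "\<zero> \<in> homog 0" by (rule additive_subgroup.zero_closed[OF additive_subgroup_homog])
    qed (rule yz)
    with y(2) show False by simp
  qed
  let ?f = "\<lambda>p. if p = triv v then coef z (triv v) / coef y (triv v) else 0"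
  \<comment> \<open>The factor is the quotient of the two coordinates, times the idempotent of the vertex.\<close>
  have "finite {p \<in> B. ?f p \<noteq> 0}"
    by (rule finite_subset[of _ "{triv v}"]) auto
  from coef_surj[OF this] obtain a where a: "a \<in> carrier R" "\<And>p. p \<in> B \<Longrightarrow> coef a p = ?f p"
    by blast
  have "len p = 0" if "p \<in> B" "coef a p \<noteq> 0" for p
    using that a(2) len_triv[OF v] by metis
  then have a0: "a \<in> homog 0" using a(1) by (simp add: homog_def)
  have "a \<otimes> y = z"
  proof (rule homog_0_eqI)
    show "a \<otimes> y \<in> homog 0" using homog_mult[OF a0 yz(1)] by simp
    fix u assume u: "u \<in> V"
    show "coef (a \<otimes> y) (triv u) = coef z (triv u)"
    proof (cases "u = v")
      case True
      then show ?thesis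
        using c a(2)[OF triv_in[OF v]] coef_mult_triv[OF a(1) yz(2) v] by simp
    next
      case False
      then show ?thesis using coef_mult_triv[OF a(1) yz(2) u] zero[OF u] by simp
    qed
  qed (rule yz)
  then show ?thesis using a0 by blast
qed

text \<open>
  The degree zero part is the product of the lines spanned by the vertices.  The definition of
  semisimplicity indexes the simple summands by themselves, so the projection onto a line has to recover the
  vertex from the line.
\<close>

lemma semisimple_degree_zero: "semisimple_ring (R\<lparr>carrier := homog 0\<rparr>)"
proof -
  let ?A = "R\<lparr>carrier := homog 0\<rparr>"
  let ?M = "regular_module ?A"
  have lm: "left_module ?A ?M"
    by (rule left_module_regular_module[OF ring_degree_zero])
  interpret M: left_module ?A ?M by (rule lm)
  have M_simps [simp]: "carrier ?M = homog 0" "\<zero>\<^bsub>?M\<^esub> = \<zero>" "smult ?M = mult R" "add ?M = add R"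
    by (auto simp: regular_module_def)
  have closed: "y \<otimes> z \<in> homog 0" if "y \<in> homog 0" "z \<in> homog 0" for y z
    using homog_mult[OF that] by simp
  have minus: "\<ominus>\<^bsub>?M\<^esub> y = \<ominus> y" if "y \<in> homog 0" for y
  proof (rule minus_equality[symmetric])
    show "\<ominus>\<^bsub>?M\<^esub> y \<oplus> y = \<zero>" using M.M.l_neg[of y] that by simp
    show "\<ominus>\<^bsub>?M\<^esub> y \<in> carrier R" using M.M.a_inv_closed[of y] that homog_carrier by simp
  qed (use that homog_carrier in auto)
  interpret H: additive_subgroup "homog 0" R by (rule additive_subgroup_homog)
  have sub: "subgroup (line_at v) (add_monoid ?M)" if v: "v \<in> V" for v
  proof (rule M.M.add.subgroupI)
    show "line_at v \<noteq> {}" using idem_line_at[OF v] by blast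
  qed (auto simp: line_at_iff v minus coef_minus coef_add homog_carrier triv_in)
  have simple: "simple_submodule (line_at v) ?A ?M" if v: "v \<in> V" for v
    unfolding simple_submodule_def
  proof (intro conjI allI impI)
    show "submodule (line_at v) ?A ?M"
      unfolding submodule_def submodule_axioms_def
      using sub[OF v] v by (auto simp: line_at_iff coef_mult_triv homog_carrier closed)
    show "line_at v \<noteq> {\<zero>\<^bsub>?M\<^esub>}"
      using idem_line_at[OF v] idem_nonzero[OF v] by auto
    fix L assume L: "submodule L ?A ?M \<and> L \<subseteq> line_at v"
    then interpret L: submodule L ?A ?M by blast
    show "L = {\<zero>\<^bsub>?M\<^esub>} \<or> L = line_at v"
    proof (cases "L = {\<zero>}")
      case False
      then obtain y where y: "y \<in> L" "y \<noteq> \<zero>"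
        using L.one_closed by auto
      then have yl: "y \<in> line_at v" using L by blast
      have "z \<in> L" if z: "z \<in> line_at v" for z
      proof -
        obtain a where a0: "a \<in> homog 0" and "a \<otimes> y = z"
          using line_at_generated[OF v yl y(2) z] by blast
        moreover have "a \<otimes> y \<in> L" using L.smult_closed[of a y] a0 y(1) by simp
        ultimately show ?thesis by simp
      qed
      then show ?thesis using L by auto
    qed simp
  qed
  \<comment> \<open>Each line determines its vertex, as the index set of the sum consists of the lines.\<close>
  define vert where "vert = the_inv_into V line_at"
  have vert: "vert (line_at v) = v" if "v \<in> V" for v
    unfolding vert_def by (rule the_inv_into_f_f[OF line_at_inj that])
  let ?S = "line_at ` V" and ?\<pi> = "\<lambda>N y. y \<otimes> idem (vert N)"
  have coef_proj: "coef (y \<otimes> idem v) (triv u) = (if u = v then coef y (triv u) else 0)"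
    if "y \<in> homog 0" "u \<in> V" "v \<in> V" for y u v
    using that coef_mult_idem[of y v "triv u"] by (simp add: homog_carrier triv_in stop_triv)
  have proj_in: "y \<otimes> idem v \<in> line_at v" if "y \<in> homog 0" "v \<in> V" for y v
    using that by (auto simp: line_at_iff closed idem_homog coef_proj)
  have line_homog: "y \<in> homog 0" if "y \<in> line_at v" for y v
    using that by (simp add: line_at_def)
  have "is_direct_sum ?M ?S (\<lambda>N. N)"
  proof (rule is_direct_sum_by_projections[where \<pi> = ?\<pi>])
    show "abelian_group ?M" by (rule M.M.abelian_group_axioms)
    show "additive_subgroup N ?M" if "N \<in> ?S" for N
      using that sub by (auto intro: additive_subgroup.intro)
    show "?\<pi> N y \<in> N" if "N \<in> ?S" "y \<in> carrier ?M" for N y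
      using that by (auto simp: vert proj_in)
    show "?\<pi> N (y \<oplus>\<^bsub>?M\<^esub> z) = ?\<pi> N y \<oplus>\<^bsub>?M\<^esub> ?\<pi> N z"
      if "N \<in> ?S" "y \<in> carrier ?M" "z \<in> carrier ?M" for N y z
      using that by (auto simp: vert l_distr homog_carrier idem_in)
    show "?\<pi> N y = y" if N: "N \<in> ?S" and yN: "y \<in> N" for N y
    proof -
      obtain v where "v \<in> V" "N = line_at v" using N by blast
      with yN show ?thesis by (simp add: vert) (simp add: line_at_def ideal_at_def)
    qed
    show "?\<pi> N y = \<zero>\<^bsub>?M\<^esub>" if N: "N \<in> ?S" "N' \<in> ?S" "N \<noteq> N'" "y \<in> N'" for N N' y
    proof -
      obtain u v where "u \<in> V" "v \<in> V" "N = line_at u" "N' = line_at v" "u \<noteq> v"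
        using N by auto
      with N(4) show ?thesis
        using proj_in[of y u] line_homog[of y v]
        by (auto simp: vert intro!: homog_0_eqI)
          (auto simp: coef_proj coef_zero triv_in line_at_iff dest: line_homog)
    qed
    show "finite {N \<in> ?S. ?\<pi> N y \<noteq> \<zero>\<^bsub>?M\<^esub>}" for y using finite_V by simp
    fix y assume y: "y \<in> carrier ?M"
    let ?F = "{N \<in> ?S. ?\<pi> N y \<noteq> \<zero>}"
    have F: "finite ?F" using finite_V by simp
    have Pi: "(\<lambda>N. ?\<pi> N y) \<in> ?F \<rightarrow> homog 0"
    proof
      fix N assume "N \<in> ?F"
      then obtain v where "v \<in> V" "N = line_at v" by blast
      then show "?\<pi> N y \<in> homog 0"
        using y line_homog[OF proj_in[of y v]] by (simp add: vert)
    qed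
    have "(\<Oplus>N\<in>?F. ?\<pi> N y) = y"
    proof (rule homog_0_eqI)
      show "(\<Oplus>N\<in>?F. ?\<pi> N y) \<in> homog 0"
        by (rule finsum_in_additive_subgroup[OF additive_subgroup_homog Pi])
      fix u assume u: "u \<in> V"
      have "coef (\<Oplus>N\<in>?F. ?\<pi> N y) (triv u) = (\<Sum>N\<in>?F. coef (?\<pi> N y) (triv u))"
        by (rule coef_finsum[OF F _ triv_in[OF u]]) (use Pi homog_carrier in blast)
      also have "\<dots> = (\<Sum>N\<in>?F. if N = line_at u then coef y (triv u) else 0)"
      proof (rule sum.cong)
        fix N assume "N \<in> ?F"
        then obtain v where v: "v \<in> V" "N = line_at v" by blast
        then have "N = line_at u \<longleftrightarrow> v = u" using inj_onD[OF line_at_inj _ v(1) u] by blast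
        then show "coef (?\<pi> N y) (triv u) = (if N = line_at u then coef y (triv u) else 0)"
          using y u v coef_proj[of y u v] by (simp add: vert eq_commute)
      qed simp
      also have "\<dots> = (if line_at u \<in> ?F then coef y (triv u) else 0)"
        using F by (simp add: sum.delta)
      also have "\<dots> = coef y (triv u)"
        using coef_proj[of y u u] y u by (auto simp: vert coef_zero triv_in)
      finally show "coef (\<Oplus>N\<in>?F. ?\<pi> N y) (triv u) = coef y (triv u)" .
    qed (use y in simp)
    then show "y = (\<Oplus>\<^bsub>?M\<^esub>N\<in>{N \<in> ?S. ?\<pi> N y \<noteq> \<zero>\<^bsub>?M\<^esub>}. ?\<pi> N y)"
      using finsum_in_subring_record[OF F Pi] by simp
  qed
  then show ?thesis
    unfolding semisimple_ring_def semisimple_module_def using ring_degree_zero lm simple by blast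
qed

lemma graded_module_degree_zero: "is_graded_module R grading (degree_zero_module R grading)"
proof -
  let ?M = "degree_zero_module R grading"
  interpret A: ring "R\<lparr>carrier := homog 0\<rparr>" by (rule ring_degree_zero)
  have simps: "carrier ?M = homog 0" "zero ?M = \<zero>" "add ?M = add R"
    "grade ?M = (\<lambda>k. if k = 0 then homog 0 else {\<zero>})"
    by (auto simp: degree_zero_module_def fun_eq_iff)
  have smult: "a \<odot>\<^bsub>?M\<^esub> y = deg_part 0 a \<otimes> y" if "a \<in> carrier R" for a y
    using homogeneous_part_eq[OF that, of 0] by (simp add: degree_zero_module_def)
  have closed: "y \<otimes> z \<in> homog 0" if "y \<in> homog 0" "z \<in> homog 0" for y z
    using homog_mult[OF that] by simp
  have ag: "abelian_group ?M"
    using abelian_groupE[OF A.is_abelian_group]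
    by (intro abelian_groupI) (simp_all add: simps)
  have lm: "left_module R ?M"
    by (rule left_moduleI[OF ring_axioms ag])
      (auto simp: simps smult closed deg_part_homog deg_part_add deg_part_0_mult
        l_distr r_distr m_assoc homog_carrier deg_part deg_part_same[OF one_homog])
  have "is_direct_sum ?M UNIV (grade ?M)"
    using is_direct_sum_concentrated[OF ag] unfolding simps .
  moreover have "a \<odot>\<^bsub>?M\<^esub> y \<in> grade ?M (int m + n)" if "a \<in> grading m" "y \<in> grade ?M n" for a y m n
  proof -
    have a: "a \<in> carrier R" using that(1) by (rule homog_carrier)
    show ?thesis
    proof (cases "m = 0")
      case True
      then show ?thesis
        using that a deg_part(1)[OF a, of 0] closed[OF deg_part_homog[OF a]]
        by (auto simp: simps smult split: if_splits)
    next
      case False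
      then have "deg_part 0 a = \<zero>" using deg_part_other[OF that(1), of 0] by simp
      moreover have "y \<in> carrier R" using that(2) homog_carrier by (auto simp: simps split: if_splits)
      ultimately show ?thesis
        using additive_subgroup.zero_closed[OF additive_subgroup_homog]
        by (simp add: simps smult a)
    qed
  qed
  ultimately show ?thesis
    unfolding is_graded_module_def using graded_ring lm by blast
qed

end

section \<open>Resolutions along chains of relations\<close>

text \<open>
  The data of a resolution of a sum of simple modules at the vertices \<open>w0 k\<close>, for \<open>k\<close> in \<open>J0\<close>.  The index
  set \<open>J1\<close> of the next term enumerates the pairs of an index \<open>k\<close> and an arrow \<open>first j\<close> with target
  \<open>w0 k\<close>.  The indices have an arbitrary type, as the two applications use different ones: arrows for the
  resolution of a single simple module, natural numbers for the degree zero part.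
\<close>

locale monomial_resolution =
  quadratic_monomial_ring R B coef len stop V triv idem E src tgt arr ext prv
  for R :: "('a, 'r) ring_scheme" (structure) and B :: "'b set" and coef :: "'a \<Rightarrow> 'b \<Rightarrow> 'k::field"
    and len and stop :: "'b \<Rightarrow> 'v" and V triv idem and E :: "'e set" and src tgt arr ext prv +
  fixes J0 :: "'j set" and w0 :: "'j \<Rightarrow> 'v"
    and J1 :: "'j set" and first :: "'j \<Rightarrow> 'e" and base :: "'j \<Rightarrow> 'j"
  assumes finite_J0: "finite J0" and w0_in: "w0 \<in> J0 \<rightarrow> V" and finite_J1: "finite J1"
    and first_base: "bij_betw (\<lambda>j. (base j, first j)) J1 (SIGMA k:J0. {\<alpha> \<in> E. tgt \<alpha> = w0 k})"
begin

lemma J1_props: "j \<in> J1 \<Longrightarrow> first j \<in> E \<and> base j \<in> J0 \<and> tgt (first j) = w0 (base j)"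
  using bij_betw_apply[OF first_base, of j] by auto

lemma first_inj: "inj_on first {j \<in> J1. base j = k}"
  using bij_betw_imp_inj_on[OF first_base] by (auto simp: inj_on_def)

lemma first_image: "k \<in> J0 \<Longrightarrow> first ` {j \<in> J1. base j = k} = {\<alpha> \<in> E. tgt \<alpha> = w0 k}"
  using bij_betw_imp_surj_on[OF first_base] by (force simp: set_eq_iff image_iff)

text \<open>
  The chain of relations beginning with the arrow \<open>first j\<close> has an \<open>n\<close>-th arrow, counted from \<open>0\<close>, exactly
  if \<open>j\<close> belongs to \<open>links n\<close>, and \<open>link n j\<close> is this arrow.
\<close>

definition links :: "nat \<Rightarrow> 'j set" where
  "links n = {j \<in> J1. relation_chain prv (first j) n \<noteq> None}"

definition link :: "nat \<Rightarrow> 'j \<Rightarrow> 'e" where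
  "link n j = the (relation_chain prv (first j) n)"

fun res :: "nat \<Rightarrow> ('a, 'j \<Rightarrow> 'a) graded_module" where
  "res 0 = principal_sum J0 w0 0"
| "res (Suc n) = principal_sum (links n) (\<lambda>j. src (link n j)) (Suc n)"

text \<open>
  In degree \<open>0\<close> all chains that belong to the same index \<open>k\<close> are added up; afterwards each chain runs
  separately.  A chain that breaks off before its arrow \<open>link (Suc n) j\<close> does not occur in the source of
  \<open>diff (Suc n)\<close>, and so contributes zero.
\<close>

fun diff :: "nat \<Rightarrow> ('j \<Rightarrow> 'a) \<Rightarrow> 'j \<Rightarrow> 'a" where
  "diff 0 f = (\<lambda>k\<in>J0. \<Oplus>j\<in>{j \<in> J1. base j = k}. f j \<otimes> arr (first j))"
| "diff (Suc n) f =
    (\<lambda>j\<in>links n. if j \<in> links (Suc n) then f j \<otimes> arr (link (Suc n) j) else \<zero>)"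

lemma links_0: "links 0 = J1" and link_0: "link 0 j = first j"
  by (auto simp: links_def link_def)

lemma links_Suc: "links (Suc n) = {j \<in> links n. prv (link n j) \<noteq> None}"
  and link_Suc: "j \<in> links (Suc n) \<Longrightarrow> prv (link n j) = Some (link (Suc n) j)"
  by (auto simp: links_def link_def bind_eq_None_conv)

lemma link_in: "j \<in> links n \<Longrightarrow> link n j \<in> E"
proof (induction n)
  case 0
  then show ?case using J1_props by (simp add: links_0 link_0)
next
  case (Suc n)
  then show ?case using link_Suc[of j n] prv_in[of "link n j"] by (auto simp: links_Suc)
qed

lemma tgt_link_Suc: "j \<in> links (Suc n) \<Longrightarrow> tgt (link (Suc n) j) = src (link n j)"
  using link_Suc[of j n] prv_in[of "link n j"] link_in[of j n] by (auto simp: links_Suc)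

lemma finite_links: "finite (links n)"
  unfolding links_def using finite_J1 by simp

lemma src_link_in: "(\<lambda>j. src (link n j)) \<in> links n \<rightarrow> V"
  using link_in src_in by blast

lemmas carrier_res_0 = principal_sum_carrier[OF finite_J0]
lemmas carrier_res_Suc = principal_sum_carrier[OF finite_links]

lemma carrier_res_1:
  "carrier (res 1) = (\<Pi>\<^sub>E j\<in>J1. ideal_at (src (first j)))"
  "grade (res 1) k = {f \<in> \<Pi>\<^sub>E j\<in>J1. ideal_at (src (first j)). \<forall>j\<in>J1. f j \<in> homog (k - 1)}"
  by (simp_all add: carrier_res_Suc) (simp_all add: links_0 link_0)

lemma res_component:
  "\<lbrakk>f \<in> carrier (res (Suc n)); j \<in> links n\<rbrakk> \<Longrightarrow> f j \<in> ideal_at (src (link n j))"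
  "\<lbrakk>f \<in> carrier (res (Suc n)); j \<in> links n\<rbrakk> \<Longrightarrow> f j \<in> carrier R"
  by (auto simp: carrier_res_Suc PiE_iff intro: ideal_at_carrier)

lemma diff_0_summand:
  assumes "f \<in> carrier (res 1)" "j \<in> J1"
  shows "f j \<otimes> arr (first j) \<in> ideal_at (w0 (base j))"
  using mult_arr_ideal_at[of "f j" "first j"] res_component(2)[of f 0 j] assms J1_props
  by (auto simp: links_0)

lemma diff_hom: "diff n \<in> graded_hom R (res (Suc n)) (res n)"
proof (cases n)
  case 0
  have fc: "f j \<in> carrier R" "f j \<otimes> arr (first j) \<in> carrier R"
    if "f \<in> carrier (res 1)" "j \<in> J1" for f j
    using res_component(2)[of f 0 j] that ideal_at_carrier[OF diff_0_summand[OF that]]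
    by (auto simp: links_0)
  have arr1: "arr (first j) \<in> carrier R" "arr (first j) \<in> homog 1" if "j \<in> J1" for j
    using that J1_props arr_in arr_homog by auto
  let ?K = "\<lambda>k. {j \<in> J1. base j = k}"
  have closed: "diff 0 f \<in> carrier (res 0)" if f: "f \<in> carrier (res 1)" for f
    using diff_0_summand[OF f] w0_in
    by (auto simp: carrier_res_0
        intro!: finsum_in_additive_subgroup additive_subgroup_ideal_at)
  moreover have "diff 0 (f \<oplus>\<^bsub>res 1\<^esub> g) = diff 0 f \<oplus>\<^bsub>res 0\<^esub> diff 0 g"
    if fg: "f \<in> carrier (res 1)" "g \<in> carrier (res 1)" for f g
  proof
    fix k
    have "(\<Oplus>j\<in>?K k. (f \<oplus>\<^bsub>res 1\<^esub> g) j \<otimes> arr (first j))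
        = (\<Oplus>j\<in>?K k. f j \<otimes> arr (first j) \<oplus> g j \<otimes> arr (first j))"
      using fg by (intro finsum_cong')
        (auto simp: fc arr1 principal_sum_simps links_0 l_distr)
    also have "\<dots> = (\<Oplus>j\<in>?K k. f j \<otimes> arr (first j)) \<oplus> (\<Oplus>j\<in>?K k. g j \<otimes> arr (first j))"
      using fg by (intro finsum_addf) (auto simp: fc)
    finally show "diff 0 (f \<oplus>\<^bsub>res 1\<^esub> g) k = (diff 0 f \<oplus>\<^bsub>res 0\<^esub> diff 0 g) k"
      by (simp add: principal_sum_simps)
  qed
  moreover have "diff 0 (a \<odot>\<^bsub>res 1\<^esub> f) = a \<odot>\<^bsub>res 0\<^esub> diff 0 f"
    if f: "f \<in> carrier (res 1)" and a: "a \<in> carrier R" for f a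
  proof
    fix k
    have fin: "finite (?K k)" using finite_J1 by simp
    have "(\<Oplus>j\<in>?K k. (a \<odot>\<^bsub>res 1\<^esub> f) j \<otimes> arr (first j))
        = (\<Oplus>j\<in>?K k. a \<otimes> (f j \<otimes> arr (first j)))"
      using f a by (intro finsum_cong')
        (auto simp: fc arr1 principal_sum_simps links_0 m_assoc)
    also have "\<dots> = a \<otimes> (\<Oplus>j\<in>?K k. f j \<otimes> arr (first j))"
      using f a by (intro finsum_rdistr[symmetric]) (auto simp: fc fin)
    finally show "diff 0 (a \<odot>\<^bsub>res 1\<^esub> f) k = (a \<odot>\<^bsub>res 0\<^esub> diff 0 f) k"
      by (simp add: principal_sum_simps)
  qed
  moreover have "diff 0 f \<in> grade (res 0) k" if f: "f \<in> grade (res 1) k" for f k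
  proof -
    have "f \<in> carrier (res 1)" using f unfolding carrier_res_1 by blast
    moreover have "f j \<otimes> arr (first j) \<in> homog k" if "j \<in> J1" for j
    proof -
      have "f j \<in> homog (k - 1)" using f that unfolding carrier_res_1 by blast
      then show ?thesis using homog_mult[OF _ arr1(2)[OF that]] by fastforce
    qed
    ultimately show ?thesis
      using closed[of f]
      by (auto simp: carrier_res_0 intro!: finsum_in_additive_subgroup additive_subgroup_homog)
  qed
  ultimately show ?thesis
    unfolding 0 One_nat_def by (intro graded_homI)
next
  case (Suc m)
  have fc: "f j \<in> carrier R" if "f \<in> carrier (res (Suc (Suc m)))" "j \<in> links (Suc m)" for f j
    using res_component(2) that by blast
  have arr1: "arr (link (Suc m) j) \<in> carrier R" "arr (link (Suc m) j) \<in> homog 1"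
    if "j \<in> links (Suc m)" for j
    using that link_in arr_in arr_homog by auto
  have zero: "\<zero> \<in> ideal_at (src (link m j))" "\<zero> \<in> homog k" if "j \<in> links m" for j k
    using that src_link_in[of m] additive_subgroup.zero_closed[OF additive_subgroup_ideal_at]
      additive_subgroup.zero_closed[OF additive_subgroup_homog] by (auto simp: Pi_iff)
  have closed: "diff (Suc m) f \<in> carrier (res (Suc m))" if f: "f \<in> carrier (res (Suc (Suc m)))" for f
  proof -
    have "f j \<otimes> arr (link (Suc m) j) \<in> ideal_at (src (link m j))" if "j \<in> links (Suc m)" for j
      using mult_arr_ideal_at[OF fc[OF f that] link_in[OF that]] tgt_link_Suc[OF that] by simp
    then show ?thesis using zero by (auto simp: carrier_res_Suc)
  qed
  moreover have "diff (Suc m) f \<in> grade (res (Suc m)) k" if f: "f \<in> grade (res (Suc (Suc m))) k" for f k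
  proof -
    have "f \<in> carrier (res (Suc (Suc m)))" using f by (simp add: carrier_res_Suc)
    moreover have "f j \<otimes> arr (link (Suc m) j) \<in> homog (k - int (Suc m))" if "j \<in> links (Suc m)" for j
    proof -
      have "f j \<in> homog (k - int (Suc (Suc m)))" using f that by (simp add: carrier_res_Suc)
      moreover have "k - int (Suc (Suc m)) + 1 = k - int (Suc m)" by simp
      ultimately show ?thesis using homog_mult[OF _ arr1(2)[OF that]] by metis
    qed
    ultimately show ?thesis
      using closed[of f] zero by (auto simp: carrier_res_Suc)
  qed
  moreover have "diff (Suc m) (f \<oplus>\<^bsub>res (Suc (Suc m))\<^esub> g) = diff (Suc m) f \<oplus>\<^bsub>res (Suc m)\<^esub> diff (Suc m) g"
    if "f \<in> carrier (res (Suc (Suc m)))" "g \<in> carrier (res (Suc (Suc m)))" for f g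
    using fc[OF that(1)] fc[OF that(2)] arr1(1)
    by (simp add: principal_sum_simps fun_eq_iff l_distr)
  moreover have "diff (Suc m) (a \<odot>\<^bsub>res (Suc (Suc m))\<^esub> f) = a \<odot>\<^bsub>res (Suc m)\<^esub> diff (Suc m) f"
    if "a \<in> carrier R" "f \<in> carrier (res (Suc (Suc m)))" for a f
    using fc[OF that(2)] arr1(1) that(1)
    by (simp add: principal_sum_simps fun_eq_iff m_assoc)
  ultimately show ?thesis
    unfolding Suc by (intro graded_homI)
qed

text \<open>
  The kernels are computed componentwise.  In degree \<open>0\<close> this uses the independence of products with
  different arrows.
\<close>

lemma diff_eq_zero_iff:
  assumes f: "f \<in> carrier (res (Suc n))"
  shows "diff n f = \<zero>\<^bsub>res n\<^esub> \<longleftrightarrow> (\<forall>j\<in>links n. f j \<otimes> arr (link n j) = \<zero>)"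
proof (cases n)
  case 0
  have fc: "f j \<in> carrier R" if "j \<in> J1" for j
    using res_component(2)[OF f] that 0 by (simp add: links_0)
  have eq: "(\<Oplus>j\<in>{j \<in> J1. base j = k}. f j \<otimes> arr (first j))
      = (\<Oplus>\<alpha>\<in>first ` {j \<in> J1. base j = k}. f (the_inv_into {j \<in> J1. base j = k} first \<alpha>) \<otimes> arr \<alpha>)"
    for k
  proof -
    have inv: "the_inv_into {j \<in> J1. base j = k} first (first j) = j" if "j \<in> J1" "base j = k" for j
      using the_inv_into_f_f[OF first_inj] that by blast
    show ?thesis
      by (subst finsum_reindex[OF _ first_inj], use fc J1_props arr_in inv in force)
        (rule finsum_cong', use fc J1_props arr_in inv in auto)
  qed
  have "f j \<otimes> arr (first j) = \<zero>" if zero: "diff 0 f = \<zero>\<^bsub>res 0\<^esub>" and j: "j \<in> J1" for j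
  proof -
    let ?K = "{i \<in> J1. base i = base j}"
    have inv: "the_inv_into ?K first (first i) = i" if "i \<in> ?K" for i
      using the_inv_into_f_f[OF first_inj that] .
    have "(\<Oplus>i\<in>?K. f i \<otimes> arr (first i)) = \<zero>"
      using fun_cong[OF zero, of "base j"] j J1_props[OF j] by (simp add: principal_sum_simps)
    then have "f (the_inv_into ?K first (first j)) \<otimes> arr (first j) = \<zero>"
      unfolding eq
      by (rule finsum_mult_arr_eq_zeroD[rotated 2]) (use J1_props inv fc j in auto)
    then show ?thesis using inv[of j] j by simp
  qed
  moreover have "diff 0 f = \<zero>\<^bsub>res 0\<^esub>" if "\<forall>j\<in>J1. f j \<otimes> arr (first j) = \<zero>"
  proof -
    have "(\<Oplus>j\<in>{j \<in> J1. base j = k}. f j \<otimes> arr (first j)) = (\<Oplus>j\<in>{j \<in> J1. base j = k}. \<zero>)" for k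
      by (rule finsum_cong') (use that in auto)
    then show ?thesis by (simp add: principal_sum_simps finsum_zero)
  qed
  ultimately show ?thesis unfolding 0 links_0 link_0 by blast
next
  case (Suc m)
  have sub: "j \<in> links m" if "j \<in> links (Suc m)" for j using that unfolding links_Suc by simp
  show ?thesis unfolding Suc
  proof (intro iffI ballI)
    fix j assume zero: "diff (Suc m) f = \<zero>\<^bsub>res (Suc m)\<^esub>" and j: "j \<in> links (Suc m)"
    show "f j \<otimes> arr (link (Suc m) j) = \<zero>"
      using fun_cong[OF zero, of j] j sub[OF j] by (simp add: principal_sum_simps)
  next
    assume "\<forall>j\<in>links (Suc m). f j \<otimes> arr (link (Suc m) j) = \<zero>"
    then show "diff (Suc m) f = \<zero>\<^bsub>res (Suc m)\<^esub>"
      by (simp add: principal_sum_simps fun_eq_iff)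
  qed
qed

text \<open>
  Along each chain, exactness is \<open>mult_prv_arr\<close> in one direction and \<open>mult_arr_eq_zeroE\<close> in the other,
  where a preimage is obtained by stripping the next arrow.
\<close>

lemma diff_exact: "diff (Suc n) ` carrier (res (Suc (Suc n))) = {f \<in> carrier (res (Suc n)). diff n f = \<zero>\<^bsub>res n\<^esub>}"
proof (intro equalityI subsetI)
  fix f assume "f \<in> diff (Suc n) ` carrier (res (Suc (Suc n)))"
  then obtain g where g: "g \<in> carrier (res (Suc (Suc n)))" and fg: "f = diff (Suc n) g" by blast
  have f: "f \<in> carrier (res (Suc n))"
    using diff_hom[of "Suc n"] g fg by (auto simp: graded_hom_def module_hom_def hom_def)
  have "f j \<otimes> arr (link n j) = \<zero>" if j: "j \<in> links n" for j
  proof (cases "j \<in> links (Suc n)")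
    case True
    then have "f j = g j \<otimes> arr (link (Suc n) j)" using j by (simp add: fg)
    then show ?thesis
      using mult_prv_arr[OF res_component(2)[OF g True] link_in[OF j] link_Suc[OF True]] by simp
  next
    case False
    then show ?thesis using j link_in arr_in by (simp add: fg)
  qed
  then show "f \<in> {f \<in> carrier (res (Suc n)). diff n f = \<zero>\<^bsub>res n\<^esub>}"
    using diff_eq_zero_iff[OF f] f by blast
next
  fix f assume "f \<in> {f \<in> carrier (res (Suc n)). diff n f = \<zero>\<^bsub>res n\<^esub>}"
  then have f: "f \<in> carrier (res (Suc n))" and zero: "\<And>j. j \<in> links n \<Longrightarrow> f j \<otimes> arr (link n j) = \<zero>"
    using diff_eq_zero_iff by auto
  define g where "g = (\<lambda>j\<in>links (Suc n). strip (link (Suc n) j) (f j))"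
  have sub: "j \<in> links n" if "j \<in> links (Suc n)" for j using that by (auto simp: links_Suc)
  have g: "g \<in> carrier (res (Suc (Suc n)))"
    using strip(3)[OF res_component(2)[OF f sub] link_in] by (auto simp: carrier_res_Suc g_def)
  have "diff (Suc n) g j = f j" for j
  proof (cases "j \<in> links n")
    case True
    note z = mult_arr_eq_zeroE[OF res_component(1)[OF f True] link_in[OF True] zero[OF True]]
    show ?thesis
      using z(1) z(2)[OF link_Suc[of j n]] True by (auto simp: g_def links_Suc)
  next
    case False
    then show ?thesis using f by (auto simp: carrier_res_Suc PiE_iff extensional_def)
  qed
  then have "f = diff (Suc n) g" by auto
  with g show "f \<in> diff (Suc n) ` carrier (res (Suc (Suc n)))" by blast
qed

lemma diff_0_image: "diff 0 ` carrier (res 1) = {f \<in> carrier (res 0). \<forall>k\<in>J0. deg_part 0 (f k) = \<zero>}"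
proof (intro equalityI subsetI)
  fix f assume "f \<in> diff 0 ` carrier (res 1)"
  then obtain g where g: "g \<in> carrier (res 1)" and fg: "f = diff 0 g" by blast
  have f: "f \<in> carrier (res 0)"
    using diff_hom[of 0] g fg by (auto simp: graded_hom_def module_hom_def hom_def)
  have "deg_part 0 (f k) = \<zero>" if k: "k \<in> J0" for k
  proof (rule coef_eqI)
    have fk: "f k \<in> carrier R"
      using f k by (auto simp: carrier_res_0 PiE_iff intro: ideal_at_carrier)
    then show "deg_part 0 (f k) \<in> carrier R" by (rule deg_part)
    fix p assume p: "p \<in> B"
    have "coef (f k) p = 0" if "len p = 0"
    proof -
      have "coef (f k) p = (\<Sum>j\<in>{j \<in> J1. base j = k}. coef (g j \<otimes> arr (first j)) p)"
        using k ideal_at_carrier[OF diff_0_summand[OF g]] p finite_J1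
        by (simp add: fg) (subst coef_finsum, auto)
      also have "\<dots> = 0"
        using res_component(2)[OF g[unfolded One_nat_def]] J1_props p that
        by (intro sum.neutral) (auto simp: links_0 coef_mult_arr_zero)
      finally show ?thesis .
    qed
    then show "coef (deg_part 0 (f k)) p = coef \<zero> p"
      using deg_part(2)[OF fk p, of 0] p by (simp add: coef_zero)
  qed simp
  with f show "f \<in> {f \<in> carrier (res 0). \<forall>k\<in>J0. deg_part 0 (f k) = \<zero>}" by blast
next
  fix f assume "f \<in> {f \<in> carrier (res 0). \<forall>k\<in>J0. deg_part 0 (f k) = \<zero>}"
  then have f: "f \<in> carrier (res 0)" and zero: "\<And>k. k \<in> J0 \<Longrightarrow> deg_part 0 (f k) = \<zero>" by auto
  have fk: "f k \<in> ideal_at (w0 k)" "f k \<in> carrier R" "w0 k \<in> V" if "k \<in> J0" for k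
    using f that w0_in by (auto simp: carrier_res_0 PiE_iff intro: ideal_at_carrier)
  define g where "g = (\<lambda>j\<in>J1. strip (first j) (f (base j)))"
  have g: "g \<in> carrier (res 1)"
    using strip(3)[OF fk(2)] J1_props unfolding carrier_res_1 g_def by auto
  have "diff 0 g k = f k" for k
  proof (cases "k \<in> J0")
    case True
    have c: "strip \<alpha> (f k) \<otimes> arr \<alpha> \<in> carrier R" if "\<alpha> \<in> E" for \<alpha>
      using strip(1)[OF fk(2)[OF True] that] arr_in[OF that] by simp
    have "diff 0 g k = (\<Oplus>j\<in>{j \<in> J1. base j = k}. strip (first j) (f k) \<otimes> arr (first j))"
      using True by (simp, intro finsum_cong') (auto simp: g_def c J1_props)
    also have "\<dots> = (\<Oplus>\<alpha>\<in>first ` {j \<in> J1. base j = k}. strip \<alpha> (f k) \<otimes> arr \<alpha>)"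
      by (rule finsum_reindex[OF _ first_inj, symmetric]) (use c J1_props in auto)
    also have "\<dots> = f k"
      unfolding first_image[OF True]
      by (rule radical_expansion[OF fk(1)[OF True] fk(3)[OF True] zero[OF True]])
    finally show ?thesis .
  next
    case False
    then show ?thesis using f by (auto simp: carrier_res_0 PiE_iff extensional_def)
  qed
  then have "f = diff 0 g" by auto
  with g show "f \<in> diff 0 ` carrier (res 1)" by blast
qed

text \<open>
  By \<open>diff_0_image\<close> the first map has as its image the elements without part of degree \<open>0\<close>.  Hence the complex
  resolves every graded module \<open>M\<close> with an augmentation \<open>\<epsilon>\<close> whose kernel consists of these elements.
\<close>

theorem resolution:
  assumes M: "is_graded_module R grading M"
    and hom: "\<epsilon> \<in> graded_hom R (res 0) M" and surj: "\<epsilon> ` carrier (res 0) = carrier M"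
    and ker: "\<And>f. f \<in> carrier (res 0) \<Longrightarrow> \<epsilon> f = \<zero>\<^bsub>M\<^esub> \<longleftrightarrow> (\<forall>k\<in>J0. deg_part 0 (f k) = \<zero>)"
  shows "graded_projective_resolution R grading res diff \<epsilon> M"
proof -
  have "is_graded_module R grading (res n) \<and> projective_module R (res n)" for n
    by (cases n) (auto intro!: graded_module_principal_sum projective_principal_sum finite_J0 w0_in
        finite_links src_link_in)
  moreover have "diff 0 ` carrier (res 1) = {x \<in> carrier (res 0). \<epsilon> x = \<zero>\<^bsub>M\<^esub>}"
    unfolding diff_0_image using ker by blast
  ultimately show ?thesis
    unfolding graded_projective_resolution_def
    using M hom surj diff_hom diff_exact by blast
qed

lemma res_generated:
  "carrier (res n) = (\<lambda>N. submodule N R (res n)) hull grade (res n) (int n)"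
proof (cases n)
  case 0
  show ?thesis unfolding 0 res.simps by (rule principal_sum_generated[OF finite_J0 w0_in])
next
  case (Suc m)
  show ?thesis unfolding Suc res.simps by (rule principal_sum_generated[OF finite_links src_link_in])
qed

theorem simple_resolution:
  assumes J0: "J0 = {k}" and w0: "w0 k = v"
  shows "graded_projective_resolution R grading res diff (\<lambda>f. coef (f k) (triv v)) (simple_at v)"
proof (rule resolution)
  have v: "v \<in> V" using w0_in J0 w0 by auto
  have kJ: "k \<in> J0" using J0 by simp
  have fk: "f k \<in> ideal_at v" "f k \<in> carrier R" if "f \<in> carrier (res 0)" for f
  proof -
    show "f k \<in> ideal_at v"
      using that w0 kJ by (auto simp: carrier_res_0 PiE_iff)
    then show "f k \<in> carrier R" by (rule ideal_at_carrier)
  qed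
  show "is_graded_module R grading (simple_at v)" by (rule graded_module_simple_at[OF v])
  show "(\<lambda>f. coef (f k) (triv v)) \<in> graded_hom R (res 0) (simple_at v)"
  proof (rule graded_homI)
    fix f m assume f: "f \<in> grade (res 0) m"
    then have "f k \<in> homog m" using kJ by (simp add: carrier_res_0)
    then show "coef (f k) (triv v) \<in> grade (simple_at v) m"
      using v by (auto simp: simple_at_def homog_def triv_in len_triv)
  qed (use fk v kJ in \<open>auto simp: simple_at_def principal_sum_simps coef_add coef_mult_triv triv_in\<close>)
  have "c \<in> (\<lambda>f. coef (f k) (triv v)) ` carrier (res 0)" for c
  proof -
    have "finite {p \<in> B. (if p = triv v then c else 0) \<noteq> 0}"
      by (rule finite_subset[of _ "{triv v}"]) auto
    from coef_surj[OF this] obtain a where a: "a \<in> carrier R"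
      "\<And>p. p \<in> B \<Longrightarrow> coef a p = (if p = triv v then c else 0)"
      by blast
    then have "a \<in> ideal_at v"
      using v by (auto simp: ideal_at_iff stop_triv)
    then have "(\<lambda>j\<in>J0. a) \<in> carrier (res 0)"
      by (auto simp: carrier_res_0) (use J0 w0 in simp)
    then show ?thesis
      by (rule rev_image_eqI) (use a v kJ in \<open>simp add: triv_in\<close>)
  qed
  then show "(\<lambda>f. coef (f k) (triv v)) ` carrier (res 0) = carrier (simple_at v)"
    by (auto simp: simple_at_def)
  show "coef (f k) (triv v) = \<zero>\<^bsub>simple_at v\<^esub> \<longleftrightarrow> (\<forall>k\<in>J0. deg_part 0 (f k) = \<zero>)"
    if "f \<in> carrier (res 0)" for f
    using deg_part_zero_iff[OF fk(1)[OF that] v] by (simp add: simple_at_def J0)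
qed

theorem degree_zero_resolution:
  assumes w0: "bij_betw w0 J0 V"
  shows "graded_projective_resolution R grading res diff
    (\<lambda>f. \<Oplus>k\<in>J0. deg_part 0 (f k)) (degree_zero_module R grading)"
proof (rule resolution)
  let ?M = "degree_zero_module R grading"
  let ?e = "\<lambda>f. \<Oplus>k\<in>J0. deg_part 0 (f k)"
  have simps: "carrier ?M = homog 0" "zero ?M = \<zero>" "add ?M = add R"
    "grade ?M = (\<lambda>k. if k = 0 then homog 0 else {\<zero>})"
    by (auto simp: degree_zero_module_def fun_eq_iff)
  have smult: "a \<odot>\<^bsub>?M\<^esub> y = deg_part 0 a \<otimes> y" if "a \<in> carrier R" for a y
    using homogeneous_part_eq[OF that, of 0] by (simp add: degree_zero_module_def)
  have fk: "f k \<in> ideal_at (w0 k)" "f k \<in> carrier R" "w0 k \<in> V"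
    if "f \<in> carrier (res 0)" "k \<in> J0" for f k
    using that w0_in by (auto simp: carrier_res_0 PiE_iff intro: ideal_at_carrier)
  have e_closed: "?e f \<in> homog 0" if "f \<in> carrier (res 0)" for f
    by (rule finsum_in_additive_subgroup[OF additive_subgroup_homog])
      (use fk that deg_part_homog in blast)
  \<comment> \<open>As \<open>w0\<close> is injective, only the summand with index \<open>j\<close> involves the trivial path at \<open>w0 j\<close>.\<close>
  have e_coef: "coef (?e f) (triv (w0 j)) = coef (f j) (triv (w0 j))"
    if f: "f \<in> carrier (res 0)" and j: "j \<in> J0" for f j
  proof -
    have t: "triv (w0 j) \<in> B" using triv_in fk(3)[OF that] by blast
    have "coef (?e f) (triv (w0 j)) = (\<Sum>k\<in>J0. coef (deg_part 0 (f k)) (triv (w0 j)))"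
      by (rule coef_finsum[OF finite_J0 _ t]) (use fk f deg_part in auto)
    also have "\<dots> = (\<Sum>k\<in>J0. if k = j then coef (f j) (triv (w0 j)) else 0)"
    proof (rule sum.cong)
      fix k assume k: "k \<in> J0"
      have "coef (f k) (triv (w0 j)) = 0" if "k \<noteq> j"
        using fk[OF f k] fk(3)[OF f j] t that bij_betw_imp_inj_on[OF w0] j k
        by (auto simp: ideal_at_iff stop_triv inj_on_def)
      then show "coef (deg_part 0 (f k)) (triv (w0 j)) = (if k = j then coef (f j) (triv (w0 j)) else 0)"
        using coef_deg_part_triv[OF fk(2)[OF f k] fk(3)[OF f j]] by auto
    qed simp
    also have "\<dots> = coef (f j) (triv (w0 j))"
      using finite_J0 j by (simp add: sum.delta)
    finally show ?thesis .
  qed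
  show "is_graded_module R grading ?M" by (rule graded_module_degree_zero)
  show "?e \<in> graded_hom R (res 0) ?M"
  proof (rule graded_homI)
    fix f g assume fg: "f \<in> carrier (res 0)" "g \<in> carrier (res 0)"
    have "?e (f \<oplus>\<^bsub>res 0\<^esub> g) = (\<Oplus>k\<in>J0. deg_part 0 (f k) \<oplus> deg_part 0 (g k))"
      by (rule finsum_cong') (use fk fg in \<open>auto simp: principal_sum_simps deg_part_add deg_part\<close>)
    also have "\<dots> = ?e f \<oplus> ?e g"
      by (rule finsum_addf) (use fk fg deg_part in auto)
    finally show "?e (f \<oplus>\<^bsub>res 0\<^esub> g) = ?e f \<oplus>\<^bsub>?M\<^esub> ?e g" by (simp add: simps)
  next
    fix a f assume af: "a \<in> carrier R" "f \<in> carrier (res 0)"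
    have "?e (a \<odot>\<^bsub>res 0\<^esub> f) = (\<Oplus>k\<in>J0. deg_part 0 a \<otimes> deg_part 0 (f k))"
      by (rule finsum_cong') (use fk af in \<open>auto simp: principal_sum_simps deg_part_0_mult deg_part\<close>)
    also have "\<dots> = deg_part 0 a \<otimes> ?e f"
      by (rule finsum_rdistr[symmetric]) (use finite_J0 fk af deg_part in auto)
    finally show "?e (a \<odot>\<^bsub>res 0\<^esub> f) = a \<odot>\<^bsub>?M\<^esub> ?e f" by (simp add: smult af)
  next
    fix m f assume f: "f \<in> grade (res 0) m"
    then have fc: "f \<in> carrier (res 0)" and fm: "\<And>k. k \<in> J0 \<Longrightarrow> f k \<in> homog m"
      by (auto simp: carrier_res_0)
    have "?e f = \<zero>" if "m \<noteq> 0"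
    proof -
      have "?e f = (\<Oplus>k\<in>J0. \<zero>)"
        by (rule finsum_cong') (use deg_part_other[OF fm] that in auto)
      then show ?thesis by (simp add: finsum_zero)
    qed
    then show "?e f \<in> grade ?M m" using e_closed[OF fc] by (auto simp: simps)
  qed (use e_closed in \<open>simp add: simps\<close>)
  have "y \<in> ?e ` carrier (res 0)" if y: "y \<in> homog 0" for y
  proof (rule image_eqI[of _ _ "\<lambda>k\<in>J0. y \<otimes> idem (w0 k)"])
    have yc: "y \<in> carrier R" using y by (rule homog_carrier)
    show f: "(\<lambda>k\<in>J0. y \<otimes> idem (w0 k)) \<in> carrier (res 0)"
      using yc w0_in by (auto simp: carrier_res_0 Pi_iff intro!: mult_ideal_at idem_ideal_at)
    show "y = ?e (\<lambda>k\<in>J0. y \<otimes> idem (w0 k))"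
    proof (rule homog_0_eqI[OF y e_closed[OF f]])
      fix v assume v: "v \<in> V"
      then obtain j where j: "j \<in> J0" "v = w0 j"
        using bij_betw_imp_surj_on[OF w0] by blast
      show "coef y (triv v) = coef (?e (\<lambda>k\<in>J0. y \<otimes> idem (w0 k))) (triv v)"
        using v j e_coef[OF f j(1)] coef_mult_idem[OF yc v triv_in[OF v]]
        by (simp add: stop_triv)
    qed
  qed
  then show "?e ` carrier (res 0) = carrier ?M"
    using e_closed by (auto simp: simps)
  fix f assume f: "f \<in> carrier (res 0)"
  have "?e f = \<zero> \<longleftrightarrow> (\<forall>v\<in>V. coef (?e f) (triv v) = 0)"
    using homog_0_eqI[OF e_closed[OF f] additive_subgroup.zero_closed[OF additive_subgroup_homog]]
    by (auto simp: coef_zero triv_in)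
  also have "\<dots> \<longleftrightarrow> (\<forall>k\<in>J0. coef (f k) (triv (w0 k)) = 0)"
    using e_coef[OF f] by (simp flip: bij_betw_imp_surj_on[OF w0])
  also have "\<dots> \<longleftrightarrow> (\<forall>k\<in>J0. deg_part 0 (f k) = \<zero>)"
    using deg_part_zero_iff[OF fk(1)[OF f] fk(3)[OF f]] by simp
  finally show "?e f = \<zero>\<^bsub>?M\<^esub> \<longleftrightarrow> (\<forall>k\<in>J0. deg_part 0 (f k) = \<zero>)" by (simp add: simps)
qed

end

text \<open>
  Take all vertices at once and number vertices and arrows, since the terms of the resolution have to be
  families indexed by natural numbers.
\<close>

theorem (in quadratic_monomial_ring) koszul: "koszul R grading"
proof -
  obtain w0 :: "nat \<Rightarrow> 'v" where w0: "bij_betw w0 {0..<card V} V"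
    using ex_bij_betw_nat_finite[OF finite_V] by blast
  obtain first :: "nat \<Rightarrow> 'e" where first: "bij_betw first {0..<card E} E"
    using ex_bij_betw_nat_finite[OF finite_E] by blast
  let ?b = "the_inv_into {0..<card V} w0"
  define base where "base = (\<lambda>j. ?b (tgt (first j)))"
  have b: "?b v \<in> {0..<card V}" "w0 (?b v) = v" if "v \<in> V" for v
    using w0 that by (auto simp: bij_betw_def intro!: the_inv_into_into f_the_inv_into_f)
      (metis the_inv_into_into subset_refl atLeastLessThan_iff)
  have bw: "?b (w0 k) = k" if "k < card V" for k
    using w0 that by (simp add: bij_betw_def the_inv_into_f_f)
  have first_in: "first j \<in> E" if "j < card E" for j
    using bij_betw_apply[OF first] that by simp
  interpret monomial_resolution R B coef len stop V triv idem E src tgt arr ext prv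
    "{0..<card V}" w0 "{0..<card E}" first base
  proof
    show "w0 \<in> {0..<card V} \<rightarrow> V" using bij_betw_apply[OF w0] by blast
    show "bij_betw (\<lambda>j. (base j, first j)) {0..<card E} (SIGMA k:{0..<card V}. {\<alpha> \<in> E. tgt \<alpha> = w0 k})"
    proof (rule bij_betw_imageI)
      show "inj_on (\<lambda>j. (base j, first j)) {0..<card E}"
        using bij_betw_imp_inj_on[OF first] by (auto simp: inj_on_def)
      show "(\<lambda>j. (base j, first j)) ` {0..<card E} = (SIGMA k:{0..<card V}. {\<alpha> \<in> E. tgt \<alpha> = w0 k})"
      proof (intro equalityI subsetI)
        fix z assume "z \<in> (\<lambda>j. (base j, first j)) ` {0..<card E}"
        then show "z \<in> (SIGMA k:{0..<card V}. {\<alpha> \<in> E. tgt \<alpha> = w0 k})"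
          using b[OF tgt_in[OF first_in]] first_in by (auto simp: base_def)
      next
        fix z assume z: "z \<in> (SIGMA k:{0..<card V}. {\<alpha> \<in> E. tgt \<alpha> = w0 k})"
        then obtain j where "j \<in> {0..<card E}" "snd z = first j"
          using bij_betw_imp_surj_on[OF first] by (metis (no_types, lifting) SigmaE imageE mem_Collect_eq snd_conv)
        with z show "z \<in> (\<lambda>j. (base j, first j)) ` {0..<card E}"
          by (auto simp: base_def bw intro!: image_eqI[of _ _ j])
      qed
    qed
  qed auto
  have "semisimple_ring (R\<lparr>carrier := grading 0\<rparr>)" using semisimple_degree_zero by simp
  then show ?thesis
    unfolding koszul_def
    using graded_ring degree_zero_resolution[OF w0] res_generated by blast
qed

section \<open>Path algebras modulo paths of length two\<close>

definition cat :: "('v, 'e) path \<Rightarrow> ('v, 'e) path \<Rightarrow> ('v, 'e) path" where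
  "cat p q = (fst p, snd p @ snd q)"

definition splits :: "('v, 'e) pre_digraph \<Rightarrow> ('v, 'e) path \<Rightarrow> (('v, 'e) path \<times> ('v, 'e) path) set" where
  "splits Q r = {(p, q) \<in> paths Q \<times> paths Q. path_end Q p = fst q \<and> r = cat p q}"

context fin_digraph begin

lemma mem_paths_iff: "p \<in> paths G \<longleftrightarrow> awalk (fst p) (snd p) (path_end G p)"
  by (cases p) (auto simp: paths_def path_end_def)

lemma path_end_trivial [simp]: "path_end G (v, []) = v"
  by (simp add: path_end_def)

lemma trivial_path_iff [simp]: "(v, []) \<in> paths G \<longleftrightarrow> v \<in> verts G"
  by (simp add: mem_paths_iff awalk_Nil_iff)

lemma path_end_in: "p \<in> paths G \<Longrightarrow> path_end G p \<in> verts G"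
  by (auto simp: mem_paths_iff)

lemma path_start_in: "p \<in> paths G \<Longrightarrow> fst p \<in> verts G"
  by (auto simp: mem_paths_iff awalk_def)

lemma path_end_append: "path_end G (u, w @ w') = path_end G (path_end G (u, w), w')"
  by (cases "w' = []") (auto simp: path_end_def awalk_verts_conv)

lemma append_path_iff:
  "(u, w @ w') \<in> paths G \<longleftrightarrow> (u, w) \<in> paths G \<and> (path_end G (u, w), w') \<in> paths G"
  unfolding mem_paths_iff by (auto simp: path_end_append awalk_append_iff) (auto simp: path_end_def)

lemma arrow_path [simp]: "\<alpha> \<in> arcs G \<Longrightarrow> (tail G \<alpha>, [\<alpha>]) \<in> paths G"
  by (auto simp: paths_def awalk_def)

lemma path_end_arrow [simp]: "path_end G (u, [\<alpha>]) = head G \<alpha>"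
  by (simp add: path_end_def)

lemma Cons_path_iff: "(u, \<alpha> # w) \<in> paths G \<longleftrightarrow> \<alpha> \<in> arcs G \<and> u = tail G \<alpha> \<and> (head G \<alpha>, w) \<in> paths G"
  by (auto simp: paths_def awalk_def)

lemma cat_in_paths: "\<lbrakk>p \<in> paths G; q \<in> paths G; path_end G p = fst q\<rbrakk> \<Longrightarrow> cat p q \<in> paths G"
  by (cases p; cases q) (auto simp: cat_def append_path_iff)

lemma finite_splits: "finite (splits G r)"
proof (rule finite_subset)
  show "splits G r \<subseteq> (\<lambda>k. ((fst r, take k (snd r)), (path_end G (fst r, take k (snd r)), drop k (snd r))))
      ` {..length (snd r)}"
  proof
    fix z assume "z \<in> splits G r"
    then obtain p q where z: "z = (p, q)" "path_end G p = fst q" "r = cat p q"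
      by (auto simp: splits_def)
    then show "z \<in> (\<lambda>k. ((fst r, take k (snd r)), (path_end G (fst r, take k (snd r)), drop k (snd r))))
      ` {..length (snd r)}"
      by (intro image_eqI[of _ _ "length (snd p)"]) (auto simp: cat_def prod_eq_iff)
  qed
qed simp

lemma splits_left_unique: "\<lbrakk>(p, q) \<in> splits G r; (p', q) \<in> splits G r\<rbrakk> \<Longrightarrow> p = p'"
  by (auto simp: splits_def cat_def prod_eq_iff)

lemma splits_right_unique: "\<lbrakk>(p, q) \<in> splits G r; (p, q') \<in> splits G r\<rbrakk> \<Longrightarrow> q = q'"
  by (auto simp: splits_def cat_def prod_eq_iff)

end

lemma mult_path_algebra: "mult (path_algebra Q) f g r = (\<Sum>(p, q)\<in>splits Q r. f p * g q)"
  by (simp add: path_algebra_def splits_def cat_def)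

lemma path_algebra_simps:
  "carrier (path_algebra Q) = {f. finite {p. f p \<noteq> 0} \<and> {p. f p \<noteq> 0} \<subseteq> paths Q}"
  "zero (path_algebra Q) = (\<lambda>r. 0)"
  "add (path_algebra Q) = (\<lambda>f g r. f r + g r)"
  by (auto simp: path_algebra_def)

definition scaled_path :: "'k::field \<Rightarrow> ('v, 'e) path \<Rightarrow> ('v, 'e) path \<Rightarrow> 'k" where
  "scaled_path c p = (\<lambda>r. if r = p then c else 0)"

lemma path_elt_scaled: "path_elt p = scaled_path 1 p"
  by (simp add: path_elt_def scaled_path_def)

lemma scaled_path_in: "p \<in> paths Q \<Longrightarrow> scaled_path c p \<in> carrier (path_algebra Q)"
  by (auto simp: path_algebra_simps scaled_path_def intro: finite_subset[of _ "{p}"])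

lemma (in fin_digraph) mult_scaled_path:
  assumes "p \<in> paths G" "q \<in> paths G" "path_end G p = fst q"
  shows "scaled_path c p \<otimes>\<^bsub>path_algebra G\<^esub> scaled_path d q = scaled_path (c * d) (cat p q)"
proof
  fix r
  have "(scaled_path c p \<otimes>\<^bsub>path_algebra G\<^esub> scaled_path d q) r
      = (\<Sum>z\<in>splits G r. if z = (p, q) then c * d else 0)"
    unfolding mult_path_algebra by (rule sum.cong) (auto simp: scaled_path_def split: if_splits)
  also have "\<dots> = scaled_path (c * d) (cat p q) r"
    using assms finite_splits[of r] by (auto simp: sum.delta scaled_path_def splits_def)
  finally show "(scaled_path c p \<otimes>\<^bsub>path_algebra G\<^esub> scaled_path d q) r = scaled_path (c * d) (cat p q) r" .
qed

lemma (in fin_digraph) mult_arrow_elt: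
  assumes "\<alpha> \<in> arcs G" "\<beta> \<in> arcs G" "head G \<alpha> = tail G \<beta>"
  shows "arrow_elt G \<alpha> \<otimes>\<^bsub>path_algebra G\<^esub> arrow_elt G \<beta> = path_elt (tail G \<alpha>, [\<alpha>, \<beta>])"
  using mult_scaled_path[of "(tail G \<alpha>, [\<alpha>])" "(tail G \<beta>, [\<beta>])" 1 1] assms
  unfolding arrow_elt_def path_elt_scaled by (simp add: cat_def)

text \<open>
  An ideal generated by paths of length \<open>2\<close>.  The set \<open>S\<close> of generators is fixed, because the relations
  between arrows are read off from it.
\<close>

locale quadratic_path_ideal = fin_digraph Q for Q :: "('v, 'e) pre_digraph" +
  fixes I :: "(('v, 'e) path \<Rightarrow> 'k::field) set" and S :: "('v, 'e) path set"
  assumes ideal_I: "ideal I (path_algebra Q)"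
    and S_paths: "S \<subseteq> {p \<in> paths Q. path_length p = 2}"
    and I_generated: "I = Idl\<^bsub>path_algebra Q\<^esub> (path_elt ` S)"
begin

sublocale KQ: ideal I "path_algebra Q" by (rule ideal_I)

definition rel :: "'e \<Rightarrow> 'e \<Rightarrow> bool" where
  "rel \<alpha> \<beta> \<longleftrightarrow> (tail Q \<alpha>, [\<alpha>, \<beta>]) \<in> S"

text \<open>
  The paths not in \<open>I\<close>, by \<open>mem_ideal_iff\<close>; their classes are the basis of the quotient.
\<close>

definition nonzero_paths :: "('v, 'e) path set" where
  "nonzero_paths = {p \<in> paths Q. successively (\<lambda>\<alpha> \<beta>. \<not> rel \<alpha> \<beta>) (snd p)}"

lemma nonzero_pathD: "p \<in> nonzero_paths \<Longrightarrow> p \<in> paths Q"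
  by (simp add: nonzero_paths_def)

lemma splits_nonzero_paths: "\<lbrakk>(p, q) \<in> splits Q r; r \<in> nonzero_paths\<rbrakk> \<Longrightarrow> p \<in> nonzero_paths \<and> q \<in> nonzero_paths"
  by (auto simp: splits_def nonzero_paths_def cat_def successively_append_iff)

lemma relation_factor:
  assumes "p \<in> paths Q" "p \<notin> nonzero_paths"
  shows "\<exists>a s b. a \<in> paths Q \<and> s \<in> S \<and> b \<in> paths Q \<and> path_end Q a = fst s \<and>
    path_end Q s = fst b \<and> p = cat a (cat s b)"
proof -
  obtain u w where p: "p = (u, w)" by (cases p)
  \<comment> \<open>An adjacent pair of arrows forms a relation; cut the path before and after it.\<close>
  have "\<not> successively (\<lambda>\<alpha> \<beta>. \<not> rel \<alpha> \<beta>) w"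
    using assms by (simp add: nonzero_paths_def p)
  then obtain w1 \<alpha> \<beta> w2 where w: "w = w1 @ \<alpha> # \<beta> # w2" and r: "rel \<alpha> \<beta>"
  proof (induction w arbitrary: thesis rule: induct_list012)
    case (3 x y zs)
    show ?case
    proof (cases "rel x y")
      case True
      then show ?thesis using "3.prems"(1)[of "[]" x y zs] by simp
    next
      case False
      then have "\<not> successively (\<lambda>\<alpha> \<beta>. \<not> rel \<alpha> \<beta>) (y # zs)" using "3.prems"(2) by simp
      from "3.IH"(2)[OF _ this] show ?thesis
        using "3.prems"(1) by (metis append_Cons)
    qed
  qed auto
  have "(u, w1) \<in> paths Q" "(path_end Q (u, w1), \<alpha> # \<beta> # w2) \<in> paths Q"
    using assms(1) by (simp_all add: p w append_path_iff)
  then show ?thesis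
    using r
    by (intro exI[of _ "(u, w1)"] exI[of _ "(tail Q \<alpha>, [\<alpha>, \<beta>])"] exI[of _ "(head Q \<beta>, w2)"])
      (auto simp: p w cat_def rel_def Cons_path_iff path_end_def)
qed

text \<open>
  The functions that vanish on the paths without a relation form an ideal, because each factor of such a path is
  again of this kind; this ideal contains \<open>S\<close>.  Conversely, a path with a relation is a multiple of an
  element of \<open>S\<close>, and a function supported on such paths is a finite sum of scalar multiples of them.
\<close>

lemma mem_ideal_iff: "f \<in> I \<longleftrightarrow> f \<in> carrier (path_algebra Q) \<and> (\<forall>p\<in>nonzero_paths. f p = 0)"
proof
  let ?J = "{f :: ('v, 'e) path \<Rightarrow> 'k. f \<in> carrier (path_algebra Q) \<and> (\<forall>p\<in>nonzero_paths. f p = 0)}"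
  have minus: "(\<ominus>\<^bsub>path_algebra Q\<^esub> f) p = - f p" if "f \<in> carrier (path_algebra Q)"
    for f :: "('v, 'e) path \<Rightarrow> 'k" and p
  proof -
    have "(\<ominus>\<^bsub>path_algebra Q\<^esub> f) p + f p = 0"
      using fun_cong[OF KQ.l_neg[OF that], of p] by (simp add: path_algebra_simps)
    then show ?thesis by (simp add: eq_neg_iff_add_eq_0)
  qed
  have "ideal ?J (path_algebra Q)"
  proof (rule idealI)
    show "ring (path_algebra Q :: (('v, 'e) path \<Rightarrow> 'k) ring)" by (rule KQ.ring_axioms)
    show "subgroup ?J (add_monoid (path_algebra Q))"
    proof (rule KQ.add.subgroupI)
      show "?J \<noteq> {}" using KQ.zero_closed by (auto simp: path_algebra_simps(2))
      fix f g assume f: "f \<in> ?J"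
      then show "\<ominus>\<^bsub>path_algebra Q\<^esub> f \<in> ?J" using minus KQ.a_inv_closed by auto
      assume g: "g \<in> ?J"
      have "f \<oplus>\<^bsub>path_algebra Q\<^esub> g \<in> carrier (path_algebra Q)" using f g by blast
      then show "f \<oplus>\<^bsub>path_algebra Q\<^esub> g \<in> ?J" using f g by (auto simp: path_algebra_simps(3))
    qed blast
    fix f g :: "('v, 'e) path \<Rightarrow> 'k" assume f: "f \<in> ?J" and g: "g \<in> carrier (path_algebra Q)"
    then have c: "g \<otimes>\<^bsub>path_algebra Q\<^esub> f \<in> carrier (path_algebra Q)"
      "f \<otimes>\<^bsub>path_algebra Q\<^esub> g \<in> carrier (path_algebra Q)" by blast+
    have "(g \<otimes>\<^bsub>path_algebra Q\<^esub> f) r = 0 \<and> (f \<otimes>\<^bsub>path_algebra Q\<^esub> g) r = 0" if "r \<in> nonzero_paths" for r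
      unfolding mult_path_algebra using f splits_nonzero_paths[OF _ that] by (auto intro!: sum.neutral)
    with c show "g \<otimes>\<^bsub>path_algebra Q\<^esub> f \<in> ?J" "f \<otimes>\<^bsub>path_algebra Q\<^esub> g \<in> ?J" by blast+
  qed
  moreover have "path_elt ` S \<subseteq> ?J"
  proof safe
    fix u w assume s: "(u, w) \<in> S"
    then have sp: "(u, w) \<in> paths Q" "length w = 2" using S_paths by (auto simp: path_length_def)
    then obtain \<alpha> \<beta> where w: "w = [\<alpha>, \<beta>]" by (auto simp: numeral_2_eq_2 length_Suc_conv)
    then have "(u, w) \<notin> nonzero_paths" using s sp by (auto simp: nonzero_paths_def rel_def Cons_path_iff)
    then show "path_elt (u, w) p = 0" if "p \<in> nonzero_paths" for p
      using that by (auto simp: path_elt_def)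
    show "path_elt (u, w) \<in> carrier (path_algebra Q)"
      unfolding path_elt_scaled by (rule scaled_path_in[OF sp(1)])
  qed
  ultimately have "I \<subseteq> ?J"
    unfolding I_generated by (rule KQ.genideal_minimal)
  then show "f \<in> carrier (path_algebra Q) \<and> (\<forall>p\<in>nonzero_paths. f p = 0)" if "f \<in> I"
    using that by blast
next
  have scaled: "scaled_path c p \<in> I" if p: "p \<in> paths Q" "p \<notin> nonzero_paths" for c p
  proof -
    obtain a s b where asb: "a \<in> paths Q" "s \<in> S" "b \<in> paths Q" "path_end Q a = fst s"
      "path_end Q s = fst b" "p = cat a (cat s b)"
      using relation_factor[OF p] by blast
    have s: "s \<in> paths Q" using asb S_paths by blast
    have "path_elt s \<in> I"
      unfolding I_generated
      by (rule subsetD[OF KQ.genideal_self]) (use asb S_paths scaled_path_in[of _ Q 1] in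
        \<open>auto simp: path_elt_scaled\<close>)
    then have "path_elt s \<otimes>\<^bsub>path_algebra Q\<^esub> scaled_path 1 b \<in> I"
      by (rule KQ.I_r_closed) (rule scaled_path_in[OF asb(3)])
    then have "scaled_path c a \<otimes>\<^bsub>path_algebra Q\<^esub> (path_elt s \<otimes>\<^bsub>path_algebra Q\<^esub> scaled_path 1 b) \<in> I"
      by (rule KQ.I_l_closed) (rule scaled_path_in[OF asb(1)])
    moreover have "path_elt s \<otimes>\<^bsub>path_algebra Q\<^esub> scaled_path 1 b = (scaled_path 1 (cat s b) :: _ \<Rightarrow> 'k)"
      using mult_scaled_path[OF s asb(3,5), of 1 1] by (simp add: path_elt_scaled)
    moreover have "scaled_path c a \<otimes>\<^bsub>path_algebra Q\<^esub> scaled_path 1 (cat s b) = scaled_path c p"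
      using mult_scaled_path[OF asb(1) cat_in_paths[OF s asb(3,5)], of c 1] asb(4,6)
      by (simp add: cat_def)
    ultimately show ?thesis by (simp only:)
  qed
  assume "f \<in> carrier (path_algebra Q) \<and> (\<forall>p\<in>nonzero_paths. f p = 0)"
  then show "f \<in> I"
  proof (induction "card {p. f p \<noteq> 0}" arbitrary: f)
    case 0
    then have "f = \<zero>\<^bsub>path_algebra Q\<^esub>" by (auto simp: path_algebra_simps fun_eq_iff)
    then show ?case using KQ.zero_closed by simp
  next
    case (Suc n)
    then have fin: "finite {p. f p \<noteq> 0}" by (simp add: path_algebra_simps)
    have "{p. f p \<noteq> 0} \<noteq> {}" using Suc.hyps(2) by (metis card.empty nat.simps(3))
    then obtain p where p: "f p \<noteq> 0" by blast
    have pp: "p \<in> paths Q" "p \<notin> nonzero_paths" using Suc p by (auto simp: path_algebra_simps)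
    have "{q. (f(p := 0)) q \<noteq> 0} = {q. f q \<noteq> 0} - {p}" by auto
    then have "card {q. (f(p := 0)) q \<noteq> 0} = n" "{q. (f(p := 0)) q \<noteq> 0} \<subseteq> {q. f q \<noteq> 0}"
      using Suc.hyps(2) p fin by auto
    then have "f(p := 0) \<in> I"
      using Suc.prems fin finite_subset[OF _ fin, of "{q. (f(p := 0)) q \<noteq> 0}"]
      by (intro Suc.hyps(1)) (simp_all add: path_algebra_simps, blast)
    then have "f(p := 0) \<oplus>\<^bsub>path_algebra Q\<^esub> scaled_path (f p) p \<in> I"
      using scaled[OF pp] by simp
    moreover have "f(p := 0) \<oplus>\<^bsub>path_algebra Q\<^esub> scaled_path (f p) p = f"
      by (auto simp: path_algebra_simps scaled_path_def)
    ultimately show ?case by simp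
  qed
qed


subsection \<open>The quotient\<close>

abbreviation A :: "(('v, 'e) path \<Rightarrow> 'k) set ring" where
  "A \<equiv> path_quotient Q I"

abbreviation cls :: "(('v, 'e) path \<Rightarrow> 'k) \<Rightarrow> (('v, 'e) path \<Rightarrow> 'k) set" where
  "cls f \<equiv> I +>\<^bsub>path_algebra Q\<^esub> f"

text \<open>
  The coordinates with respect to the classes of the paths in \<open>nonzero_paths\<close>.  On these paths the value does not depend on
  the representative; elsewhere it is meaningless.
\<close>

definition rep_coef :: "(('v, 'e) path \<Rightarrow> 'k) set \<Rightarrow> ('v, 'e) path \<Rightarrow> 'k" where
  "rep_coef X p = (SOME f. f \<in> X) p"

lemma ring_A: "ring A"
  unfolding path_quotient_def by (rule KQ.quotient_is_ring)

lemma carrier_A: "carrier A = cls ` carrier (path_algebra Q)"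
  by (auto simp: path_quotient_def FactRing_def A_RCOSETS_def RCOSETS_def a_r_coset_def)

lemma cls_in: "f \<in> carrier (path_algebra Q) \<Longrightarrow> cls f \<in> carrier A"
  by (simp add: carrier_A)

lemma cls_mult:
  "\<lbrakk>f \<in> carrier (path_algebra Q); g \<in> carrier (path_algebra Q)\<rbrakk> \<Longrightarrow>
    cls f \<otimes>\<^bsub>A\<^esub> cls g = cls (f \<otimes>\<^bsub>path_algebra Q\<^esub> g)"
  by (simp add: path_quotient_def FactRing_def KQ.rcoset_mult_add)

lemma cls_add:
  "\<lbrakk>f \<in> carrier (path_algebra Q); g \<in> carrier (path_algebra Q)\<rbrakk> \<Longrightarrow>
    cls f \<oplus>\<^bsub>A\<^esub> cls g = cls (f \<oplus>\<^bsub>path_algebra Q\<^esub> g)"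
  by (simp add: path_quotient_def FactRing_def KQ.a_rcos_sum)

lemma rep_coef_cls:
  assumes f: "f \<in> carrier (path_algebra Q)" and p: "p \<in> nonzero_paths"
  shows "rep_coef (cls f) p = f p"
proof -
  have "(SOME g. g \<in> cls f) \<in> cls f"
    by (rule someI[of _ f]) (rule KQ.a_rcos_self[OF f])
  then obtain h where "h \<in> I" "(SOME g. g \<in> cls f) = h \<oplus>\<^bsub>path_algebra Q\<^esub> f"
    by (auto simp: a_r_coset_def')
  then show ?thesis
    using p by (simp add: rep_coef_def path_algebra_simps(3) mem_ideal_iff)
qed

lemma rep_coef_eqI:
  assumes "X \<in> carrier A" "Y \<in> carrier A" "\<And>p. p \<in> nonzero_paths \<Longrightarrow> rep_coef X p = rep_coef Y p"
  shows "X = Y"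
proof -
  obtain f g where f: "f \<in> carrier (path_algebra Q)" "X = cls f"
    and g: "g \<in> carrier (path_algebra Q)" "Y = cls g"
    using assms(1,2) by (auto simp: carrier_A)
  let ?h = "f \<ominus>\<^bsub>path_algebra Q\<^esub> g"
  have h: "?h \<in> carrier (path_algebra Q)" using f g by blast
  have fgh: "?h \<oplus>\<^bsub>path_algebra Q\<^esub> g = f"
    using f g by (simp add: KQ.minus_eq KQ.a_assoc KQ.l_neg)
  have "?h p + g p = f p" for p
    using fun_cong[OF fgh, of p] by (simp add: path_algebra_simps(3))
  moreover have "f p = g p" if "p \<in> nonzero_paths" for p
    using assms(3)[OF that] unfolding f(2) g(2) rep_coef_cls[OF f(1) that] rep_coef_cls[OF g(1) that] .
  ultimately have "?h p = 0" if "p \<in> nonzero_paths" for p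
    using that by (metis add_cancel_left_left)
  then have "?h \<in> I" using h by (simp add: mem_ideal_iff)
  then show ?thesis
    using KQ.quotient_eq_iff_same_a_r_cos[OF ideal_I f(1) g(1)] f g by simp
qed

lemma rep_coef_add:
  assumes "X \<in> carrier A" "Y \<in> carrier A" and p: "p \<in> nonzero_paths"
  shows "rep_coef (X \<oplus>\<^bsub>A\<^esub> Y) p = rep_coef X p + rep_coef Y p"
proof -
  obtain f g where f: "f \<in> carrier (path_algebra Q)" "X = cls f"
    and g: "g \<in> carrier (path_algebra Q)" "Y = cls g"
    using assms(1,2) by (auto simp: carrier_A)
  have "rep_coef (X \<oplus>\<^bsub>A\<^esub> Y) p = (f \<oplus>\<^bsub>path_algebra Q\<^esub> g) p"
    unfolding f(2) g(2) cls_add[OF f(1) g(1)] by (rule rep_coef_cls[OF KQ.a_closed[OF f(1) g(1)] p])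
  then show ?thesis
    using f g p by (simp add: path_algebra_simps(3) rep_coef_cls)
qed

lemma rep_coef_mult:
  assumes "X \<in> carrier A" "Y \<in> carrier A" "r \<in> nonzero_paths"
  shows "rep_coef (X \<otimes>\<^bsub>A\<^esub> Y) r = (\<Sum>(p, q)\<in>splits Q r. rep_coef X p * rep_coef Y q)"
proof -
  obtain f g where f: "f \<in> carrier (path_algebra Q)" "X = cls f"
    and g: "g \<in> carrier (path_algebra Q)" "Y = cls g"
    using assms(1,2) by (auto simp: carrier_A)
  have "rep_coef (X \<otimes>\<^bsub>A\<^esub> Y) r = (f \<otimes>\<^bsub>path_algebra Q\<^esub> g) r"
    using f g assms(3) by (simp add: cls_mult rep_coef_cls)
  also have "\<dots> = (\<Sum>(p, q)\<in>splits Q r. rep_coef X p * rep_coef Y q)"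
    unfolding mult_path_algebra
    by (rule sum.cong) (use f g splits_nonzero_paths[OF _ assms(3)] in \<open>auto simp: rep_coef_cls\<close>)
  finally show ?thesis .
qed

lemma finite_rep_coef: "X \<in> carrier A \<Longrightarrow> finite {p \<in> nonzero_paths. rep_coef X p \<noteq> 0}"
proof -
  assume "X \<in> carrier A"
  then obtain f where f: "f \<in> carrier (path_algebra Q)" "X = cls f" by (auto simp: carrier_A)
  show ?thesis
    by (rule finite_subset[of _ "{p. f p \<noteq> 0}"]) (use f in \<open>auto simp: rep_coef_cls path_algebra_simps(1)\<close>)
qed

lemma rep_coef_surj:
  assumes "finite {p \<in> nonzero_paths. f p \<noteq> 0}"
  shows "\<exists>X\<in>carrier A. \<forall>p\<in>nonzero_paths. rep_coef X p = f p"
proof -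
  let ?g = "\<lambda>p. if p \<in> nonzero_paths then f p else 0"
  have "?g \<in> carrier (path_algebra Q)"
    using nonzero_pathD by (auto simp: path_algebra_simps(1) intro: finite_subset[OF _ assms])
  then show ?thesis
    by (intro bexI[of _ "cls ?g"]) (auto simp: rep_coef_cls cls_in)
qed

abbreviation path_class :: "('v, 'e) path \<Rightarrow> (('v, 'e) path \<Rightarrow> 'k) set" where
  "path_class p \<equiv> cls (path_elt p)"

lemma path_elt_in: "p \<in> paths Q \<Longrightarrow> path_elt p \<in> carrier (path_algebra Q)"
  unfolding path_elt_scaled by (rule scaled_path_in)

lemma path_class_in: "p \<in> paths Q \<Longrightarrow> path_class p \<in> carrier A"
  by (intro cls_in path_elt_in)

lemma rep_coef_path_class:
  "\<lbrakk>q \<in> paths Q; p \<in> nonzero_paths\<rbrakk> \<Longrightarrow> rep_coef (path_class q) p = (if p = q then 1 else 0)"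
  by (simp add: rep_coef_cls path_elt_in) (simp add: path_elt_def)

lemma mult_path_class:
  "\<lbrakk>p \<in> paths Q; q \<in> paths Q; path_end Q p = fst q\<rbrakk> \<Longrightarrow>
    path_class p \<otimes>\<^bsub>A\<^esub> path_class q = path_class (cat p q)"
  by (simp add: cls_mult path_elt_in) (simp add: path_elt_scaled mult_scaled_path)

lemma rep_coef_mult_path_right:
  assumes X: "X \<in> carrier A" and r: "r \<in> nonzero_paths" and q: "q \<in> paths Q"
  shows "(p, q) \<in> splits Q r \<Longrightarrow> rep_coef (X \<otimes>\<^bsub>A\<^esub> path_class q) r = rep_coef X p"
    and "(\<And>p. (p, q) \<notin> splits Q r) \<Longrightarrow> rep_coef (X \<otimes>\<^bsub>A\<^esub> path_class q) r = 0"
proof -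
  have eq: "rep_coef (X \<otimes>\<^bsub>A\<^esub> path_class q) r
      = (\<Sum>z\<in>splits Q r. if snd z = q then rep_coef X (fst z) else 0)"
    unfolding rep_coef_mult[OF X path_class_in[OF q] r]
    by (rule sum.cong) (use splits_nonzero_paths[OF _ r] q in \<open>auto simp: rep_coef_path_class\<close>)
  show "rep_coef (X \<otimes>\<^bsub>A\<^esub> path_class q) r = rep_coef X p" if pq: "(p, q) \<in> splits Q r"
  proof -
    have "(\<Sum>z\<in>splits Q r. if snd z = q then rep_coef X (fst z) else 0)
        = (\<Sum>z\<in>splits Q r. if z = (p, q) then rep_coef X p else 0)"
      by (rule sum.cong) (use splits_left_unique[OF pq] in auto)
    then show ?thesis using eq pq finite_splits[of r] by simp
  qed
  show "rep_coef (X \<otimes>\<^bsub>A\<^esub> path_class q) r = 0" if "\<And>p. (p, q) \<notin> splits Q r"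
    unfolding eq by (rule sum.neutral) (use that in auto)
qed

lemma rep_coef_mult_path_left:
  assumes X: "X \<in> carrier A" and r: "r \<in> nonzero_paths" and p: "p \<in> paths Q"
  shows "(p, q) \<in> splits Q r \<Longrightarrow> rep_coef (path_class p \<otimes>\<^bsub>A\<^esub> X) r = rep_coef X q"
    and "(\<And>q. (p, q) \<notin> splits Q r) \<Longrightarrow> rep_coef (path_class p \<otimes>\<^bsub>A\<^esub> X) r = 0"
proof -
  have eq: "rep_coef (path_class p \<otimes>\<^bsub>A\<^esub> X) r
      = (\<Sum>z\<in>splits Q r. if fst z = p then rep_coef X (snd z) else 0)"
    unfolding rep_coef_mult[OF path_class_in[OF p] X r]
    by (rule sum.cong) (use splits_nonzero_paths[OF _ r] p in \<open>auto simp: rep_coef_path_class\<close>)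
  show "rep_coef (path_class p \<otimes>\<^bsub>A\<^esub> X) r = rep_coef X q" if pq: "(p, q) \<in> splits Q r"
  proof -
    have "(\<Sum>z\<in>splits Q r. if fst z = p then rep_coef X (snd z) else 0)
        = (\<Sum>z\<in>splits Q r. if z = (p, q) then rep_coef X q else 0)"
      by (rule sum.cong) (use splits_right_unique[OF pq] in auto)
    then show ?thesis using eq pq finite_splits[of r] by simp
  qed
  show "rep_coef (path_class p \<otimes>\<^bsub>A\<^esub> X) r = 0" if "\<And>q. (p, q) \<notin> splits Q r"
    unfolding eq by (rule sum.neutral) (use that in auto)
qed

lemma rep_coef_mult_nonzero:
  assumes "X \<in> carrier A" "Y \<in> carrier A" "r \<in> nonzero_paths" "rep_coef (X \<otimes>\<^bsub>A\<^esub> Y) r \<noteq> 0"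
  shows "\<exists>p\<in>nonzero_paths. \<exists>q\<in>nonzero_paths. rep_coef X p \<noteq> 0 \<and> rep_coef Y q \<noteq> 0 \<and>
    path_length r = path_length p + path_length q"
proof -
  obtain z where z: "z \<in> splits Q r" "(case z of (p, q) \<Rightarrow> rep_coef X p * rep_coef Y q) \<noteq> 0"
    using assms(4) unfolding rep_coef_mult[OF assms(1-3)] by (rule sum.not_neutral_contains_not_neutral)
  obtain p q where "z = (p, q)" by (cases z)
  with z have "(p, q) \<in> splits Q r" "rep_coef X p \<noteq> 0" "rep_coef Y q \<noteq> 0" by auto
  then show ?thesis
    using splits_nonzero_paths[OF _ assms(3), of p q] by (auto simp: splits_def cat_def path_length_def)
qed

lemma trivial_nonzero_path: "v \<in> verts Q \<Longrightarrow> (v, []) \<in> nonzero_paths"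
  by (simp add: nonzero_paths_def)

lemma rep_coef_mult_trivial:
  assumes "X \<in> carrier A" "Y \<in> carrier A" "v \<in> verts Q"
  shows "rep_coef (X \<otimes>\<^bsub>A\<^esub> Y) (v, []) = rep_coef X (v, []) * rep_coef Y (v, [])"
proof -
  have "splits Q (v, []) = {((v, []), (v, []))}"
    using assms(3) by (auto simp: splits_def cat_def prod_eq_iff)
  then show ?thesis
    using rep_coef_mult[OF assms(1,2) trivial_nonzero_path[OF assms(3)]] by simp
qed

lemma nonzero_path_snoc_iff:
  assumes "(u, w) \<in> nonzero_paths" "\<alpha> \<in> arcs Q"
  shows "(u, w @ [\<alpha>]) \<in> nonzero_paths \<longleftrightarrow>
    path_end Q (u, w) = tail Q \<alpha> \<and> (w \<noteq> [] \<longrightarrow> \<not> rel (last w) \<alpha>)"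
proof -
  have "(path_end Q (u, w), [\<alpha>]) \<in> paths Q \<longleftrightarrow> path_end Q (u, w) = tail Q \<alpha>"
    using assms(2) unfolding Cons_path_iff trivial_path_iff by simp
  then show ?thesis
    using assms(1) by (auto simp: nonzero_paths_def append_path_iff successively_append_iff)
qed

lemma nonzero_path_Cons_iff:
  assumes "(head Q \<alpha>, w) \<in> nonzero_paths" "\<alpha> \<in> arcs Q"
  shows "(tail Q \<alpha>, \<alpha> # w) \<in> nonzero_paths \<longleftrightarrow> (w \<noteq> [] \<longrightarrow> \<not> rel \<alpha> (hd w))"
proof -
  have "(tail Q \<alpha>, \<alpha> # w) \<in> paths Q"
    using assms nonzero_pathD unfolding Cons_path_iff[of _ \<alpha> w] by blast
  then show ?thesis
    using assms(1) by (cases w) (auto simp: nonzero_paths_def)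
qed

lemma nonzero_path_snocD: "(u, w @ [\<alpha>]) \<in> nonzero_paths \<Longrightarrow> (u, w) \<in> nonzero_paths \<and> \<alpha> \<in> arcs Q"
  unfolding nonzero_paths_def mem_Collect_eq fst_conv snd_conv append_path_iff Cons_path_iff successively_append_iff
  by blast

lemma nonzero_path_ConsD: "(u, \<alpha> # w) \<in> nonzero_paths \<Longrightarrow> (head Q \<alpha>, w) \<in> nonzero_paths \<and> \<alpha> \<in> arcs Q \<and> u = tail Q \<alpha>"
  unfolding nonzero_paths_def mem_Collect_eq snd_conv Cons_path_iff[of u \<alpha>] by (cases w) auto

lemma relD: "rel \<alpha> \<beta> \<Longrightarrow> \<alpha> \<in> arcs Q \<and> \<beta> \<in> arcs Q \<and> head Q \<alpha> = tail Q \<beta>"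
proof -
  assume "rel \<alpha> \<beta>"
  then have "(tail Q \<alpha>, [\<alpha>, \<beta>]) \<in> paths Q" using S_paths unfolding rel_def by blast
  then show ?thesis unfolding Cons_path_iff by blast
qed

lemma arrow_mult_mem_ideal_iff:
  assumes "\<alpha> \<in> arcs Q" "\<beta> \<in> arcs Q" "head Q \<alpha> = tail Q \<beta>"
  shows "arrow_elt Q \<alpha> \<otimes>\<^bsub>path_algebra Q\<^esub> arrow_elt Q \<beta> \<in> I \<longleftrightarrow> rel \<alpha> \<beta>"
proof -
  have p: "(tail Q \<alpha>, [\<alpha>, \<beta>]) \<in> paths Q"
    using assms unfolding Cons_path_iff trivial_path_iff by simp
  have "arrow_elt Q \<alpha> \<otimes>\<^bsub>path_algebra Q\<^esub> arrow_elt Q \<beta> = (path_elt (tail Q \<alpha>, [\<alpha>, \<beta>]) :: _ \<Rightarrow> 'k)"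
    by (rule mult_arrow_elt[OF assms])
  moreover have "path_elt (tail Q \<alpha>, [\<alpha>, \<beta>]) \<in> I \<longleftrightarrow> (tail Q \<alpha>, [\<alpha>, \<beta>]) \<notin> nonzero_paths"
    unfolding mem_ideal_iff using path_elt_in[OF p] by (auto simp: path_elt_def)
  moreover have "(tail Q \<alpha>, [\<alpha>, \<beta>]) \<notin> nonzero_paths \<longleftrightarrow> rel \<alpha> \<beta>"
    using p by (simp add: nonzero_paths_def)
  ultimately show ?thesis by simp
qed

end

section \<open>Locally gentle algebras\<close>

text \<open>
  The uniqueness of the relations to the left and to the right of an arrow.  The first condition yields the
  resolutions of right modules, the second those of left modules.
\<close>

locale gentle_path_ideal = quadratic_path_ideal Q I S
  for Q :: "('v, 'e) pre_digraph" and I :: "(('v, 'e) path \<Rightarrow> 'k::field) set" and S +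
  assumes rel_right_unique: "\<lbrakk>rel \<alpha> \<beta>; rel \<alpha> \<gamma>\<rbrakk> \<Longrightarrow> \<beta> = \<gamma>"
    and rel_left_unique: "\<lbrakk>rel \<beta> \<alpha>; rel \<gamma> \<alpha>\<rbrakk> \<Longrightarrow> \<beta> = \<gamma>"
begin

definition previous_relation_arrow :: "'e \<Rightarrow> 'e option" where
  "previous_relation_arrow \<alpha> = (if \<exists>\<gamma>. rel \<gamma> \<alpha> then Some (THE \<gamma>. rel \<gamma> \<alpha>) else None)"

lemma previous_relation_arrow_iff: "previous_relation_arrow \<alpha> = Some \<gamma> \<longleftrightarrow> rel \<gamma> \<alpha>"
proof -
  have "(THE \<gamma>. rel \<gamma> \<alpha>) = \<gamma>" if "rel \<gamma> \<alpha>" for \<gamma>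
    using that rel_left_unique by blast
  then show ?thesis by (auto simp: previous_relation_arrow_def)
qed

lemma next_relation_arrow_iff:
  assumes "\<alpha> \<in> arcs Q"
  shows "next_relation_arrow Q I \<alpha> = Some \<beta> \<longleftrightarrow> rel \<alpha> \<beta>"
proof -
  have B: "{\<beta> \<in> arcs Q. head Q \<alpha> = tail Q \<beta> \<and>
      arrow_elt Q \<alpha> \<otimes>\<^bsub>path_algebra Q\<^esub> arrow_elt Q \<beta> \<in> I} = {\<beta>. rel \<alpha> \<beta>}"
    using arrow_mult_mem_ideal_iff[OF assms] relD by blast
  have "(THE \<beta>. rel \<alpha> \<beta>) = \<beta>" if "rel \<alpha> \<beta>" for \<beta>
    using that rel_right_unique by blast
  then show ?thesis by (auto simp: next_relation_arrow_def B Let_def)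
qed

lemma mult_idem_arrow: "\<alpha> \<in> arcs Q \<Longrightarrow>
    path_class (tail Q \<alpha>, []) \<otimes>\<^bsub>A\<^esub> path_class (tail Q \<alpha>, [\<alpha>]) = path_class (tail Q \<alpha>, [\<alpha>])"
  "\<alpha> \<in> arcs Q \<Longrightarrow>
    path_class (tail Q \<alpha>, [\<alpha>]) \<otimes>\<^bsub>A\<^esub> path_class (head Q \<alpha>, []) = path_class (tail Q \<alpha>, [\<alpha>])"
  by (simp_all add: mult_path_class cat_def)

text \<open>
  For left modules, paths are prolonged at their end, and chains of relations run backwards.
\<close>

lemma left_quadratic_monomial_ring: "quadratic_monomial_ring A nonzero_paths rep_coef path_length (path_end Q) (verts Q)
  (\<lambda>v. (v, [])) (\<lambda>v. path_class (v, [])) (arcs Q) (tail Q) (head Q)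
  (\<lambda>\<alpha>. path_class (tail Q \<alpha>, [\<alpha>])) (\<lambda>p \<alpha>. (fst p, snd p @ [\<alpha>])) previous_relation_arrow"
proof (intro quadratic_monomial_ring.intro quadratic_monomial_ring_axioms.intro)
  show "ring A" by (rule ring_A)
  show "finite (verts Q)" "finite (arcs Q)" by simp_all
  fix X Y assume X: "X \<in> carrier A"
  show "finite {p \<in> nonzero_paths. rep_coef X p \<noteq> 0}" using X by (rule finite_rep_coef)
  show "rep_coef (X \<otimes>\<^bsub>A\<^esub> path_class (v, [])) p = (if path_end Q p = v then rep_coef X p else 0)"
    if "v \<in> verts Q" "p \<in> nonzero_paths" for v p
    using rep_coef_mult_path_right[OF X that(2), of "(v, [])"] that nonzero_pathD
    by (auto simp: splits_def cat_def)
  assume Y: "Y \<in> carrier A"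
  show "X = Y" if "\<And>p. p \<in> nonzero_paths \<Longrightarrow> rep_coef X p = rep_coef Y p"
    using X Y that by (rule rep_coef_eqI)
  show "rep_coef (X \<oplus>\<^bsub>A\<^esub> Y) p = rep_coef X p + rep_coef Y p" if "p \<in> nonzero_paths" for p
    using X Y that by (rule rep_coef_add)
  show "\<exists>p\<in>nonzero_paths. \<exists>q\<in>nonzero_paths. rep_coef X p \<noteq> 0 \<and> rep_coef Y q \<noteq> 0 \<and>
      path_length r = path_length p + path_length q"
    if "r \<in> nonzero_paths" "rep_coef (X \<otimes>\<^bsub>A\<^esub> Y) r \<noteq> 0" for r
    using X Y that by (rule rep_coef_mult_nonzero)
  show "rep_coef (X \<otimes>\<^bsub>A\<^esub> Y) (v, []) = rep_coef X (v, []) * rep_coef Y (v, [])" if "v \<in> verts Q" for v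
    using X Y that by (rule rep_coef_mult_trivial)
next
  fix f :: "('v, 'e) path \<Rightarrow> 'k" assume "finite {p \<in> nonzero_paths. f p \<noteq> 0}"
  then show "\<exists>y\<in>carrier A. \<forall>p\<in>nonzero_paths. rep_coef y p = f p" by (rule rep_coef_surj)
next
  fix X \<alpha> \<beta> p assume X: "X \<in> carrier A" and p: "p \<in> nonzero_paths" and arcs: "\<alpha> \<in> arcs Q" "\<beta> \<in> arcs Q"
    and ext: "(fst p, snd p @ [\<alpha>]) \<in> nonzero_paths"
  let ?r = "(fst p, snd p @ [\<alpha>])"
  have end_p: "path_end Q p = tail Q \<alpha>"
    using nonzero_path_snoc_iff[of "fst p" "snd p" \<alpha>] p arcs ext by simp
  show "rep_coef (X \<otimes>\<^bsub>A\<^esub> path_class (tail Q \<beta>, [\<beta>])) ?r = (if \<alpha> = \<beta> then rep_coef X p else 0)"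
  proof (cases "\<alpha> = \<beta>")
    case True
    then have "(p, (tail Q \<beta>, [\<beta>])) \<in> splits Q ?r"
      using p arcs end_p nonzero_pathD by (auto simp: splits_def cat_def)
    then show ?thesis using rep_coef_mult_path_right(1)[OF X ext] True arcs by simp
  next
    case False
    then have "(q, (tail Q \<beta>, [\<beta>])) \<notin> splits Q ?r" for q by (auto simp: splits_def cat_def)
    then show ?thesis using rep_coef_mult_path_right(2)[OF X ext] False arcs by simp
  qed
next
  fix X q \<beta> assume X: "X \<in> carrier A" and q: "q \<in> nonzero_paths" "path_length q = 0" and \<beta>: "\<beta> \<in> arcs Q"
  then have "(p, (tail Q \<beta>, [\<beta>])) \<notin> splits Q q" for p
    by (auto simp: splits_def cat_def path_length_def)
  then show "rep_coef (X \<otimes>\<^bsub>A\<^esub> path_class (tail Q \<beta>, [\<beta>])) q = 0"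
    using rep_coef_mult_path_right(2)[OF X q(1)] \<beta> by simp
next
  fix p \<alpha> assume p: "p \<in> nonzero_paths" and \<alpha>: "\<alpha> \<in> arcs Q" and "(fst p, snd p @ [\<alpha>]) \<in> nonzero_paths"
  then show "path_end Q p = tail Q \<alpha> \<and> path_end Q (fst p, snd p @ [\<alpha>]) = head Q \<alpha> \<and>
      path_length (fst p, snd p @ [\<alpha>]) = Suc (path_length p)"
    using nonzero_path_snoc_iff[of "fst p" "snd p" \<alpha>] by (simp add: path_end_append path_length_def)
next
  fix p \<alpha> assume p: "p \<in> nonzero_paths" and \<alpha>: "\<alpha> \<in> arcs Q" "path_end Q p = tail Q \<alpha>"
    and ext: "(fst p, snd p @ [\<alpha>]) \<notin> nonzero_paths"
  then have w: "snd p \<noteq> []" "rel (last (snd p)) \<alpha>"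
    using nonzero_path_snoc_iff[of "fst p" "snd p" \<alpha>] by auto
  have "(fst p, butlast (snd p)) \<in> nonzero_paths"
    using nonzero_path_snocD[of "fst p" "butlast (snd p)" "last (snd p)"] p w(1) by simp
  then have "\<exists>p'\<in>nonzero_paths. p = (fst p', snd p' @ [last (snd p)])"
    using w(1) by (intro bexI[of _ "(fst p, butlast (snd p))"]) (auto simp: prod_eq_iff)
  then show "\<exists>\<gamma>. previous_relation_arrow \<alpha> = Some \<gamma> \<and> (\<exists>p'\<in>nonzero_paths. p = (fst p', snd p' @ [\<gamma>]))"
    using w(2) previous_relation_arrow_iff by blast
next
  fix p \<alpha> \<gamma> assume "p \<in> nonzero_paths" "\<alpha> \<in> arcs Q" "previous_relation_arrow \<alpha> = Some \<gamma>"
    "(fst p, snd p @ [\<gamma>]) \<in> nonzero_paths"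
  then show "(fst (fst p, snd p @ [\<gamma>]), snd (fst p, snd p @ [\<gamma>]) @ [\<alpha>]) \<notin> nonzero_paths"
    using nonzero_path_snoc_iff[of "fst p" "snd p @ [\<gamma>]" \<alpha>] by (simp add: previous_relation_arrow_iff)
next
  fix \<alpha> \<gamma> assume "\<alpha> \<in> arcs Q" "previous_relation_arrow \<alpha> = Some \<gamma>"
  then show "\<gamma> \<in> arcs Q \<and> head Q \<gamma> = tail Q \<alpha>"
    using relD by (simp add: previous_relation_arrow_iff)
next
  fix q assume q: "q \<in> nonzero_paths" "path_length q \<noteq> 0"
  then have "snd q \<noteq> []" by (simp add: path_length_def)
  then obtain w \<alpha> where w: "snd q = w @ [\<alpha>]" by (metis rev_exhaust)
  then have "q = (fst q, w @ [\<alpha>])" by (simp add: prod_eq_iff)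
  then have "(fst q, w) \<in> nonzero_paths" "\<alpha> \<in> arcs Q" using nonzero_path_snocD[of "fst q" w \<alpha>] q(1) by auto
  then show "\<exists>p\<in>nonzero_paths. \<exists>\<alpha>\<in>arcs Q. q = (fst p, snd p @ [\<alpha>])"
    using w by (intro bexI[of _ "(fst q, w)"] bexI[of _ \<alpha>]) (auto simp: prod_eq_iff)
qed (use mult_idem_arrow in \<open>auto simp: path_end_in nonzero_pathD trivial_nonzero_path path_length_def
      path_class_in rep_coef_path_class prod_eq_iff\<close>)

text \<open>
  For right modules, paths are prolonged at their start.  A trivial path at a vertex other than the end
  of \<open>\<alpha>\<close> must not be prolonged by \<open>\<alpha>\<close>, but the pair \<open>(tail Q \<alpha>, [\<alpha>])\<close> no longer shows at which vertex the
  trivial path was.  Therefore the basis consists of options, where \<open>None\<close> stands for a failed prolongation.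
\<close>

definition ext_left :: "('v, 'e) path option \<Rightarrow> 'e \<Rightarrow> ('v, 'e) path option" where
  "ext_left x \<alpha> = (case x of None \<Rightarrow> None
    | Some p \<Rightarrow> if fst p = head Q \<alpha> then Some (tail Q \<alpha>, \<alpha> # snd p) else None)"

lemma ext_left_nonzeroD:
  assumes "p \<in> nonzero_paths" "\<alpha> \<in> arcs Q" "ext_left (Some p) \<alpha> \<in> Some ` nonzero_paths"
  shows "fst p = head Q \<alpha>" "ext_left (Some p) \<alpha> = Some (tail Q \<alpha>, \<alpha> # snd p)"
    "(tail Q \<alpha>, \<alpha> # snd p) \<in> nonzero_paths"
  using assms by (auto simp: ext_left_def split: if_splits)

lemma right_quadratic_monomial_ring: "quadratic_monomial_ring (opp_ring A) (Some ` nonzero_paths) (\<lambda>X p. rep_coef X (the p))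
  (\<lambda>p. path_length (the p)) (\<lambda>p. fst (the p)) (verts Q) (\<lambda>v. Some (v, [])) (\<lambda>v. path_class (v, []))
  (arcs Q) (head Q) (tail Q) (\<lambda>\<alpha>. path_class (tail Q \<alpha>, [\<alpha>])) ext_left (next_relation_arrow Q I)"
proof (intro quadratic_monomial_ring.intro quadratic_monomial_ring_axioms.intro)
  have [simp]: "carrier (opp_ring A) = carrier A" "X \<otimes>\<^bsub>opp_ring A\<^esub> Y = Y \<otimes>\<^bsub>A\<^esub> X"
    "X \<oplus>\<^bsub>opp_ring A\<^esub> Y = X \<oplus>\<^bsub>A\<^esub> Y" for X Y
    by (simp_all add: opp_ring_def)
  have img: "{p \<in> Some ` nonzero_paths. g (the p) \<noteq> (0 :: 'k)} = Some ` {p \<in> nonzero_paths. g p \<noteq> 0}" for g by auto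
  show "ring (opp_ring A)" by (rule ring_opp_ring[OF ring_A])
  show "finite (verts Q)" "finite (arcs Q)" by simp_all
  fix X Y assume "X \<in> carrier (opp_ring A)"
  then have X: "X \<in> carrier A" by simp
  show "finite {p \<in> Some ` nonzero_paths. rep_coef X (the p) \<noteq> 0}"
    unfolding img using finite_rep_coef[OF X] by simp
  show "rep_coef (X \<otimes>\<^bsub>opp_ring A\<^esub> path_class (v, [])) (the p) = (if fst (the p) = v then rep_coef X (the p) else 0)"
    if v: "v \<in> verts Q" and p: "p \<in> Some ` nonzero_paths" for v p
  proof -
    obtain u w where q: "p = Some (u, w)" "(u, w) \<in> nonzero_paths" using p by auto
    note mult = rep_coef_mult_path_left[OF X q(2), of "(v, [])"]
    show ?thesis
    proof (cases "u = v")
      case True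
      then have "((v, []), (u, w)) \<in> splits Q (u, w)"
        using v nonzero_pathD[OF q(2)] by (simp add: splits_def cat_def)
      then show ?thesis using mult(1) True v q(1) by simp
    next
      case False
      then have "((v, []), r) \<notin> splits Q (u, w)" for r by (simp add: splits_def cat_def)
      then show ?thesis using mult(2) False v q(1) by simp
    qed
  qed
  assume "Y \<in> carrier (opp_ring A)"
  then have Y: "Y \<in> carrier A" by simp
  show "X = Y" if "\<And>p. p \<in> Some ` nonzero_paths \<Longrightarrow> rep_coef X (the p) = rep_coef Y (the p)"
    by (rule rep_coef_eqI[OF X Y]) (use that in force)
  show "rep_coef (X \<oplus>\<^bsub>opp_ring A\<^esub> Y) (the p) = rep_coef X (the p) + rep_coef Y (the p)"
    if "p \<in> Some ` nonzero_paths" for p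
    using rep_coef_add[OF X Y] that by auto
  show "\<exists>p\<in>Some ` nonzero_paths. \<exists>q\<in>Some ` nonzero_paths. rep_coef X (the p) \<noteq> 0 \<and> rep_coef Y (the q) \<noteq> 0 \<and>
      path_length (the r) = path_length (the p) + path_length (the q)"
    if "r \<in> Some ` nonzero_paths" "rep_coef (X \<otimes>\<^bsub>opp_ring A\<^esub> Y) (the r) \<noteq> 0" for r
  proof -
    have "the r \<in> nonzero_paths" "rep_coef (Y \<otimes>\<^bsub>A\<^esub> X) (the r) \<noteq> 0" using that by auto
    from rep_coef_mult_nonzero[OF Y X this] obtain p q where "p \<in> nonzero_paths" "q \<in> nonzero_paths"
      "rep_coef Y p \<noteq> 0" "rep_coef X q \<noteq> 0" "path_length (the r) = path_length q + path_length p"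
      by (auto simp: add.commute)
    then show ?thesis by (intro bexI[of _ "Some q"] bexI[of _ "Some p"]) auto
  qed
  show "rep_coef (X \<otimes>\<^bsub>opp_ring A\<^esub> Y) (the (Some (v, []))) =
      rep_coef X (the (Some (v, []))) * rep_coef Y (the (Some (v, [])))" if "v \<in> verts Q" for v
    using rep_coef_mult_trivial[OF Y X that] by simp
next
  fix f :: "('v, 'e) path option \<Rightarrow> 'k" assume fin: "finite {p \<in> Some ` nonzero_paths. f p \<noteq> 0}"
  have "{p \<in> Some ` nonzero_paths. f p \<noteq> 0} = Some ` {p \<in> nonzero_paths. f (Some p) \<noteq> 0}" by auto
  then have "finite {p \<in> nonzero_paths. f (Some p) \<noteq> 0}" using fin finite_imageD[of Some] by (simp add: inj_on_def)
  from rep_coef_surj[OF this]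
  show "\<exists>y\<in>carrier (opp_ring A). \<forall>p\<in>Some ` nonzero_paths. rep_coef y (the p) = f p"
    by (auto simp: opp_ring_def)
next
  fix X x \<alpha> \<beta> assume "X \<in> carrier (opp_ring A)" and "x \<in> Some ` nonzero_paths"
    and arcs: "\<alpha> \<in> arcs Q" "\<beta> \<in> arcs Q" and ext: "ext_left x \<alpha> \<in> Some ` nonzero_paths"
  then obtain p where p: "p \<in> nonzero_paths" "x = Some p" and X: "X \<in> carrier A" by (auto simp: opp_ring_def)
  let ?r = "(tail Q \<alpha>, \<alpha> # snd p)"
  note e = ext_left_nonzeroD[OF p(1) arcs(1) ext[unfolded p(2)]]
  have "rep_coef (path_class (tail Q \<beta>, [\<beta>]) \<otimes>\<^bsub>A\<^esub> X) ?r = (if \<alpha> = \<beta> then rep_coef X p else 0)"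
  proof (cases "\<alpha> = \<beta>")
    case True
    then have "((tail Q \<beta>, [\<beta>]), p) \<in> splits Q ?r"
      using p arcs e(1) nonzero_pathD by (auto simp: splits_def cat_def)
    then show ?thesis using rep_coef_mult_path_left(1)[OF X e(3)] True arcs by simp
  next
    case False
    then have "((tail Q \<beta>, [\<beta>]), q) \<notin> splits Q ?r" for q by (auto simp: splits_def cat_def)
    then show ?thesis using rep_coef_mult_path_left(2)[OF X e(3)] False arcs by simp
  qed
  then show "rep_coef (X \<otimes>\<^bsub>opp_ring A\<^esub> path_class (tail Q \<beta>, [\<beta>])) (the (ext_left x \<alpha>)) =
      (if \<alpha> = \<beta> then rep_coef X (the x) else 0)"
    unfolding p(2) e(2) option.sel by (simp only: mult_opp_ring)
next
  fix X x \<beta> assume "X \<in> carrier (opp_ring A)" and "x \<in> Some ` nonzero_paths" "path_length (the x) = 0"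
    and \<beta>: "\<beta> \<in> arcs Q"
  then obtain q where q: "q \<in> nonzero_paths" "x = Some q" "path_length q = 0" and X: "X \<in> carrier A"
    by (auto simp: opp_ring_def)
  then have "((tail Q \<beta>, [\<beta>]), p) \<notin> splits Q q" for p
    by (auto simp: splits_def cat_def path_length_def)
  then show "rep_coef (X \<otimes>\<^bsub>opp_ring A\<^esub> path_class (tail Q \<beta>, [\<beta>])) (the x) = 0"
    using rep_coef_mult_path_left(2)[OF X q(1)] \<beta> by (simp add: opp_ring_def q(2))
next
  fix x \<alpha> assume "x \<in> Some ` nonzero_paths" and \<alpha>: "\<alpha> \<in> arcs Q" and ext: "ext_left x \<alpha> \<in> Some ` nonzero_paths"
  then obtain p where p: "p \<in> nonzero_paths" "x = Some p" by blast
  show "fst (the x) = head Q \<alpha> \<and> fst (the (ext_left x \<alpha>)) = tail Q \<alpha> \<and>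
      path_length (the (ext_left x \<alpha>)) = Suc (path_length (the x))"
    using ext_left_nonzeroD(1,2)[OF p(1) \<alpha> ext[unfolded p(2)]] by (simp add: p(2) path_length_def)
next
  fix x \<alpha> assume "x \<in> Some ` nonzero_paths" and \<alpha>: "\<alpha> \<in> arcs Q" "fst (the x) = head Q \<alpha>"
    and ext: "ext_left x \<alpha> \<notin> Some ` nonzero_paths"
  then obtain p where p: "p \<in> nonzero_paths" "x = Some p" "fst p = head Q \<alpha>" by auto
  then have "(tail Q \<alpha>, \<alpha> # snd p) \<notin> nonzero_paths" using ext by (auto simp: ext_left_def)
  moreover have hp: "(head Q \<alpha>, snd p) \<in> nonzero_paths" using p by (metis prod.collapse)
  ultimately have w: "snd p \<noteq> []" "rel \<alpha> (hd (snd p))"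
    using nonzero_path_Cons_iff[of \<alpha> "snd p"] \<alpha> by auto
  then obtain \<gamma> w where c: "snd p = \<gamma> # w" by (cases "snd p") auto
  then have g: "(head Q \<gamma>, w) \<in> nonzero_paths" "tail Q \<gamma> = head Q \<alpha>"
    using nonzero_path_ConsD[of "head Q \<alpha>" \<gamma> w] hp by auto
  then have "x = ext_left (Some (head Q \<gamma>, w)) \<gamma>"
    using p c by (simp add: ext_left_def prod_eq_iff)
  then show "\<exists>\<gamma>. next_relation_arrow Q I \<alpha> = Some \<gamma> \<and> (\<exists>p'\<in>Some ` nonzero_paths. x = ext_left p' \<gamma>)"
    using w(2) c g(1) next_relation_arrow_iff[OF \<alpha>(1)] by auto
next
  fix x \<alpha> \<gamma> assume "x \<in> Some ` nonzero_paths" and \<alpha>: "\<alpha> \<in> arcs Q" "next_relation_arrow Q I \<alpha> = Some \<gamma>"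
    and ext: "ext_left x \<gamma> \<in> Some ` nonzero_paths"
  then obtain p where p: "p \<in> nonzero_paths" "x = Some p" by blast
  have rel: "rel \<alpha> \<gamma>" using \<alpha> next_relation_arrow_iff by blast
  then have \<gamma>: "\<gamma> \<in> arcs Q" "tail Q \<gamma> = head Q \<alpha>" using relD by auto
  note e = ext_left_nonzeroD[OF p(1) \<gamma>(1) ext[unfolded p(2)]]
  show "ext_left (ext_left x \<gamma>) \<alpha> \<notin> Some ` nonzero_paths"
  proof
    assume "ext_left (ext_left x \<gamma>) \<alpha> \<in> Some ` nonzero_paths"
    then have "(tail Q \<alpha>, \<alpha> # \<gamma> # snd p) \<in> nonzero_paths"
      using ext_left_nonzeroD(3)[OF e(3) \<alpha>(1)] by (simp add: p(2) e(2))
    then show False using rel by (simp add: nonzero_paths_def)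
  qed
next
  fix \<alpha> \<gamma> assume "\<alpha> \<in> arcs Q" "next_relation_arrow Q I \<alpha> = Some \<gamma>"
  then show "\<gamma> \<in> arcs Q \<and> tail Q \<gamma> = head Q \<alpha>"
    using relD[of \<alpha> \<gamma>] next_relation_arrow_iff by auto
next
  fix x assume "x \<in> Some ` nonzero_paths" "path_length (the x) \<noteq> 0"
  then obtain u \<alpha> w where x: "x = Some (u, \<alpha> # w)" "(u, \<alpha> # w) \<in> nonzero_paths"
    by (auto simp: path_length_def neq_Nil_conv)
  then have "(head Q \<alpha>, w) \<in> nonzero_paths" "\<alpha> \<in> arcs Q" "x = ext_left (Some (head Q \<alpha>, w)) \<alpha>"
    using nonzero_path_ConsD[OF x(2)] by (auto simp: ext_left_def)
  then show "\<exists>p\<in>Some ` nonzero_paths. \<exists>\<alpha>\<in>arcs Q. x = ext_left p \<alpha>" by blast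
next
  fix x x' \<alpha> \<alpha>' assume "x \<in> Some ` nonzero_paths" "x' \<in> Some ` nonzero_paths" and arcs: "\<alpha> \<in> arcs Q" "\<alpha>' \<in> arcs Q"
    and ext: "ext_left x \<alpha> \<in> Some ` nonzero_paths" "ext_left x \<alpha> = ext_left x' \<alpha>'"
  then obtain p p' where p: "p \<in> nonzero_paths" "x = Some p" "p' \<in> nonzero_paths" "x' = Some p'" by blast
  then show "x = x' \<and> \<alpha> = \<alpha>'"
    using ext ext_left_nonzeroD[OF p(1) arcs(1)] ext_left_nonzeroD[OF p(3) arcs(2)]
    by (auto simp: prod_eq_iff)
next
  show "fst (the p) \<in> verts Q" if "p \<in> Some ` nonzero_paths" for p
    using that path_start_in[OF nonzero_pathD] by auto
next
  fix v p assume "v \<in> verts Q" "p \<in> Some ` nonzero_paths"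
  then show "rep_coef (path_class (v, [])) (the p) = (if p = Some (v, []) then 1 else 0)"
    by (auto simp: rep_coef_path_class split: if_splits)
qed (use mult_idem_arrow in \<open>auto simp: trivial_nonzero_path path_length_def path_class_in prod_eq_iff
      opp_ring_def\<close>)

lemma relation_chain_next_relation_arrow:
  "relation_chain (next_relation_arrow Q I) \<alpha> n = full_relation_path Q I \<alpha> n"
  by (induction n) simp_all

lemma length_grading_eq:
  "length_grading Q I n = {X \<in> carrier A. \<forall>p\<in>nonzero_paths. rep_coef X p \<noteq> 0 \<longrightarrow> path_length p = n}"
proof (intro equalityI subsetI)
  fix X assume "X \<in> length_grading Q I n"
  then obtain f where f: "f \<in> carrier (path_algebra Q)" "X = cls f"
    and "\<forall>p. f p \<noteq> 0 \<longrightarrow> path_length p = n"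
    by (auto simp: length_grading_def)
  then show "X \<in> {X \<in> carrier A. \<forall>p\<in>nonzero_paths. rep_coef X p \<noteq> 0 \<longrightarrow> path_length p = n}"
    using cls_in[OF f(1)] by (auto simp: rep_coef_cls)
next
  fix X assume X: "X \<in> {X \<in> carrier A. \<forall>p\<in>nonzero_paths. rep_coef X p \<noteq> 0 \<longrightarrow> path_length p = n}"
  define f where "f = (\<lambda>p. if p \<in> nonzero_paths then rep_coef X p else 0)"
  have "{p. f p \<noteq> 0} = {p \<in> nonzero_paths. rep_coef X p \<noteq> 0}" by (auto simp: f_def)
  then have f: "f \<in> carrier (path_algebra Q)"
    using finite_rep_coef[of X] X nonzero_pathD unfolding path_algebra_simps(1) by auto
  have "X = cls f"
    by (rule rep_coef_eqI) (use X f cls_in in \<open>auto simp: rep_coef_cls\<close>, auto simp: f_def)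
  then show "X \<in> length_grading Q I n"
    using f X by (auto simp: length_grading_def f_def split: if_splits intro!: exI[of _ f])
qed

text \<open>
  The Koszul property concerns left modules, so here arrows are appended.
\<close>

lemma koszul_path_quotient: "koszul A (length_grading Q I)"
proof -
  interpret L: quadratic_monomial_ring A nonzero_paths rep_coef path_length "path_end Q" "verts Q"
    "\<lambda>v. (v, [])" "\<lambda>v. path_class (v, [])" "arcs Q" "tail Q" "head Q"
    "\<lambda>\<alpha>. path_class (tail Q \<alpha>, [\<alpha>])" "\<lambda>p \<alpha>. (fst p, snd p @ [\<alpha>])" previous_relation_arrow
    by (rule left_quadratic_monomial_ring)
  have grading: "length_grading Q I = L.grading"
    by (rule ext) (simp add: length_grading_eq L.homog_def)
  show ?thesis unfolding grading by (rule L.koszul)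
qed

text \<open>
  The resolution for the opposite ring with the single vertex \<open>i\<close> and all arrows starting in \<open>i\<close>.  Its
  terms are indexed by arrows, and the chain of relations of an arrow is its path with full relations.  The term of degree
  \<open>0\<close> is a sum over one index, for which any value of the type of arrows will do.
\<close>

lemma vertex_simple_resolution:
  assumes i: "i \<in> verts Q"
  shows "\<exists>(P :: nat \<Rightarrow> ((('v, 'e) path \<Rightarrow> 'k) set, 'e \<Rightarrow> (('v, 'e) path \<Rightarrow> 'k) set) graded_module) d \<epsilon>.
    graded_projective_resolution (opp_ring A) (length_grading Q I) P d \<epsilon> (vertex_simple Q I i) \<and>
    graded_iso (opp_ring A) (P 0) (vertex_projective Q I i) \<and>
    (\<forall>n. graded_iso (opp_ring A) (P (Suc n)) (shift (int (Suc n)) (full_relation_term Q I i n)))"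
proof -
  interpret R: quadratic_monomial_ring "opp_ring A" "Some ` nonzero_paths" "\<lambda>X p. rep_coef X (the p)"
    "\<lambda>p. path_length (the p)" "\<lambda>p. fst (the p)" "verts Q" "\<lambda>v. Some (v, [])"
    "\<lambda>v. path_class (v, [])" "arcs Q" "head Q" "tail Q" "\<lambda>\<alpha>. path_class (tail Q \<alpha>, [\<alpha>])"
    ext_left "next_relation_arrow Q I"
    by (rule right_quadratic_monomial_ring)
  interpret R: monomial_resolution "opp_ring A" "Some ` nonzero_paths" "\<lambda>X p. rep_coef X (the p)"
    "\<lambda>p. path_length (the p)" "\<lambda>p. fst (the p)" "verts Q" "\<lambda>v. Some (v, [])"
    "\<lambda>v. path_class (v, [])" "arcs Q" "head Q" "tail Q" "\<lambda>\<alpha>. path_class (tail Q \<alpha>, [\<alpha>])"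
    ext_left "next_relation_arrow Q I" "{undefined :: 'e}" "\<lambda>_. i" "out_arcs Q i" "\<lambda>\<alpha>. \<alpha>" "\<lambda>_. undefined"
    by unfold_locales (use i in \<open>auto simp: bij_betw_def inj_on_def\<close>)
  have carA: "carrier (opp_ring A) = carrier A" "\<zero>\<^bsub>opp_ring A\<^esub> = \<zero>\<^bsub>A\<^esub>" "add (opp_ring A) = add A"
    "mult (opp_ring A) = (\<lambda>a x. x \<otimes>\<^bsub>A\<^esub> a)"
    by (simp_all add: opp_ring_def)
  have grading: "length_grading Q I = R.grading"
    by (rule ext) (auto simp: length_grading_eq R.homog_def carA)
  interpret A: ring A by (rule ring_A)
  have proj: "carrier (vertex_projective Q I v) = R.ideal_at v"
    "zero (vertex_projective Q I v) = \<zero>\<^bsub>A\<^esub>" "add (vertex_projective Q I v) = add A"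
    "smult (vertex_projective Q I v) = (\<lambda>a x. x \<otimes>\<^bsub>A\<^esub> a)"
    "grade (vertex_projective Q I v) = (\<lambda>k. R.ideal_at v \<inter> R.homog k)"
    if v: "v \<in> verts Q" for v
  proof -
    let ?e = "path_class (v, [])"
    have e: "?e \<in> carrier A" "?e \<otimes>\<^bsub>A\<^esub> ?e = ?e"
      using v by (simp_all add: path_class_in mult_path_class cat_def)
    show car: "carrier (vertex_projective Q I v) = R.ideal_at v"
    proof (intro equalityI subsetI)
      fix y assume "y \<in> carrier (vertex_projective Q I v)"
      then obtain a where a: "a \<in> carrier A" "y = ?e \<otimes>\<^bsub>A\<^esub> a"
        by (auto simp: vertex_projective_def Let_def)
      have "?e \<otimes>\<^bsub>A\<^esub> y = y"
        unfolding a(2) by (subst A.m_assoc[OF e(1) e(1) a(1), symmetric]) (simp only: e(2))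
      then show "y \<in> R.ideal_at v" using a e(1) by (simp add: R.ideal_at_def carA)
    next
      fix y assume "y \<in> R.ideal_at v"
      then have "y \<in> carrier A" "y = ?e \<otimes>\<^bsub>A\<^esub> y" by (simp_all add: R.ideal_at_def carA)
      then show "y \<in> carrier (vertex_projective Q I v)"
        unfolding vertex_projective_def Let_def by auto
    qed
    have "grade (vertex_projective Q I v) k = R.ideal_at v \<inter> R.homog k" for k
    proof (cases "k < 0")
      case True
      then show ?thesis
        using R.homog_negative[OF True] additive_subgroup.zero_closed[OF R.additive_subgroup_ideal_at[OF v]]
        by (auto simp: vertex_projective_def Let_def carA)
    next
      case False
      have "grade (vertex_projective Q I v) k = carrier (vertex_projective Q I v) \<inter> length_grading Q I (nat k)"
        using False by (simp add: vertex_projective_def Let_def)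
      then show ?thesis using False by (simp add: car grading)
    qed
    then show "grade (vertex_projective Q I v) = (\<lambda>k. R.ideal_at v \<inter> R.homog k)" by blast
  qed (simp_all add: vertex_projective_def Let_def)
  have sum_eq: "graded_direct_sum J (\<lambda>j. R.principal (w j)) = graded_direct_sum J (\<lambda>j. vertex_projective Q I (w j))"
    if "w \<in> J \<rightarrow> verts Q" for w and J :: "'e set"
    by (rule graded_direct_sum_cong) (use that in \<open>auto simp: R.principal_def proj carA Pi_iff\<close>)
  have "vertex_simple Q I i = R.simple_at i"
    by (simp add: vertex_simple_def R.simple_at_def) (simp add: rep_coef_def)
  then have "graded_projective_resolution (opp_ring A) (length_grading Q I) R.res R.diff
      (\<lambda>f. rep_coef (f undefined) (the (Some (i, [])))) (vertex_simple Q I i)"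
    unfolding grading by (simp only:) (rule R.simple_resolution; simp)
  moreover have "graded_iso (opp_ring A) (R.res 0) (vertex_projective Q I i)"
  proof -
    have "R.res 0 = graded_direct_sum {undefined} (\<lambda>_. vertex_projective Q I i)"
      using sum_eq[of "\<lambda>_. i" "{undefined}"] i by (simp add: R.principal_sum_def shift_0)
    moreover have "grade (vertex_projective Q I i) n \<subseteq> carrier (vertex_projective Q I i)" for n
      by (simp add: proj i)
    ultimately show ?thesis using graded_iso_singleton_sum by metis
  qed
  moreover have "graded_iso (opp_ring A) (R.res (Suc n)) (shift (int (Suc n)) (full_relation_term Q I i n))" for n
  proof -
    have "R.links n = {\<alpha> \<in> out_arcs Q i. full_relation_path Q I \<alpha> n \<noteq> None}"
      "R.link n = (\<lambda>\<alpha>. the (full_relation_path Q I \<alpha> n))"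
      by (simp_all add: R.links_def R.link_def relation_chain_next_relation_arrow fun_eq_iff)
    then have "R.res (Suc n) = shift (int (Suc n)) (full_relation_term Q I i n)"
      using sum_eq[OF R.src_link_in, of n]
      by (simp add: R.principal_sum_def full_relation_term_def)
    then show ?thesis using graded_iso_refl by metis
  qed
  ultimately show ?thesis by blast
qed

end

theorem proposition3p4:
  fixes Q :: "('v, 'e) pre_digraph"
    and I :: "(('v, 'e) path \<Rightarrow> 'k::field) set"
  assumes "locally_gentle Q I"
  shows "(\<forall>i\<in>verts Q.
      \<exists>(P :: nat \<Rightarrow> ((('v, 'e) path \<Rightarrow> 'k) set, 'e \<Rightarrow> (('v, 'e) path \<Rightarrow> 'k) set) graded_module) d \<epsilon>.
        graded_projective_resolution (opp_ring (path_quotient Q I)) (length_grading Q I)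
          P d \<epsilon> (vertex_simple Q I i) \<and>
        graded_iso (opp_ring (path_quotient Q I)) (P 0) (vertex_projective Q I i) \<and>
        (\<forall>n. graded_iso (opp_ring (path_quotient Q I)) (P (Suc n))
               (shift (int (Suc n)) (full_relation_term Q I i n))))
    \<and> koszul (path_quotient Q I) (length_grading Q I)"
proof -
  obtain S where S: "S \<subseteq> {p \<in> paths Q. path_length p = 2}" "I = Idl\<^bsub>path_algebra Q\<^esub> (path_elt ` S)"
    using assms by (auto simp: locally_gentle_def)
  have "fin_digraph Q" "ideal I (path_algebra Q)"
    using assms by (auto simp: locally_gentle_def admissible_def)
  then interpret quadratic_path_ideal Q I S
    using S by (intro quadratic_path_ideal.intro quadratic_path_ideal_axioms.intro)
  have gentle: "\<forall>\<alpha>\<in>arcs Q.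
      (\<exists>\<^sub>\<le>\<^sub>1\<beta>. \<beta> \<in> arcs Q \<and> head Q \<alpha> = tail Q \<beta> \<and>
        arrow_elt Q \<alpha> \<otimes>\<^bsub>path_algebra Q\<^esub> arrow_elt Q \<beta> \<in> I) \<and>
      (\<exists>\<^sub>\<le>\<^sub>1\<gamma>. \<gamma> \<in> arcs Q \<and> head Q \<gamma> = tail Q \<alpha> \<and>
        arrow_elt Q \<gamma> \<otimes>\<^bsub>path_algebra Q\<^esub> arrow_elt Q \<alpha> \<in> I)"
    using assms by (simp add: locally_gentle_def)
  interpret gentle_path_ideal Q I S
  proof
    have rel_in: "rel \<alpha> \<beta> \<Longrightarrow> \<alpha> \<in> arcs Q \<and> \<beta> \<in> arcs Q \<and> head Q \<alpha> = tail Q \<beta> \<and>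
        arrow_elt Q \<alpha> \<otimes>\<^bsub>path_algebra Q\<^esub> arrow_elt Q \<beta> \<in> I" for \<alpha> \<beta>
      using relD[of \<alpha> \<beta>] arrow_mult_mem_ideal_iff[of \<alpha> \<beta>] by blast
    show "\<beta> = \<gamma>" if "rel \<alpha> \<beta>" "rel \<alpha> \<gamma>" for \<alpha> \<beta> \<gamma>
      using gentle rel_in[OF that(1)] rel_in[OF that(2)] unfolding Uniq_def by blast
    show "\<beta> = \<gamma>" if "rel \<beta> \<alpha>" "rel \<gamma> \<alpha>" for \<alpha> \<beta> \<gamma>
      using gentle rel_in[OF that(1)] rel_in[OF that(2)] unfolding Uniq_def by blast
  qed
  show ?thesis
    using vertex_simple_resolution koszul_path_quotient by blast
qed

end
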